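(* Let the dimension $N\ge1$ be fixed, let $q_c:=\frac{N+2}{N+1}$ and let $q\in(1,q_c]$. There is a constant $K=K(q)\ge0$ such that the following holds. Let $u_0\in L^1(\mathbb{R}^N)\cap W^{1,\infty}(\mathbb{R}^N)$ be non-positive with $u_0\not\equiv0$, and let $u$ be the solution of $u_t-\Delta u+|\nabla u|^q=0$ in $\mathbb{R}^N\times(0,\infty)$, $u(\cdot,0)=u_0$. If $u_0\in W^{2,\infty}(\mathbb{R}^N)$ fulfils $$\|u_0\|_\infty\,\left\|(\Delta u_0)^+\right\|_\infty^{1-2/q}>K,$$ then $$\lim_{t\to\infty}\|u(t)\|_\infty>0.$$ Furthermore, if $N\le3$ and $1<q<\dfrac{4}{1+\sqrt{1+2N}}$, then $K(q)=0$ (that is, the preceding assertion holds with $K=0$).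
   Context: For $q>1$ and every $u_0\in W^{1,\infty}(\mathbb{R}^N)$, the Cauchy problem $u_t-\Delta u+|\nabla u|^q=0$, $u(\cdot,0)=u_0$, has a unique global-in-time classical solution $u\in\mathcal{C}(\mathbb{R}^N\times[0,\infty))\cap\mathcal{C}^{2,1}(\mathbb{R}^N\times(0,\infty))$; it satisfies $\|u(t)\|_\infty\le\|u_0\|_\infty$ and $\|\nabla u(t)\|_\infty\le\|\nabla u_0\|_\infty$ for all $t>0$. "The solution" means this one. If $u_0\le0$ then $u\le0$; moreover $t\mapsto\|u(t)\|_\infty$ is non-increasing. For a real number $r$, $r^+:=\max\{r,0\}$. $\|\cdot\|_\infty$ is the $L^\infty(\mathbb{R}^N)$-norm and $u(t)=u(\cdot,t)$. *)

theory Defs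
  imports "HOL-Analysis.Analysis" "HOL-Probability.Essential_Supremum"
begin

text \<open>The space \<open>\<real>\<^sup>N\<close> is an arbitrary type \<open>'a::euclidean_space\<close> with \<open>N = DIM('a) \<ge> 1\<close>;
  coordinate directions are the elements \<open>b \<in> Basis\<close>.\<close>

section \<open>Classical derivatives\<close>

definition has_pd :: "'a::euclidean_space \<Rightarrow> ('a \<Rightarrow> real) \<Rightarrow> 'a \<Rightarrow> bool" where
  "has_pd b f x \<longleftrightarrow> (\<lambda>s::real. f (x + s *\<^sub>R b)) differentiable (at 0)"

definition pd :: "'a::euclidean_space \<Rightarrow> ('a \<Rightarrow> real) \<Rightarrow> 'a \<Rightarrow> real" where
  "pd b f x = deriv (\<lambda>s::real. f (x + s *\<^sub>R b)) 0"

definition grad :: "('a::euclidean_space \<Rightarrow> real) \<Rightarrow> 'a \<Rightarrow> 'a" where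
  "grad f x = (\<Sum>b\<in>Basis. pd b f x *\<^sub>R b)"

definition laplacian :: "('a::euclidean_space \<Rightarrow> real) \<Rightarrow> 'a \<Rightarrow> real" where
  "laplacian f x = (\<Sum>b\<in>Basis. pd b (pd b f) x)"

text \<open>\<open>C_k k f\<close>: all partial derivatives of \<open>f\<close> of order at most \<open>k\<close> exist and are continuous
  on the whole space.\<close>

primrec C_k :: "nat \<Rightarrow> ('a::euclidean_space \<Rightarrow> real) \<Rightarrow> bool" where
  "C_k 0 f \<longleftrightarrow> continuous_on UNIV f"
| "C_k (Suc k) f \<longleftrightarrow>
     continuous_on UNIV f \<and> (\<forall>b\<in>Basis. (\<forall>x. has_pd b f x) \<and> C_k k (pd b f))"

text \<open>Functions of time and space are written \<open>u t x\<close>. The class \<open>C\<^sup>2\<^sup>,\<^sup>1\<close> on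
  \<open>\<real>\<^sup>N \<times> (0,\<infinity>)\<close>: the derivatives \<open>u\<^sub>t\<close>, \<open>\<partial>\<^sub>b u\<close>, \<open>\<partial>\<^sub>c \<partial>\<^sub>b u\<close> exist and are jointly continuous
  in time and space; \<open>C_k 2 (u t)\<close> is there for the existence of the spatial ones.\<close>

definition C21 :: "(real \<Rightarrow> 'a::euclidean_space \<Rightarrow> real) \<Rightarrow> bool" where
  "C21 u \<longleftrightarrow>
     continuous_on ({0<..} \<times> UNIV) (\<lambda>(t, x). u t x) \<and>
     (\<forall>t>0. \<forall>x. (\<lambda>s. u s x) differentiable (at t)) \<and>
     continuous_on ({0<..} \<times> UNIV) (\<lambda>(t, x). deriv (\<lambda>s. u s x) t) \<and>
     (\<forall>t>0. C_k 2 (u t)) \<and>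
     (\<forall>b\<in>Basis. continuous_on ({0<..} \<times> UNIV) (\<lambda>(t, x). pd b (u t) x)) \<and>
     (\<forall>b\<in>Basis. \<forall>c\<in>Basis.
        continuous_on ({0<..} \<times> UNIV) (\<lambda>(t, x). pd c (pd b (u t)) x))"

section \<open>The space \<open>L\<^sup>\<infinity>\<close>\<close>

definition Linf_enorm :: "('a::euclidean_space \<Rightarrow> 'b::euclidean_space) \<Rightarrow> ereal" where
  "Linf_enorm f = esssup lebesgue (\<lambda>x. ereal (norm (f x)))"

definition Linf :: "('a::euclidean_space \<Rightarrow> 'b::euclidean_space) \<Rightarrow> bool" where
  "Linf f \<longleftrightarrow> f \<in> borel_measurable lebesgue \<and> Linf_enorm f < \<infinity>"

text \<open>As a real number the norm is only meaningful for \<open>f\<close> with \<open>Linf f\<close>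
  (\<open>real_of_ereal \<infinity> = 0\<close>).\<close>

definition Linf_norm :: "('a::euclidean_space \<Rightarrow> 'b::euclidean_space) \<Rightarrow> real" where
  "Linf_norm f = real_of_ereal (Linf_enorm f)"

section \<open>Weak derivatives and the Sobolev spaces \<open>W\<^sup>k\<^sup>,\<^sup>\<infinity>\<close>\<close>

definition test_fun :: "('a::euclidean_space \<Rightarrow> real) \<Rightarrow> bool" where
  "test_fun \<phi> \<longleftrightarrow> (\<forall>k. C_k k \<phi>) \<and> compact (closure {x. \<phi> x \<noteq> 0})"

definition L1_loc :: "('a::euclidean_space \<Rightarrow> real) \<Rightarrow> bool" where
  "L1_loc f \<longleftrightarrow> (\<forall>S. compact S \<longrightarrow> set_integrable lebesgue S f)"

definition has_weak_pd :: "'a::euclidean_space \<Rightarrow> ('a \<Rightarrow> real) \<Rightarrow> ('a \<Rightarrow> real) \<Rightarrow> bool" where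
  "has_weak_pd b f g \<longleftrightarrow> L1_loc f \<and> L1_loc g \<and>
     (\<forall>\<phi>. test_fun \<phi> \<longrightarrow>
        (\<integral>x. f x * pd b \<phi> x \<partial>lebesgue) = - (\<integral>x. g x * \<phi> x \<partial>lebesgue))"

text \<open>\<open>W_inf k f\<close>: \<open>f\<close> has weak derivatives up to order \<open>k\<close>, all of them in \<open>L\<^sup>\<infinity>\<close>.\<close>

primrec W_inf :: "nat \<Rightarrow> ('a::euclidean_space \<Rightarrow> real) \<Rightarrow> bool" where
  "W_inf 0 f \<longleftrightarrow> Linf f"
| "W_inf (Suc k) f \<longleftrightarrow> Linf f \<and> (\<forall>b\<in>Basis. \<exists>g. has_weak_pd b f g \<and> W_inf k g)"

text \<open>Weak derivatives are determined only up to null sets; \<open>weak_pd\<close> picks a representative.\<close>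

definition weak_pd :: "'a::euclidean_space \<Rightarrow> ('a \<Rightarrow> real) \<Rightarrow> 'a \<Rightarrow> real" where
  "weak_pd b f = (SOME g. has_weak_pd b f g)"

definition weak_grad :: "('a::euclidean_space \<Rightarrow> real) \<Rightarrow> 'a \<Rightarrow> 'a" where
  "weak_grad f x = (\<Sum>b\<in>Basis. weak_pd b f x *\<^sub>R b)"

definition weak_laplacian :: "('a::euclidean_space \<Rightarrow> real) \<Rightarrow> 'a \<Rightarrow> real" where
  "weak_laplacian f x = (\<Sum>b\<in>Basis. weak_pd b (weak_pd b f) x)"

section \<open>The Cauchy problem\<close>

text \<open>Global classical solutions of \<open>u\<^sub>t - \<Delta>u + \<bar>\<nabla>u\<bar>\<^sup>q = 0\<close>, \<open>u(0) = u\<^sub>0\<close>. As \<open>u\<^sub>0\<close> is an \<open>L\<^sup>\<infinity>\<close>-class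
  of functions, the initial condition is required almost everywhere, i.e. the continuous function
  \<open>u 0\<close> is the continuous representative of \<open>u\<^sub>0\<close>.\<close>

definition classical_solution ::
    "real \<Rightarrow> ('a::euclidean_space \<Rightarrow> real) \<Rightarrow> (real \<Rightarrow> 'a \<Rightarrow> real) \<Rightarrow> bool" where
  "classical_solution q u0 u \<longleftrightarrow>
     continuous_on ({0..} \<times> UNIV) (\<lambda>(t, x). u t x) \<and>
     C21 u \<and>
     (\<forall>t>0. \<forall>x. deriv (\<lambda>s. u s x) t - laplacian (u t) x + norm (grad (u t) x) powr q = 0) \<and>
     (AE x in lebesgue. u 0 x = u0 x)"

text \<open>The solution for \<open>u\<^sub>0 \<in> W\<^sup>1\<^sup>,\<^sup>\<infinity>\<close>: the classical solution that obeys the bounds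
  \<open>\<parallel>u(t)\<parallel>\<^sub>\<infinity> \<le> \<parallel>u\<^sub>0\<parallel>\<^sub>\<infinity>\<close> and \<open>\<parallel>\<nabla>u(t)\<parallel>\<^sub>\<infinity> \<le> \<parallel>\<nabla>u\<^sub>0\<parallel>\<^sub>\<infinity>\<close>. These fix the (otherwise tacit) class in which
  classical solutions are unique, excluding growth at spatial infinity.\<close>

definition is_solution ::
    "real \<Rightarrow> ('a::euclidean_space \<Rightarrow> real) \<Rightarrow> (real \<Rightarrow> 'a \<Rightarrow> real) \<Rightarrow> bool" where
  "is_solution q u0 u \<longleftrightarrow>
     classical_solution q u0 u \<and>
     (\<forall>t>0. Linf_enorm (u t) \<le> Linf_enorm u0 \<and>
            Linf_enorm (grad (u t)) \<le> Linf_enorm (weak_grad u0))"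

definition q_crit :: "nat \<Rightarrow> real" where
  "q_crit N = (real N + 2) / (real N + 1)"

end

theory Submission
  imports Defs "HOL-Computational_Algebra.Polynomial"
begin

text \<open>
  Everything rests on one comparison principle for bounded classical sub- and supersolutions,
  which needs no gradient bound: convexity of \<open>|p|\<^sup>q\<close> allows the subsolution \<open>w\<close> to be replaced by a convex
  combination of \<open>w\<close> with a strict subsolution tending to \<open>-\<infinity>\<close> at spatial infinity. Regularity of \<open>u\<close>
  beyond \<open>C\<^sup>2\<^sup>,\<^sup>1\<close> is never used, because derivative bounds are obtained by comparing \<open>u\<close> with
  combinations of its translates.
  Comparing \<open>u\<close> with \<open>\<lambda> u(t, x + t y)\<close> gives
  \<open>|\<nabla>u(t)| \<le> C (\<parallel>u\<^sub>0\<parallel> / t)\<^sup>1\<^sup>/\<^sup>q\<close>; comparing it with the mean of \<open>u(t, x \<plusminus> t y)\<close> and using the strong convexity of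
  \<open>|p|\<^sup>q\<close> on balls gives semiconcavity, and together
  \<open>\<Delta>u(t) \<le> C \<parallel>u\<^sub>0\<parallel>\<^sup>\<alpha> t\<^sup>-\<^sup>1\<^sup>-\<^sup>\<alpha>\<close> with \<open>\<alpha> = 2/q - 1 > 0\<close>. By Jensen, averages of \<open>u\<close> over random walks are again
  subsolutions, whence \<open>\<Delta>u(t) \<le> \<parallel>(\<Delta>u\<^sub>0)\<^sup>+\<parallel>\<close>.
  Since \<open>u\<^sub>t \<le> \<Delta>u\<close> and the minimum of these two bounds is integrable in time, \<open>u\<close> stays below a negative constant at a
  point where \<open>u\<^sub>0\<close> is almost minimal, once \<open>\<parallel>u\<^sub>0\<parallel> \<parallel>(\<Delta>u\<^sub>0)\<^sup>+\<parallel>\<^sup>-\<^sup>\<alpha>\<close> is large.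
  For small \<open>q\<close> this criterion is met by \<open>u(T)\<close> for large \<open>T\<close>: comparison with a
  difference of two heat kernels gives \<open>\<parallel>u(T)\<parallel> \<ge> c T\<^sup>-\<^sup>N\<^sup>/\<^sup>2\<close>, while \<open>\<Delta>u(t) \<le> C T\<^sup>-\<^sup>1\<^sup>-\<^sup>\<alpha>\<close> for \<open>t \<ge> T\<close>.
\<close>

section \<open>Partial derivatives\<close>

text \<open>The translates move: the shift t y vanishes at t = 0, so the derivative bounds ask
  nothing of u_0, but the equation acquires the drift y . grad u. This drift is paid for by what the
  convexity of |p|^q leaves over. A factor \<lambda> with 1 - \<lambda> proportional to |h| leaves a
  multiple of |p|^q; the loss is linear in h and bounds first derivatives. Opposite translates leave
  a multiple of the squared difference of two gradients; the loss is quadratic in h and bounds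
  second derivatives from above. The bound by the positive part of the Laplacian of u_0 cannot be
  read off a single average of second differences: along different axes these average the pure
  second derivatives of u_0 over different segments, whereas only the sum of these derivatives at a
  common point is bounded by A. A walk of n steps of length h with n h^2 = s imitates the heat flow
  as h tends to 0, and it raises u_0 by at most s A / (2 N) + o(1). Comparison carries this to time
  t, and small s then gives back the Laplacian of u(t).\<close>

lemma has_pd_line:
  assumes "has_pd b f (x + s *\<^sub>R b)"
  shows "((\<lambda>r. f (x + r *\<^sub>R b)) has_real_derivative pd b f (x + s *\<^sub>R b)) (at s)"
proof -
  have "((\<lambda>r. f ((x + s *\<^sub>R b) + r *\<^sub>R b)) has_real_derivative pd b f (x + s *\<^sub>R b)) (at 0)"
    using assms unfolding has_pd_def pd_def
    by (simp add: DERIV_deriv_iff_real_differentiable)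
  then have "((\<lambda>r. f (x + (r + s) *\<^sub>R b)) has_real_derivative pd b f (x + s *\<^sub>R b)) (at 0)"
    by (simp add: algebra_simps)
  then show ?thesis
    using DERIV_shift[of "\<lambda>r. f (x + r *\<^sub>R b)" "pd b f (x + s *\<^sub>R b)" 0 s] by simp
qed

lemma pdI:
  assumes "((\<lambda>s. f (x + s *\<^sub>R b)) has_real_derivative d) (at 0)"
  shows "has_pd b f x" "pd b f x = d"
  using assms unfolding has_pd_def pd_def
  by (auto intro: DERIV_imp_deriv simp: real_differentiable_def)

lemma has_pdD:
  assumes "has_pd b f x"
  shows "((\<lambda>s. f (x + s *\<^sub>R b)) has_real_derivative pd b f x) (at 0)"
  using has_pd_line[of b f x 0] assms by simp

lemma pd_shift: "pd b (\<lambda>x. f (x + z)) = (\<lambda>x. pd b f (x + z))"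
  and has_pd_shift: "has_pd b (\<lambda>x. f (x + z)) x \<longleftrightarrow> has_pd b f (x + z)"
  by (auto simp: fun_eq_iff pd_def has_pd_def add_ac)

lemma pd_sum:
  assumes "\<And>i x. i \<in> I \<Longrightarrow> has_pd b (f i) x"
  shows "has_pd b (\<lambda>x. \<Sum>i\<in>I. c i * f i x) x"
    and "pd b (\<lambda>x. \<Sum>i\<in>I. c i * f i x) = (\<lambda>x. \<Sum>i\<in>I. c i * pd b (f i) x)"
proof -
  have *: "((\<lambda>s. \<Sum>i\<in>I. c i * f i (x + s *\<^sub>R b)) has_real_derivative (\<Sum>i\<in>I. c i * pd b (f i) x)) (at 0)" for x
    by (intro DERIV_sum DERIV_cmult has_pdD assms)
  show "has_pd b (\<lambda>x. \<Sum>i\<in>I. c i * f i x) x"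
    by (rule pdI(1)[OF *])
  show "pd b (\<lambda>x. \<Sum>i\<in>I. c i * f i x) = (\<lambda>x. \<Sum>i\<in>I. c i * pd b (f i) x)"
    using pdI(2)[OF *] by blast
qed

lemma grad_inner: "b \<in> Basis \<Longrightarrow> grad f x \<bullet> b = pd b f x"
  unfolding grad_def by (simp add: inner_sum_left inner_Basis if_distrib sum.delta cong: if_cong)

section \<open>Real inequalities\<close>

lemma second_derivative_at_max:
  fixes G :: "real \<Rightarrow> real"
  assumes G: "\<And>s. (G has_real_derivative G' s) (at s)"
    and G': "(G' has_real_derivative D) (at 0)"
    and max: "\<And>s. G s \<le> G 0"
  shows "G' 0 = 0" "D \<le> 0"
proof -
  show 0: "G' 0 = 0"
    by (rule DERIV_local_max[OF G[of 0], of 1]) (use max in auto)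
  show "D \<le> 0"
  proof (rule ccontr)
    assume "\<not> D \<le> 0"
    then obtain d where d: "d > 0" "\<And>h. 0 < h \<Longrightarrow> h < d \<Longrightarrow> G' 0 < G' (0 + h)"
      using DERIV_pos_inc_right[OF G'] by auto
    obtain z where z: "0 < z" "z < d / 2" "G (d / 2) - G 0 = (d / 2 - 0) * G' z"
      using MVT2[of 0 "d / 2" G G'] G d(1) by auto
    have "G' z > 0" using d(2)[of z] z 0 d(1) by auto
    then have "G (d / 2) > G 0" using z(3) d(1) by (simp add: algebra_simps) (smt (verit) mult_pos_pos)
    then show False using max[of "d / 2"] by simp
  qed
qed

text \<open>\<open>r powr q - \<kappa> * r\<^sup>2\<close> is convex on (0, L]: as q \<le> 2, its
  second derivative is smallest at r = L, where the hypothesis on \<kappa> makes it nonnegative. The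
  value \<kappa> = 0 serves plain convexity, \<kappa> > 0 strong convexity.\<close>

lemma powr_tangent_line:
  fixes q :: real
  assumes q: "1 < q" "q \<le> 2" and \<kappa>: "2 * \<kappa> \<le> q * (q - 1) * L powr (q - 2)"
    and a: "0 \<le> a" "a \<le> L" and m: "0 < m" "m \<le> L"
  shows "m powr q - \<kappa> * m\<^sup>2 + (q * m powr (q - 1) - 2 * \<kappa> * m) * (a - m) \<le> a powr q - \<kappa> * a\<^sup>2"
proof -
  define f where "f r = r powr q - \<kappa> * r\<^sup>2" for r :: real
  define f' where "f' r = q * r powr (q - 1) - 2 * \<kappa> * r" for r :: real
  have f: "(f has_real_derivative f' r) (at r)" if "r > 0" for r
    unfolding f_def f'_def using that by (auto intro!: derivative_eq_intros)
  have f': "(f' has_real_derivative q * ((q - 1) * r powr (q - 2)) - 2 * \<kappa>) (at r)" if "r > 0" for r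
    unfolding f'_def using that by (auto intro!: derivative_eq_intros simp: algebra_simps)
  have mono: "f' x \<le> f' y" if "0 < x" "x \<le> y" "y \<le> L" for x y
  proof (rule DERIV_nonneg_imp_nondecreasing[OF \<open>x \<le> y\<close>])
    fix r assume r: "x \<le> r" "r \<le> y"
    have "L powr (q - 2) \<le> r powr (q - 2)"
      using r that q by (intro powr_mono2') auto
    then have "q * (q - 1) * L powr (q - 2) \<le> q * (q - 1) * r powr (q - 2)"
      using q by (intro mult_left_mono) auto
    then show "\<exists>D. (f' has_real_derivative D) (at r) \<and> 0 \<le> D"
      using f'[of r] r that \<kappa> by (intro exI[of _ "q * ((q - 1) * r powr (q - 2)) - 2 * \<kappa>"]) auto
  qed
  have cont: "continuous_on {0..} f"
    unfolding f_def using q by (intro continuous_intros continuous_on_powr') auto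
  have "f m + f' m * (a - m) \<le> f a"
  proof (cases a m rule: linorder_cases)
    case less
    have "continuous_on {a..m} f"
      by (rule continuous_on_subset[OF cont]) (use a in auto)
    moreover have "f differentiable (at z)" if "a < z" "z < m" for z
      using f[of z] that a by (auto simp: real_differentiable_def)
    ultimately obtain D z where z: "a < z" "z < m" "(f has_real_derivative D) (at z)" "f m - f a = (m - a) * D"
      using MVT[OF less, of f] by blast
    have "D = f' z" using DERIV_unique[OF z(3) f[of z]] z a by auto
    moreover have "f' z \<le> f' m" using mono[of z m] z a m by auto
    ultimately have "(m - a) * D \<le> (m - a) * f' m"
      using less by (intro mult_left_mono) auto
    then show ?thesis using z(4) by (simp add: algebra_simps)
  next
    case greater
    obtain z where z: "m < z" "z < a" "f a - f m = (a - m) * f' z"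
      using MVT2[OF greater, of f f'] f m by auto
    have "(a - m) * f' m \<le> (a - m) * f' z"
      using mono[of m z] z a m by (intro mult_left_mono) auto
    then show ?thesis using z(3) by (simp add: algebra_simps)
  qed simp
  then show ?thesis by (simp add: f_def f'_def)
qed

text \<open>The tangent at the norm m of the combination has nonnegative slope, so the triangle
  inequality can be inserted into it before the two tangent inequalities are added.\<close>

lemma convex_on_norm_powr:
  fixes q :: real
  assumes q: "1 < q" "q \<le> 2"
  shows "convex_on UNIV (\<lambda>p::'a::real_normed_vector. norm p powr q)"
proof (rule convex_onI)
  fix t :: real and x y :: 'a
  assume t: "0 < t" "t < 1"
  define m where "m = norm ((1 - t) *\<^sub>R x + t *\<^sub>R y)"
  show "norm ((1 - t) *\<^sub>R x + t *\<^sub>R y) powr q \<le> (1 - t) * norm x powr q + t * norm y powr q"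
  proof (cases "m = 0")
    case True
    then show ?thesis using t by (simp add: m_def)
  next
    case False
    then have m: "m > 0" by (simp add: m_def)
    have tri: "m \<le> (1 - t) * norm x + t * norm y"
      unfolding m_def using t norm_triangle_ineq[of "(1 - t) *\<^sub>R x" "t *\<^sub>R y"] by simp
    define L where "L = max m (max (norm x) (norm y))"
    have T: "m powr q + q * m powr (q - 1) * (a - m) \<le> a powr q" if "0 \<le> a" "a \<le> L" for a
      using powr_tangent_line[OF q, of 0 L a m] that m q by (simp add: L_def)
    have "m powr q \<le> m powr q + q * m powr (q - 1) * ((1 - t) * norm x + t * norm y - m)"
      using tri q by simp
    also have "\<dots> = (1 - t) * (m powr q + q * m powr (q - 1) * (norm x - m))
        + t * (m powr q + q * m powr (q - 1) * (norm y - m))"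
      by (simp add: algebra_simps)
    also have "\<dots> \<le> (1 - t) * norm x powr q + t * norm y powr q"
      using t T[of "norm x"] T[of "norm y"]
      by (intro add_mono mult_left_mono) (auto simp: L_def)
    finally show ?thesis by (simp add: m_def)
  qed
qed simp

text \<open>On the ball of radius L the function
  \<open>norm p powr q - \<kappa> * (norm p)\<^sup>2\<close> is midpoint convex, because its radial
  profile is convex and nondecreasing there; the parallelogram identity turns the quadratic parts
  into the gap \<open>\<kappa> / 4 * (norm (x - y))\<^sup>2\<close>. The ball is essential: for q <
  2 the convexity of |p|^q degenerates as |p| grows.\<close>

lemma norm_powr_midpoint_strong:
  fixes x y :: "'a::real_inner" and q :: real
  assumes q: "1 < q" "q \<le> 2" and \<kappa>: "0 \<le> \<kappa>" "2 * \<kappa> \<le> q * (q - 1) * L powr (q - 2)"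
    and x: "norm x \<le> L" and y: "norm y \<le> L"
  shows "norm ((1/2) *\<^sub>R x + (1/2) *\<^sub>R y) powr q + \<kappa> / 4 * (norm (x - y))\<^sup>2
    \<le> 1/2 * norm x powr q + 1/2 * norm y powr q"
proof -
  define m where "m = norm ((1/2) *\<^sub>R x + (1/2) *\<^sub>R y)"
  have par: "1/2 * (norm x)\<^sup>2 + 1/2 * (norm y)\<^sup>2 = m\<^sup>2 + (norm (x - y))\<^sup>2 / 4"
    by (simp add: m_def power2_norm_eq_inner inner_add_left inner_add_right inner_diff_left
        inner_diff_right inner_commute algebra_simps) (simp add: field_simps inner_commute)
  have tri: "m \<le> 1/2 * norm x + 1/2 * norm y"
    unfolding m_def using norm_triangle_ineq[of "(1/2) *\<^sub>R x" "(1/2) *\<^sub>R y"] by simp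
  have \<kappa>': "\<kappa> \<le> L powr (q - 2)"
  proof -
    have "q * (q - 1) \<le> 2 * 1" using q by (intro mult_mono) auto
    then have "q * (q - 1) * L powr (q - 2) \<le> 2 * L powr (q - 2)" 
      by (intro mult_right_mono) auto
    then show ?thesis using \<kappa> by simp
  qed
  have low: "\<kappa> * r\<^sup>2 \<le> r powr q" if "0 < r" "r \<le> L" for r
  proof -
    have "\<kappa> \<le> r powr (q - 2)"
      using \<kappa>' powr_mono2'[of "q - 2" r L] that q by auto
    then have "\<kappa> * r\<^sup>2 \<le> r powr (q - 2) * r powr 2"
      using that by (simp add: powr_numeral)
    also have "\<dots> = r powr q" by (simp flip: powr_add)
    finally show ?thesis .
  qed
  show ?thesis
  proof (cases "m = 0")
    case True
    \<comment> \<open>No tangent is available at m = 0. There the profile vanishes, and its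
      nonnegativity does the job.\<close>
    have "\<kappa> * r\<^sup>2 \<le> r powr q" if "0 \<le> r" "r \<le> L" for r
      using low[of r] that by (cases "r = 0") auto
    from this[of "norm x"] this[of "norm y"] x y
    have "1/2 * (\<kappa> * (norm x)\<^sup>2) + 1/2 * (\<kappa> * (norm y)\<^sup>2) \<le> 1/2 * norm x powr q + 1/2 * norm y powr q"
      by simp
    also have "1/2 * (\<kappa> * (norm x)\<^sup>2) + 1/2 * (\<kappa> * (norm y)\<^sup>2) = \<kappa> * (1/2 * (norm x)\<^sup>2 + 1/2 * (norm y)\<^sup>2)"
      by (simp add: algebra_simps)
    finally show ?thesis using True unfolding par m_def[symmetric] by simp
  next
    case False
    then have m: "m > 0" by (simp add: m_def)
    have mL: "m \<le> L" using tri x y by linarith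
    \<comment> \<open>The triangle inequality bounds m from above, so it may be inserted into the
      tangent only with a nonnegative slope.\<close>
    have slope: "0 \<le> q * m powr (q - 1) - 2 * \<kappa> * m"
    proof -
      have "2 * \<kappa> \<le> q * ((q - 1) * L powr (q - 2))" using \<kappa> by (simp add: mult.assoc)
      also have "\<dots> \<le> q * (1 * m powr (q - 2))"
        using q m mL by (intro mult_left_mono mult_mono powr_mono2') auto
      finally have "2 * \<kappa> * m \<le> q * m powr (q - 2) * m powr 1"
        using m by simp
      also have "\<dots> = q * m powr (q - 1)" 
        unfolding mult.assoc powr_add[symmetric] by simp
      finally show ?thesis by simp
    qed
    define S where "S = q * m powr (q - 1) - 2 * \<kappa> * m"
    have T: "m powr q - \<kappa> * m\<^sup>2 + S * (a - m) \<le> a powr q - \<kappa> * a\<^sup>2" if "0 \<le> a" "a \<le> L" for a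
      unfolding S_def by (rule powr_tangent_line[OF q \<kappa>(2) that m mL])
    have "m powr q - \<kappa> * m\<^sup>2 \<le> m powr q - \<kappa> * m\<^sup>2 + S * (1/2 * norm x + 1/2 * norm y - m)"
      using tri slope by (simp add: S_def)
    also have "\<dots> = 1/2 * (m powr q - \<kappa> * m\<^sup>2 + S * (norm x - m))
        + 1/2 * (m powr q - \<kappa> * m\<^sup>2 + S * (norm y - m))"
      by (simp add: algebra_simps)
    also have "\<dots> \<le> 1/2 * (norm x powr q - \<kappa> * (norm x)\<^sup>2) + 1/2 * (norm y powr q - \<kappa> * (norm y)\<^sup>2)"
      using T[of "norm x"] T[of "norm y"] x y by (intro add_mono mult_left_mono) auto
    also have "\<dots> = 1/2 * norm x powr q + 1/2 * norm y powr q - \<kappa> * (1/2 * (norm x)\<^sup>2 + 1/2 * (norm y)\<^sup>2)"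
      by (simp add: algebra_simps)
    finally show ?thesis unfolding par m_def[symmetric] by (simp add: algebra_simps)
  qed
qed

section \<open>Comparison principle\<close>

text \<open>Exactly the derivatives that are evaluated at an interior maximum. No continuity is
  included, so that sums, averages, moving translates and heat kernels qualify by differentiation
  rules alone.\<close>

definition hj_reg :: "(real \<Rightarrow> 'a::euclidean_space \<Rightarrow> real) \<Rightarrow> bool" where
  "hj_reg w \<longleftrightarrow> (\<forall>t>0. \<forall>x. (\<lambda>s. w s x) differentiable (at t) \<and>
     (\<forall>b\<in>Basis. has_pd b (w t) x \<and> has_pd b (pd b (w t)) x))"

text \<open>Subsolutions are the functions with defect at most 0, supersolutions those with defect
  at least 0.\<close>

definition hj_defect :: "real \<Rightarrow> (real \<Rightarrow> 'a::euclidean_space \<Rightarrow> real) \<Rightarrow> real \<Rightarrow> 'a \<Rightarrow> real" where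
  "hj_defect q w t x = deriv (\<lambda>s. w s x) t - laplacian (w t) x + norm (grad (w t) x) powr q"

lemma hj_regD:
  assumes "hj_reg w" "t > 0"
  shows "((\<lambda>s. w s x) has_real_derivative deriv (\<lambda>s. w s x) t) (at t)"
    and "b \<in> Basis \<Longrightarrow> has_pd b (w t) x"
    and "b \<in> Basis \<Longrightarrow> has_pd b (pd b (w t)) x"
  using assms unfolding hj_reg_def by (auto simp: DERIV_deriv_iff_real_differentiable)

text \<open>The penalty - sqrt (1 + |x|^2) - (N + 2) t is a strict subsolution: its time derivative
  is - (N + 2), its Laplacian is at least - N and its gradient has norm at most 1, so its defect is
  at most - 1. The convex combination of w with it is therefore strict too and cannot touch the
  supersolution v from below at a positive time.\<close>

lemma comparison_no_interior_max:
  fixes w v :: "real \<Rightarrow> 'a::euclidean_space \<Rightarrow> real"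
  assumes q: "1 < q" "q \<le> 2" and l: "0 < l" "l < 1"
    and w: "hj_reg w" "hj_defect q w t x \<le> 0"
    and v: "hj_reg v" "hj_defect q v t x \<ge> 0"
    and t: "0 < t"
    and F: "F = (\<lambda>t x. l * w t x - v t x - (1 - l) * (sqrt (1 + x \<bullet> x) + (real DIM('a) + 2) * t))"
    and maxx: "\<And>y. F t y \<le> F t x" and maxt: "\<And>s. 0 < s \<Longrightarrow> s \<le> t \<Longrightarrow> F s x \<le> F t x"
  shows False
proof -
  define Q where "Q y = sqrt (1 + y \<bullet> y)" for y :: 'a
  have Q1: "Q y \<ge> 1" for y unfolding Q_def by simp
  have Q2: "(Q y)\<^sup>2 = 1 + y \<bullet> y" for y unfolding Q_def by simp
  define W where "W = deriv (\<lambda>s. w s x) t"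
  define V where "V = deriv (\<lambda>s. v s x) t"
  have "((\<lambda>s. F s x) has_real_derivative l * W - V - (1 - l) * (real DIM('a) + 2)) (at t)"
    unfolding F W_def V_def
    by (rule derivative_eq_intros hj_regD(1)[OF w(1) t] hj_regD(1)[OF v(1) t] refl | simp)+
  \<comment> \<open>Only earlier times compete, so t may be the final time; the time derivative is
    then nonnegative rather than zero.\<close>
  then have time: "l * W - V - (1 - l) * (real DIM('a) + 2) \<ge> 0"
  proof (rule_tac ccontr)
    assume D: "((\<lambda>s. F s x) has_real_derivative l * W - V - (1 - l) * (real DIM('a) + 2)) (at t)"
      "\<not> l * W - V - (1 - l) * (real DIM('a) + 2) \<ge> 0"
    then obtain d where d: "d > 0" "\<And>h. 0 < h \<Longrightarrow> h < d \<Longrightarrow> F t x < F (t - h) x"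
      using DERIV_neg_dec_left[OF D(1)] by auto
    define h where "h = min (d/2) (t/2)"
    have h: "0 < h" "h < d" "h < t" using d t by (auto simp: h_def)
    show False using d(2)[of h] h maxt[of "t - h"] by auto
  qed
  have line: "l * pd b (w t) x - pd b (v t) x - (1 - l) * ((x \<bullet> b) / Q x) = 0
     \<and> l * pd b (pd b (w t)) x - pd b (pd b (v t)) x - (1 - l) \<le> 0" if b: "b \<in> Basis" for b
  proof -
    define G where "G s = F t (x + s *\<^sub>R b)" for s
    define G' where "G' s = l * pd b (w t) (x + s *\<^sub>R b) - pd b (v t) (x + s *\<^sub>R b)
      - (1 - l) * (((x + s *\<^sub>R b) \<bullet> b) / Q (x + s *\<^sub>R b))" for s
    have dQ: "((\<lambda>s. Q (x + s *\<^sub>R b)) has_real_derivative ((x + s *\<^sub>R b) \<bullet> b) / Q (x + s *\<^sub>R b)) (at s)" for s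
    proof -
      have pos: "1 + (x + s *\<^sub>R b) \<bullet> (x + s *\<^sub>R b) > 0"
        by (smt (verit) inner_ge_zero)
      have "(\<lambda>s. 1 + (x + s *\<^sub>R b) \<bullet> (x + s *\<^sub>R b)) = (\<lambda>s. 1 + x \<bullet> x + 2 * s * (x \<bullet> b) + s\<^sup>2)"
        using b by (auto simp: fun_eq_iff inner_add_left inner_add_right inner_commute power2_eq_square)
      moreover have "((\<lambda>s. 1 + x \<bullet> x + 2 * s * (x \<bullet> b) + s\<^sup>2) has_real_derivative 2 * ((x + s *\<^sub>R b) \<bullet> b)) (at s)"
        using b by (auto intro!: derivative_eq_intros simp: inner_add_left)
      ultimately have "((\<lambda>s. 1 + (x + s *\<^sub>R b) \<bullet> (x + s *\<^sub>R b)) has_real_derivative 2 * ((x + s *\<^sub>R b) \<bullet> b)) (at s)"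
        by simp
      from DERIV_chain2[OF DERIV_real_sqrt[OF pos] this]
      show ?thesis unfolding Q_def by (simp add: field_simps)
    qed
    have Q0: "Q y \<noteq> 0" for y using Q1[of y] by simp
    have G: "(G has_real_derivative G' s) (at s)" for s
      unfolding G_def F G'_def Q_def[symmetric]
      by (rule derivative_eq_intros has_pd_line hj_regD(2)[OF w(1) t b] hj_regD(2)[OF v(1) t b] dQ refl | simp)+
    have dn: "((\<lambda>s. (x + s *\<^sub>R b) \<bullet> b) has_real_derivative 1) (at s)" for s
      using b by (auto intro!: derivative_eq_intros simp: inner_add_left)
    have G'd: "(G' has_real_derivative
      l * pd b (pd b (w t)) (x + 0 *\<^sub>R b) - pd b (pd b (v t)) (x + 0 *\<^sub>R b) - (1 - l) *
        ((1 * Q (x + 0 *\<^sub>R b) - ((x + 0 *\<^sub>R b) \<bullet> b) * (((x + 0 *\<^sub>R b) \<bullet> b) / Q (x + 0 *\<^sub>R b))) / (Q (x + 0 *\<^sub>R b) * Q (x + 0 *\<^sub>R b)))) (at 0)"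
      unfolding G'_def
      by (intro DERIV_diff DERIV_cmult DERIV_divide has_pd_line hj_regD(3)[OF w(1) t b] hj_regD(3)[OF v(1) t b] dn dQ Q0)
    have mx: "G s \<le> G 0" for s using maxx by (simp add: G_def)
    note S = second_derivative_at_max[OF G G'd mx]
    have le1: "(Q x - (x \<bullet> b) * ((x \<bullet> b) / Q x)) / (Q x * Q x) \<le> 1"
    proof -
      have "Q x - (x \<bullet> b) * ((x \<bullet> b) / Q x) \<le> Q x"
        using Q1[of x] by simp
      also have "\<dots> \<le> Q x * Q x" using Q1[of x] by simp
      finally show ?thesis using Q1[of x] by (simp add: divide_le_eq)
    qed
    have "(1 - l) * ((Q x - (x \<bullet> b) * ((x \<bullet> b) / Q x)) / (Q x * Q x)) \<le> (1 - l) * 1"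
      using l by (intro mult_left_mono le1) auto
    then show ?thesis using S by (simp add: G'_def)
  qed
  define e where "e = (1 / Q x) *\<^sub>R x"
  have ne: "norm e \<le> 1"
  proof -
    have "norm x \<le> Q x" unfolding Q_def norm_eq_sqrt_inner by simp
    then show ?thesis using Q1[of x] by (simp add: e_def)
  qed
  \<comment> \<open>At the maximum the gradient of v is the convex combination of those of w and of
    the penalty. Convexity of |p|^q thus compares the gradient terms without any bound on the
    gradients.\<close>
  have "grad (v t) x = (1 - (1 - l)) *\<^sub>R grad (w t) x + (1 - l) *\<^sub>R (- e)"
  proof (rule euclidean_eqI)
    fix b :: 'a assume b: "b \<in> Basis"
    show "grad (v t) x \<bullet> b = ((1 - (1 - l)) *\<^sub>R grad (w t) x + (1 - l) *\<^sub>R (- e)) \<bullet> b"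
      using line[OF b] by (simp add: inner_diff_left grad_inner[OF b] e_def)
  qed
  then have "norm (grad (v t) x) powr q \<le> (1 - (1 - l)) * norm (grad (w t) x) powr q + (1 - l) * norm (- e) powr q"
    using convex_onD[OF convex_on_norm_powr[OF q], of "1 - l" "grad (w t) x" "- e"] l by simp
  also have "\<dots> \<le> l * norm (grad (w t) x) powr q + (1 - l) * 1"
    using l ne q powr_mono2[of q "norm e" 1] by simp
  finally have H: "norm (grad (v t) x) powr q \<le> l * norm (grad (w t) x) powr q + (1 - l)" by simp
  have "(\<Sum>b\<in>Basis. l * pd b (pd b (w t)) x - pd b (pd b (v t)) x - (1 - l)) \<le> 0"
    using line by (intro sum_nonpos) auto
  then have lap: "l * laplacian (w t) x - laplacian (v t) x - real DIM('a) * (1 - l) \<le> 0"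
    unfolding laplacian_def by (simp add: sum_subtractf sum_distrib_left)
  have "l * (W - laplacian (w t) x + norm (grad (w t) x) powr q) \<le> 0"
    using w(2) l unfolding hj_defect_def W_def by (simp add: mult_nonneg_nonpos)
  moreover have "V - laplacian (v t) x + norm (grad (v t) x) powr q \<ge> 0"
    using v(2) unfolding hj_defect_def V_def .
  ultimately have "l * W - V \<le> (1 - l) * (real DIM('a) + 1)"
    using lap H by (simp add: algebra_simps)
  then show False using time l by (simp add: algebra_simps)
qed

text \<open>For each l < 1 the penalty confines the maximum of F over [0, T] to a compact set, and
  the maximum can only sit at time 0, where the initial ordering applies. At the fixed point (T, x)
  all errors are multiples of 1 - l, so l may tend to 1.\<close>

theorem hj_comparison:
  fixes w v :: "real \<Rightarrow> 'a::euclidean_space \<Rightarrow> real"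
  assumes q: "1 < q" "q \<le> 2" and T: "0 \<le> T"
    and w: "hj_reg w" "\<And>t x. t > 0 \<Longrightarrow> hj_defect q w t x \<le> 0"
      "continuous_on ({0..T} \<times> UNIV) (\<lambda>(t, x). w t x)" "\<And>t x. 0 \<le> t \<Longrightarrow> t \<le> T \<Longrightarrow> \<bar>w t x\<bar> \<le> M"
    and v: "hj_reg v" "\<And>t x. t > 0 \<Longrightarrow> hj_defect q v t x \<ge> 0"
      "continuous_on ({0..T} \<times> UNIV) (\<lambda>(t, x). v t x)" "\<And>t x. 0 \<le> t \<Longrightarrow> t \<le> T \<Longrightarrow> \<bar>v t x\<bar> \<le> M"
    and init: "\<And>x. w 0 x \<le> v 0 x + D"
  shows "w T x \<le> v T x + D"
proof -
  have M: "M \<ge> 0" using w(4)[of 0 0] T by simp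
  define P where "P = sqrt (1 + x \<bullet> x) + (real DIM('a) + 2) * T + M"
  have main: "l * w T x - v T x \<le> D + (1 - l) * P" if l: "0 < l" "l < 1" for l
  proof -
    define F where "F = (\<lambda>t x. l * w t x - v t x - (1 - l) * (sqrt (1 + x \<bullet> x) + (real DIM('a) + 2) * t))"
    have far: "F t y \<le> 2 * M - (1 - l) * norm y" if "0 \<le> t" "t \<le> T" for t y
    proof -
      have "l * w t y \<le> 1 * M"
        using l w(4)[OF that, of y] M by (smt (verit, ccfv_SIG) mult_left_le_one_le mult_left_mono mult_nonneg_nonneg)
      moreover have "- v t y \<le> M" using v(4)[OF that, of y] by auto
      moreover have "norm y \<le> sqrt (1 + y \<bullet> y)" unfolding norm_eq_sqrt_inner by simp
      then have "(1 - l) * norm y \<le> (1 - l) * (sqrt (1 + y \<bullet> y) + (real DIM('a) + 2) * t)"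
        using l that by (intro mult_left_mono add_increasing2) auto
      ultimately show ?thesis by (simp add: F_def)
    qed
    \<comment> \<open>Outside the ball of this radius the bound \<open>far\<close> puts F below its
      value at (T, x), so the maximum over the compact set is global.\<close>
    define R where "R = max (norm x) ((2 * M - F T x) / (1 - l))"
    have R: "R \<ge> 0" by (simp add: R_def max.coboundedI1)
    define S where "S = {0..T} \<times> cball (0::'a) R"
    have Tx: "(T, x) \<in> S" using T by (simp add: S_def R_def)
    have "continuous_on ({0..T} \<times> UNIV) (\<lambda>(t, x). F t x)"
      using w(3) v(3) unfolding F_def case_prod_unfold by (intro continuous_intros)
    then have "continuous_on S (\<lambda>(t, x). F t x)"
      by (rule continuous_on_subset) (auto simp: S_def)
    moreover have "compact S" unfolding S_def by (intro compact_Times) auto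
    moreover have "S \<noteq> {}" using Tx by blast
    ultimately obtain z where z: "z \<in> S" "\<And>y. y \<in> S \<Longrightarrow> (\<lambda>(t, x). F t x) y \<le> (\<lambda>(t, x). F t x) z"
      using continuous_attains_sup[of S "\<lambda>(t, x). F t x"] by blast
    obtain s y where sy: "z = (s, y)" by (cases z)
    have mx: "F s' y' \<le> F s y" if "0 \<le> s'" "s' \<le> T" for s' y'
    proof (cases "norm y' \<le> R")
      case True
      then show ?thesis using z(2)[of "(s', y')"] that sy by (auto simp: S_def)
    next
      case False
      then have "(2 * M - F T x) / (1 - l) \<le> norm y'" by (simp add: R_def)
      then have "2 * M - F T x \<le> (1 - l) * norm y'" using l by (simp add: divide_le_eq mult.commute)
      then have "F s' y' \<le> F T x" using far[OF that, of y'] by simp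
      also have "\<dots> \<le> F s y" using z(2)[OF Tx] sy by simp
      finally show ?thesis .
    qed
    have s: "0 \<le> s" "s \<le> T" using z(1) sy by (auto simp: S_def)
    have "s = 0"
    proof (rule ccontr)
      assume "s \<noteq> 0"
      then have "0 < s" using s by simp
      show False
        by (rule comparison_no_interior_max[OF q l w(1) w(2)[OF \<open>0 < s\<close>] v(1) v(2)[OF \<open>0 < s\<close>] \<open>0 < s\<close> F_def])
          (use mx s in auto)
    qed
    have "F T x \<le> F 0 y" using mx[of T x] T \<open>s = 0\<close> by simp
    also have "F 0 y \<le> l * w 0 y - v 0 y" using l by (simp add: F_def)
    also have "\<dots> = (w 0 y - v 0 y) - (1 - l) * w 0 y" by (simp add: algebra_simps)
    also have "\<dots> \<le> D + (1 - l) * M"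
    proof -
      have "(1 - l) * (- w 0 y) \<le> (1 - l) * M"
        using w(4)[of 0 y] T l by (intro mult_left_mono) auto
      then show ?thesis using init[of y] by simp
    qed
    finally show ?thesis by (simp add: F_def P_def algebra_simps)
  qed
  have "((\<lambda>l. l * w T x - v T x) \<longlongrightarrow> 1 * w T x - v T x) (at_left 1)"
    by (intro tendsto_intros)
  moreover have "((\<lambda>l. D + (1 - l) * P) \<longlongrightarrow> D + (1 - 1) * P) (at_left 1)"
    by (intro tendsto_intros)
  moreover have "\<forall>\<^sub>F l in at_left 1. l * w T x - v T x \<le> D + (1 - l) * P"
    using eventually_at_left_field[of "\<lambda>l. l * w T x - v T x \<le> D + (1 - l) * P" 1] main
    by (metis zero_less_one)
  ultimately have "1 * w T x - v T x \<le> D + (1 - 1) * P"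
    by (intro tendsto_le[of "at_left 1"]) auto
  then show ?thesis by simp
qed

section \<open>Gradient bound and semiconcavity\<close>

definition hj_sol :: "real \<Rightarrow> (real \<Rightarrow> 'a::euclidean_space \<Rightarrow> real) \<Rightarrow> bool" where
  "hj_sol q u \<longleftrightarrow> continuous_on ({0..} \<times> UNIV) (\<lambda>(t, x). u t x) \<and> C21 u \<and>
     (\<forall>t>0. \<forall>x. hj_defect q u t x = 0)"

lemma C21_imp_reg: "C21 u \<Longrightarrow> hj_reg u"
  unfolding C21_def hj_reg_def by (auto simp: eval_nat_numeral)

lemma hj_solD:
  assumes "hj_sol q u"
  shows "hj_reg u" "C21 u" "continuous_on ({0..} \<times> UNIV) (\<lambda>(t, x). u t x)"
    "t > 0 \<Longrightarrow> hj_defect q u t x = 0"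
  using assms C21_imp_reg by (auto simp: hj_sol_def)

lemma hj_sol_shift_time:
  fixes u :: "real \<Rightarrow> 'a::euclidean_space \<Rightarrow> real"
  assumes u: "hj_sol q u" and a: "0 \<le> a"
  shows "hj_sol q (\<lambda>t. u (t + a))"
proof -
  note C = hj_solD(2)[OF u, unfolded C21_def]
  have shift: "continuous_on ({0<..} \<times> UNIV) (\<lambda>(t, x). f (t + a) x)"
    if "continuous_on ({0<..} \<times> UNIV) (\<lambda>(t, x). f t x)" for f :: "real \<Rightarrow> 'a \<Rightarrow> real"
  proof -
    have "continuous_on ({0<..} \<times> UNIV) (\<lambda>z. (\<lambda>(t, x). f t x) (fst z + a, snd z))"
      by (rule continuous_on_compose2[OF that]) (use a in \<open>auto intro!: continuous_intros\<close>)
    then show ?thesis by (simp add: case_prod_unfold)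
  qed
  have shift0: "continuous_on ({0..} \<times> UNIV) (\<lambda>(t, x). u (t + a) x)"
  proof -
    have "continuous_on ({0..} \<times> UNIV) (\<lambda>z. (\<lambda>(t, x). u t x) (fst z + a, snd z))"
      by (rule continuous_on_compose2[OF hj_solD(3)[OF u]]) (use a in \<open>auto intro!: continuous_intros\<close>)
    then show ?thesis by (simp add: case_prod_unfold)
  qed
  have D: "((\<lambda>s. u (s + a) x) has_real_derivative deriv (\<lambda>s. u s x) (t + a)) (at t)" if "t > 0" for t x
    using iffD1[OF DERIV_shift[of "\<lambda>s. u s x" _ t a] hj_regD(1)[OF hj_solD(1)[OF u], of "t + a" x]] that a by simp
  then have d: "deriv (\<lambda>s. u (s + a) x) t = deriv (\<lambda>s. u s x) (t + a)" if "t > 0" for t x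
    using DERIV_imp_deriv that by blast
  have "continuous_on ({0<..} \<times> UNIV) (\<lambda>(t, x). deriv (\<lambda>s. u (s + a) x) t)"
  proof (rule continuous_on_eq)
    show "continuous_on ({0<..} \<times> UNIV) (\<lambda>(t, x). deriv (\<lambda>s. u s x) (t + a))"
      by (rule shift) (use C in blast)
  qed (auto simp: d)
  then have "C21 (\<lambda>t. u (t + a))"
    unfolding C21_def using C D a
    by (intro conjI shift[of u] ballI allI impI shift[of "\<lambda>t. pd _ (u t)"] shift[of "\<lambda>t. pd _ (pd _ (u t))"])
       (auto simp: real_differentiable_def)
  moreover have "hj_defect q (\<lambda>t. u (t + a)) t x = 0" if "t > 0" for t x
    using hj_solD(4)[OF u, of "t + a" x] that a by (simp add: hj_defect_def d)
  ultimately show ?thesis unfolding hj_sol_def using shift0 by blast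
qed

text \<open>The defect is linear apart from its gradient term, so only that term has to be
  exchanged. The summand - K t lowers the defect by K and pays for errors.\<close>

lemma hj_defect_sum:
  fixes W :: "'i \<Rightarrow> real \<Rightarrow> 'a::euclidean_space \<Rightarrow> real" and c :: "'i \<Rightarrow> real" and K :: real
  assumes W: "\<And>i. i \<in> I \<Longrightarrow> hj_reg (W i)"
  defines "w \<equiv> (\<lambda>t x. (\<Sum>i\<in>I. c i * W i t x) - K * t)"
  shows "hj_reg w"
    and "t > 0 \<Longrightarrow> hj_defect q w t x = (\<Sum>i\<in>I. c i * (hj_defect q (W i) t x - norm (grad (W i t) x) powr q))
      + norm (\<Sum>i\<in>I. c i *\<^sub>R grad (W i t) x) powr q - K"
proof -
  have T: "((\<lambda>s. w s x) has_real_derivative (\<Sum>i\<in>I. c i * deriv (\<lambda>s. W i s x) t) - K) (at t)" if "t > 0" for t x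
    unfolding w_def using DERIV_cmult_Id[of K]
    by (intro DERIV_diff DERIV_sum DERIV_cmult hj_regD(1)[OF W that]) auto
  have D: "((\<lambda>s. w t (x + s *\<^sub>R b)) has_real_derivative (\<Sum>i\<in>I. c i * pd b (W i t) x)) (at 0)"
    if "t > 0" "b \<in> Basis" for t x b
  proof -
    have "((\<lambda>s. w t (x + s *\<^sub>R b)) has_real_derivative (\<Sum>i\<in>I. c i * pd b (W i t) x) - 0) (at 0)"
      unfolding w_def by (intro DERIV_diff DERIV_sum DERIV_cmult DERIV_const has_pdD hj_regD(2)[OF W] that)
    then show ?thesis by simp
  qed
  have pw: "pd b (w t) = (\<lambda>x. \<Sum>i\<in>I. c i * pd b (W i t) x)" if "t > 0" "b \<in> Basis" for t b
    using pdI(2)[OF D[OF that]] by blast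
  have hp: "has_pd b (pd b (w t)) x" "pd b (pd b (w t)) x = (\<Sum>i\<in>I. c i * pd b (pd b (W i t)) x)"
    if "t > 0" "b \<in> Basis" for t b x
    unfolding pw[OF that] using pd_sum[of I b "\<lambda>i. pd b (W i t)" c] hj_regD(3)[OF W] that by auto
  show "hj_reg w"
    unfolding hj_reg_def using T pdI(1)[OF D] hp by (auto simp: real_differentiable_def)
  assume t: "t > 0"
  have g: "grad (w t) x = (\<Sum>i\<in>I. c i *\<^sub>R grad (W i t) x)"
    by (rule euclidean_eqI) (simp add: grad_inner pw[OF t] inner_sum_left)
  have l: "laplacian (w t) x = (\<Sum>i\<in>I. c i * laplacian (W i t) x)"
  proof -
    have "laplacian (w t) x = (\<Sum>b\<in>Basis. \<Sum>i\<in>I. c i * pd b (pd b (W i t)) x)"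
      unfolding laplacian_def by (intro sum.cong refl hp(2)[OF t])
    also have "\<dots> = (\<Sum>i\<in>I. \<Sum>b\<in>Basis. c i * pd b (pd b (W i t)) x)"
      by (rule sum.swap)
    finally show ?thesis unfolding laplacian_def sum_distrib_left .
  qed
  show "hj_defect q w t x = (\<Sum>i\<in>I. c i * (hj_defect q (W i) t x - norm (grad (W i t) x) powr q))
      + norm (\<Sum>i\<in>I. c i *\<^sub>R grad (W i t) x) powr q - K"
    unfolding hj_defect_def DERIV_imp_deriv[OF T[OF t]] g l
    by (simp add: algebra_simps sum_subtractf)
qed

lemma hj_translate:
  fixes w :: "real \<Rightarrow> 'a::euclidean_space \<Rightarrow> real"
  assumes w: "hj_reg w"
  shows "hj_reg (\<lambda>t x. w t (x + z))" "hj_defect q (\<lambda>t x. w t (x + z)) t x = hj_defect q w t (x + z)"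
  using w unfolding hj_reg_def hj_defect_def grad_def laplacian_def
  by (auto simp: pd_shift has_pd_shift)

text \<open>In t both arguments of u vary, so separate differentiability is not enough for the chain
  rule. The joint continuity of the spatial derivative contained in \<open>C21\<close> provides
  joint differentiability along the line.\<close>

lemma hj_moving:
  fixes u :: "real \<Rightarrow> 'a::euclidean_space \<Rightarrow> real" and c :: real
  assumes u: "C21 u" and b: "b \<in> Basis"
  defines "w \<equiv> (\<lambda>t x. u t (x + (c * t) *\<^sub>R b))"
  shows "hj_reg w" "grad (w t) x = grad (u t) (x + (c * t) *\<^sub>R b)"
    "t > 0 \<Longrightarrow> hj_defect q w t x = hj_defect q u t (x + (c * t) *\<^sub>R b) + c * (grad (w t) x \<bullet> b)"
proof -
  note reg = C21_imp_reg[OF u]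
  have D: "((\<lambda>s. w s x) has_real_derivative
      deriv (\<lambda>s. u s (x + (c * t) *\<^sub>R b)) t + c * pd b (u t) (x + (c * t) *\<^sub>R b)) (at t)" if t: "t > 0" for t x
  proof -
    define f where "f s r = u s (x + r *\<^sub>R b)" for s r
    define P where "P s r = pd b (u s) (x + r *\<^sub>R b) *\<^sub>R (id_blinfun :: real \<Rightarrow>\<^sub>L real)" for s r
    have cP: "continuous_on ({0<..} \<times> UNIV) (\<lambda>(s, r). P s r)"
    proof -
      have "continuous_on ({0<..} \<times> UNIV) (\<lambda>(t, x). pd b (u t) x)"
        using u b by (simp add: C21_def)
      then have "continuous_on ({0<..} \<times> UNIV) (\<lambda>z. (\<lambda>(t, x). pd b (u t) x) (fst z, x + snd z *\<^sub>R b))"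
        by (rule continuous_on_compose2) (auto intro!: continuous_intros)
      then have "continuous_on ({0<..} \<times> UNIV) (\<lambda>(s, r). pd b (u s) (x + r *\<^sub>R b))"
        by (simp add: case_prod_unfold)
      then show ?thesis unfolding P_def case_prod_unfold by (intro continuous_intros)
    qed
    have "((\<lambda>(s, r). f s r) has_derivative
        (\<lambda>(ts, tr). deriv (\<lambda>s. f s (c * t)) t * ts + P t (c * t) tr)) (at (t, c * t) within {0<..} \<times> UNIV)"
    proof (rule has_derivative_partialsI)
      show "((\<lambda>s. f s (c * t)) has_derivative (*) (deriv (\<lambda>s. f s (c * t)) t)) (at t within {0<..})"
        using hj_regD(1)[OF reg t] unfolding f_def has_field_derivative_def[symmetric]
        by (rule has_field_derivative_at_within)
      show "(f s has_derivative blinfun_apply (P s r)) (at r within UNIV)" if "s \<in> {0<..}" for s r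
        using has_pd_line[OF hj_regD(2)[OF reg, of s b], of x r] that b
        unfolding f_def P_def has_field_derivative_def by (simp add: scaleR_blinfun.rep_eq mult_commute_abs)
      show "continuous (at (t, c * t) within {0<..} \<times> UNIV) (\<lambda>(s, r). P s r)"
        using cP t by (auto simp: continuous_on_eq_continuous_within)
    qed auto
    moreover have "at (t, c * t) within {0<..} \<times> UNIV = at (t, c * t)"
      using t by (intro at_within_open open_Times) auto
    ultimately have F: "((\<lambda>(s, r). f s r) has_derivative
        (\<lambda>(ts, tr). deriv (\<lambda>s. f s (c * t)) t * ts + P t (c * t) tr)) (at ((\<lambda>s. (s, c * s)) t))"
      by simp
    have "((\<lambda>s. (s, c * s)) has_derivative (\<lambda>h. (h, c * h))) (at t)"
      by (auto intro!: derivative_eq_intros)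
    from has_derivative_compose[OF this F]
    have "((\<lambda>s. f s (c * s)) has_derivative (\<lambda>h. deriv (\<lambda>s. f s (c * t)) t * h + P t (c * t) (c * h))) (at t)"
      by simp
    moreover have "(\<lambda>h. deriv (\<lambda>s. f s (c * t)) t * h + P t (c * t) (c * h))
        = (*) (deriv (\<lambda>s. f s (c * t)) t + c * pd b (u t) (x + (c * t) *\<^sub>R b))"
      by (auto simp: fun_eq_iff P_def scaleR_blinfun.rep_eq algebra_simps)
    ultimately show ?thesis unfolding has_field_derivative_def w_def f_def by simp
  qed
  show "hj_reg w"
    unfolding hj_reg_def
  proof (intro allI impI ballI conjI)
    fix t :: real and x b' :: 'a assume t: "t > 0" and b': "b' \<in> Basis"
    show "has_pd b' (w t) x" "has_pd b' (pd b' (w t)) x"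
      unfolding w_def pd_shift has_pd_shift using hj_regD[OF reg t] b' by auto
  next
    fix t :: real and x :: 'a assume "t > 0"
    then show "(\<lambda>s. w s x) differentiable at t" using D by (auto simp: real_differentiable_def)
  qed
  show g: "grad (w t) x = grad (u t) (x + (c * t) *\<^sub>R b)"
    unfolding grad_def w_def pd_shift ..
  show "hj_defect q w t x = hj_defect q u t (x + (c * t) *\<^sub>R b) + c * (grad (w t) x \<bullet> b)" if t: "t > 0"
    unfolding hj_defect_def DERIV_imp_deriv[OF D[OF t]] g grad_inner[OF b]
    by (simp add: laplacian_def w_def pd_shift)
qed

lemma continuous_on_moving:
  fixes u :: "real \<Rightarrow> 'a::euclidean_space \<Rightarrow> real"
  assumes "continuous_on ({0..} \<times> UNIV) (\<lambda>(t, x). u t x)"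
  shows "continuous_on ({0..T} \<times> UNIV) (\<lambda>(t, x). u t (x + (c * t) *\<^sub>R b))"
proof -
  have "continuous_on ({0..T} \<times> UNIV) (\<lambda>z. (\<lambda>(t, x). u t x) (fst z, snd z + (c * fst z) *\<^sub>R b))"
    by (rule continuous_on_compose2[OF assms]) (auto intro!: continuous_intros)
  then show ?thesis by (simp add: case_prod_unfold)
qed

text \<open>At time 0 all translates coincide, so the initial comparison costs only D. The constant
  K bounds the excess of the drift over the convexity gap; since the p i are gradients of u at one
  common time, a gradient bound may be fed in there. It is applied with a single translate of weight
  below 1 and with two translates of weight 1/2.\<close>

lemma hj_moving_comparison:
  fixes u :: "real \<Rightarrow> 'a::euclidean_space \<Rightarrow> real"
  assumes q: "1 < q" "q \<le> 2" and T: "0 \<le> T" and b: "b \<in> Basis" and I: "finite I"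
    and u: "hj_sol q u" and M: "\<And>t x. 0 \<le> t \<Longrightarrow> \<bar>u t x\<bar> \<le> M"
    and K: "\<And>t p. t > 0 \<Longrightarrow> (\<And>i. i \<in> I \<Longrightarrow> \<exists>x. p i = grad (u t) x) \<Longrightarrow>
      (\<Sum>i\<in>I. a i * (c i * (p i \<bullet> b) - norm (p i) powr q)) + norm (\<Sum>i\<in>I. a i *\<^sub>R p i) powr q \<le> K"
    and init: "\<And>x. (\<Sum>i\<in>I. a i * u 0 x) \<le> u 0 x + D"
  shows "(\<Sum>i\<in>I. a i * u T (x + (c i * T) *\<^sub>R b)) \<le> u T x + D + K * T"
proof -
  define W where "W i t x = u t (x + (c i * t) *\<^sub>R b)" for i t x
  define w where "w t x = (\<Sum>i\<in>I. a i * W i t x) - K * t" for t x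
  note C = hj_solD(2)[OF u]
  have W: "hj_reg (W i)" for i unfolding W_def by (rule hj_moving(1)[OF C b])
  note S = hj_defect_sum[where I = I and W = W and c = a and K = K, OF W, folded w_def]
  have M0: "M \<ge> 0" using M[of 0 0] by simp
  define M' where "M' = M + (\<Sum>i\<in>I. \<bar>a i\<bar> * M) + \<bar>K\<bar> * T"
  have M': "M \<le> M'" using M0 T by (simp add: M'_def sum_nonneg)
  have "w T x \<le> u T x + D"
  proof (rule hj_comparison[where w = w and v = u and M = M', OF q T])
    show "hj_reg w" using S(1) unfolding w_def[abs_def] .
    show "hj_defect q w t x \<le> 0" if t: "t > 0" for t x
    proof -
      have "hj_defect q w t x = (\<Sum>i\<in>I. a i * (c i * (grad (W i t) x \<bullet> b) - norm (grad (W i t) x) powr q))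
        + norm (\<Sum>i\<in>I. a i *\<^sub>R grad (W i t) x) powr q - K"
      proof -
        have "hj_defect q (W i) t x = c i * (grad (W i t) x \<bullet> b)" for i
          using hj_moving(3)[OF C b t, of q "c i" x] hj_solD(4)[OF u t] by (simp add: W_def[abs_def])
        then show ?thesis using S(2)[OF t, of q x] by simp
      qed
      also have "\<dots> \<le> 0"
        using K[OF t, of "\<lambda>i. grad (W i t) x"] hj_moving(2)[OF C b] unfolding W_def by fastforce
      finally show ?thesis .
    qed
    show "continuous_on ({0..T} \<times> UNIV) (\<lambda>(t, x). w t x)"
      using continuous_on_moving[OF hj_solD(3)[OF u]]
      unfolding w_def W_def case_prod_unfold by (intro continuous_intros) auto
    show "\<bar>w t x\<bar> \<le> M'" if "0 \<le> t" "t \<le> T" for t x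
    proof -
      have "\<bar>\<Sum>i\<in>I. a i * W i t x\<bar> \<le> (\<Sum>i\<in>I. \<bar>a i * W i t x\<bar>)" by (rule sum_abs)
      also have "\<dots> \<le> (\<Sum>i\<in>I. \<bar>a i\<bar> * M)"
        unfolding abs_mult W_def using M that by (intro sum_mono mult_left_mono) auto
      finally have "\<bar>\<Sum>i\<in>I. a i * W i t x\<bar> \<le> (\<Sum>i\<in>I. \<bar>a i\<bar> * M)" .
      moreover have "\<bar>K * t\<bar> \<le> \<bar>K\<bar> * T" using that by (simp add: abs_mult mult_left_mono)
      ultimately show ?thesis unfolding w_def M'_def using M0 by linarith
    qed
    show "hj_reg u" by (rule hj_solD(1)[OF u])
    show "hj_defect q u t x \<ge> 0" if "t > 0" for t x using hj_solD(4)[OF u that] by simp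
    show "continuous_on ({0..T} \<times> UNIV) (\<lambda>(t, x). u t x)"
      by (rule continuous_on_subset[OF hj_solD(3)[OF u]]) auto
    show "\<bar>u t x\<bar> \<le> M'" if "0 \<le> t" "t \<le> T" for t x using M[of t x] M' that by simp
    show "w 0 x \<le> u 0 x + D" for x using init[of x] by (simp add: w_def W_def)
  qed
  then show ?thesis by (simp add: w_def W_def)
qed

section \<open>Bounds for first and pure second derivatives at positive times\<close>

lemma scale_inner_le:
  fixes x b :: "'a::real_inner"
  assumes "norm b = 1"
  shows "k * (x \<bullet> b) \<le> \<bar>k\<bar> * norm x"
proof -
  have "k * (x \<bullet> b) \<le> \<bar>k * (x \<bullet> b)\<bar>" by (rule abs_ge_self)
  also have "\<dots> \<le> \<bar>k\<bar> * (norm x * norm b)"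
    unfolding abs_mult by (intro mult_left_mono Cauchy_Schwarz_ineq2) simp
  finally show ?thesis using assms by simp
qed

text \<open>Beyond r = (a / \<mu>)^(1 / (q - 1)) the power dominates the linear term; up to there
  the linear term itself is below the right-hand side.\<close>

lemma young_absorb:
  fixes r :: real
  assumes "0 \<le> r" "0 \<le> a" "0 < \<mu>" "1 < q"
  shows "a * r - \<mu> * r powr q \<le> a * (a / \<mu>) powr (1 / (q - 1))"
proof (cases "r \<le> (a / \<mu>) powr (1 / (q - 1))")
  case True
  then have "a * r \<le> a * (a / \<mu>) powr (1 / (q - 1))" using assms by (intro mult_left_mono) auto
  moreover have "\<mu> * r powr q \<ge> 0" using assms by simp
  ultimately show ?thesis by linarith
next
  case False
  then have r: "r > 0" "(a / \<mu>) powr (1 / (q - 1)) \<le> r" using le_less_trans[OF powr_ge_zero, of "a / \<mu>" "1 / (q - 1)" r] by auto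
  have "a / \<mu> = ((a / \<mu>) powr (1 / (q - 1))) powr (q - 1)"
    using assms by (simp add: powr_powr)
  also have "\<dots> \<le> r powr (q - 1)" using r assms by (intro powr_mono2) auto
  finally have "a * r \<le> \<mu> * (r powr (q - 1) * r)"
    using assms r by (simp add: divide_le_eq mult.commute mult.left_commute)
  also have "r powr (q - 1) * r = r powr q" using r by (simp add: powr_diff)
  finally have "a * r - \<mu> * r powr q \<le> 0" by simp
  also have "0 \<le> a * (a / \<mu>) powr (1 / (q - 1))" using assms by simp
  finally show ?thesis .
qed

text \<open>The upper bound is required on both sides of 0: positive h bounds D from above, negative
  h from below.\<close>

lemma DERIV_abs_le:
  fixes G :: "real \<Rightarrow> real"
  assumes G: "(G has_real_derivative D) (at 0)" and d: "d > 0"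
    and B: "\<And>h. \<bar>h\<bar> < d \<Longrightarrow> G h \<le> G 0 + B * \<bar>h\<bar>"
  shows "\<bar>D\<bar> \<le> B"
proof (rule ccontr)
  assume "\<not> \<bar>D\<bar> \<le> B"
  then consider "D - B > 0" | "D + B < 0" by linarith
  then show False
  proof cases
    case 1
    have "((\<lambda>h. G h - B * h) has_real_derivative D - B) (at 0)"
      by (auto intro!: derivative_eq_intros G)
    then obtain e where e: "e > 0" "\<And>h. 0 < h \<Longrightarrow> h < e \<Longrightarrow> G 0 < G h - B * h"
      using DERIV_pos_inc_right[of "\<lambda>h. G h - B * h" "D - B" 0] 1 by auto
    define h where "h = min e d / 2"
    have "0 < h" "h < e" "h < d" using e(1) d by (auto simp: h_def)
    then show False using e(2)[of h] B[of h] by auto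
  next
    case 2
    have "((\<lambda>h. G h + B * h) has_real_derivative D + B) (at 0)"
      by (auto intro!: derivative_eq_intros G)
    then obtain e where e: "e > 0" "\<And>h. 0 < h \<Longrightarrow> h < e \<Longrightarrow> G 0 < G (- h) + B * (- h)"
      using DERIV_neg_dec_left[of "\<lambda>h. G h + B * h" "D + B" 0] 2 by auto
    define h where "h = min e d / 2"
    have "0 < h" "h < e" "h < d" using e(1) d by (auto simp: h_def)
    then show False using e(2)[of h] B[of "- h"] by auto
  qed
qed

text \<open>In units of X |h| with X = (m / T)^(1 / q), the 1 is the loss (1 - \<lambda>) m at time
  0 and the power is the remainder of \<open>young_absorb\<close> accumulated up to time T.\<close>

definition grad_const :: "real \<Rightarrow> real" where
  "grad_const q = 1 + (1 / (q - 1)) powr (1 / (q - 1))"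

text \<open>For \<lambda> < 1 the function \<lambda> u(t, x + t y) has a surplus (\<lambda> -
  \<lambda>^q) |p|^q in its gradient term, which absorbs the drift. Since u \<le> 0, the factor
  \<lambda> may be dropped at the end, which leaves a bound for u(T, x + h b) - u(T, x) linear in
  |h|.\<close>

lemma hj_pd_bound:
  fixes u :: "real \<Rightarrow> 'a::euclidean_space \<Rightarrow> real"
  assumes q: "1 < q" "q < 2" and u: "hj_sol q u" and m: "m > 0"
    and bd: "\<And>t x. 0 \<le> t \<Longrightarrow> - m \<le> u t x \<and> u t x \<le> 0"
    and T: "T > 0" and b: "b \<in> Basis"
  shows "\<bar>pd b (u T) x\<bar> \<le> grad_const q * (m / T) powr (1 / q)"
proof -
  define X where "X = (m / T) powr (1 / q)"
  have X: "X > 0" using m T by (simp add: X_def)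
  have Xq: "X powr q = m / T" using m T q by (simp add: X_def powr_powr)
  \<comment> \<open>\<open>\<lambda> = 1 - \<zeta> |h|\<close>; this \<open>\<zeta>\<close> balances the loss \<open>(1 - \<lambda>) m\<close> against Young's remainder\<close>
  define \<zeta> where "\<zeta> = X / m"
  have \<zeta>: "\<zeta> > 0" using X m by (simp add: \<zeta>_def)
  have "((\<lambda>s. u T (x + s *\<^sub>R b)) has_real_derivative pd b (u T) x) (at 0)"
    by (intro has_pdD hj_regD(2)[OF hj_solD(1)[OF u] T b])
  then have "\<bar>pd b (u T) x\<bar> \<le> grad_const q * X"
  proof (rule DERIV_abs_le)
    show "1 / \<zeta> > 0" using \<zeta> by simp
    fix h :: real assume h: "\<bar>h\<bar> < 1 / \<zeta>"
    show "u T (x + h *\<^sub>R b) \<le> u T (x + 0 *\<^sub>R b) + grad_const q * X * \<bar>h\<bar>"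
    proof (cases "h = 0")
      case False
      define l where "l = 1 - \<bar>h\<bar> * \<zeta>"
      have l: "0 < l" "l < 1" using h False \<zeta> by (auto simp: l_def field_simps)
      define K where "K = \<bar>h\<bar> / T * ((\<bar>h\<bar> / T) / ((q - 1) * (1 - l))) powr (1 / (q - 1))"
      have K0: "K \<ge> 0" using T by (simp add: K_def)
      have "(\<Sum>i\<in>{()}. l * u T (x + (h / T * T) *\<^sub>R b)) \<le> u T x + (1 - l) * m + K * T"
      proof (rule hj_moving_comparison[where u = u and T = T and b = b and I = "{()}" and a = "\<lambda>_. l"
            and c = "\<lambda>_. h / T" and K = K and M = m and q = q, OF q(1) _ _ b _ u])
        show "\<bar>u t x\<bar> \<le> m" if "0 \<le> t" for t x using bd[OF that, of x] by auto
        show "(\<Sum>i\<in>{()}. l * u 0 x) \<le> u 0 x + (1 - l) * m" for x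
        proof -
          have "(1 - l) * (- u 0 x) \<le> (1 - l) * m"
            using bd[of 0 x] l by (intro mult_left_mono) auto
          then show ?thesis by (simp add: algebra_simps)
        qed
        fix p :: "unit \<Rightarrow> 'a"
        define r where "r = norm (p ())"
        have 1: "h / T * (p () \<bullet> b) \<le> \<bar>h\<bar> / T * r"
          using scale_inner_le[of b "h / T" "p ()"] b T by (simp add: r_def)
        \<comment> \<open>The weighted mean inequality puts the concave power l^(q - 1) below its
          tangent at 1; the surplus is thus at least l (q - 1) (1 - l) |p|^q.\<close>
        have "l powr (q - 1) * 1 powr (1 - (q - 1)) \<le> (q - 1) * l + (1 - (q - 1)) * 1"
          using q l by (intro Youngs_inequality_0) auto
        then have "l powr (q - 1) \<le> 1 - (q - 1) * (1 - l)" by (simp add: algebra_simps)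
        then have "l powr (q - 1) * r powr q \<le> (1 - (q - 1) * (1 - l)) * r powr q"
          by (intro mult_right_mono) auto
        moreover have "norm (l *\<^sub>R p ()) powr q = l * (l powr (q - 1) * r powr q)"
          using l by (simp add: r_def powr_mult powr_diff)
        ultimately have "l * (h / T * (p () \<bullet> b) - r powr q) + norm (l *\<^sub>R p ()) powr q
            \<le> l * (\<bar>h\<bar> / T * r - r powr q) + l * ((1 - (q - 1) * (1 - l)) * r powr q)"
          using 1 l by (intro add_mono mult_left_mono) auto
        also have "\<dots> = l * (\<bar>h\<bar> / T * r - (q - 1) * (1 - l) * r powr q)"
          by (simp add: algebra_simps)
        also have "\<dots> \<le> l * K"
          unfolding K_def using l q T by (intro mult_left_mono young_absorb) (auto simp: r_def)
        also have "\<dots> \<le> K" using l K0 by (simp add: mult_left_le_one_le)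
        finally show "(\<Sum>i\<in>{()}. l * (h / T * (p i \<bullet> b) - norm (p i) powr q)) + norm (\<Sum>i\<in>{()}. l *\<^sub>R p i) powr q \<le> K"
          by (simp add: r_def)
      qed (use q T in auto)
      then have A: "l * u T (x + h *\<^sub>R b) \<le> u T x + (1 - l) * m + K * T" using T by simp
      have "(1 - l) * u T (x + h *\<^sub>R b) \<le> 0"
        using bd[of T "x + h *\<^sub>R b"] T l by (intro mult_nonneg_nonpos) auto
      with A have "u T (x + h *\<^sub>R b) \<le> u T x + (1 - l) * m + K * T" by (simp add: algebra_simps)
      also have "(1 - l) * m = X * \<bar>h\<bar>" using m by (simp add: l_def \<zeta>_def)
      also have "K * T = (1 / (q - 1)) powr (1 / (q - 1)) * X * \<bar>h\<bar>"
      proof -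
        have "(\<bar>h\<bar> / T) / ((q - 1) * (1 - l)) = (1 / (q - 1)) * (m / T / X)"
          using False q T m X by (simp add: l_def \<zeta>_def field_simps)
        also have "m / T / X = X powr (q - 1)"
          using X Xq by (simp add: powr_diff)
        finally have "((\<bar>h\<bar> / T) / ((q - 1) * (1 - l))) powr (1 / (q - 1))
            = (1 / (q - 1) * X powr (q - 1)) powr (1 / (q - 1))"
          by (rule arg_cong)
        also have "\<dots> = (1 / (q - 1)) powr (1 / (q - 1)) * (X powr (q - 1)) powr (1 / (q - 1))"
          using q X by (intro powr_mult)
        also have "(X powr (q - 1)) powr (1 / (q - 1)) = X"
          using q X by (simp add: powr_powr)
        finally show ?thesis using T by (simp add: K_def)
      qed
      finally show ?thesis by (simp add: grad_const_def algebra_simps)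
    qed simp
  qed
  then show ?thesis by (simp add: X_def)
qed

text \<open>Symmetrisation makes 0 a maximum of g s + g (- s) - 2 g 0 - E s^2, whose second
  derivative there is 2 D - 2 E.\<close>

lemma second_derivative_le:
  fixes g :: "real \<Rightarrow> real"
  assumes g: "\<And>s. (g has_real_derivative g' s) (at s)" and g': "(g' has_real_derivative D) (at 0)"
    and E: "\<And>h. g h + g (- h) - 2 * g 0 \<le> E * h\<^sup>2"
  shows "D \<le> E"
proof -
  have m: "((\<lambda>s. g (- s)) has_real_derivative - g' (- s)) (at s)" for s
    using DERIV_mirror[of g "g' (- s)" s] g by simp
  have m': "((\<lambda>s. g' (- s)) has_real_derivative - D) (at 0)"
    using DERIV_mirror[of g' D 0] g' by simp
  define G where "G s = g s + g (- s) - 2 * g 0 - E * s\<^sup>2" for s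
  have 1: "(G has_real_derivative g' s - g' (- s) - 2 * E * s) (at s)" for s
    unfolding G_def by (rule derivative_eq_intros g m refl | simp)+
  have 2: "((\<lambda>s. g' s - g' (- s) - 2 * E * s) has_real_derivative 2 * D - 2 * E) (at 0)"
    by (rule derivative_eq_intros g' m' refl | simp)+
  have "2 * D - 2 * E \<le> 0"
    by (rule second_derivative_at_max(2)[OF 1 2]) (use E in \<open>auto simp: G_def\<close>)
  then show ?thesis by simp
qed

text \<open>Translates moving in opposite directions feel the drift only through the difference d of
  their gradients, to first order, while strong convexity supplies d^2. Completing the square leaves
  a loss quadratic in h. The bound L fixes the ball on which |p|^q is strongly convex.\<close>

lemma hj_semiconcave:
  fixes u :: "real \<Rightarrow> 'a::euclidean_space \<Rightarrow> real"
  assumes q: "1 < q" "q < 2" and u: "hj_sol q u" and M: "\<And>t x. 0 \<le> t \<Longrightarrow> \<bar>u t x\<bar> \<le> M"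
    and L: "L > 0" "\<And>t x. t > 0 \<Longrightarrow> norm (grad (u t) x) \<le> L"
    and T: "T > 0" and b: "b \<in> Basis"
  shows "pd b (pd b (u T)) x \<le> L powr (2 - q) / (q * (q - 1) * T)"
proof -
  define \<kappa> where "\<kappa> = q * (q - 1) * L powr (q - 2) / 2"
  have \<kappa>: "\<kappa> > 0" using q L by (simp add: \<kappa>_def)
  have E: "1 / (2 * \<kappa> * T) = L powr (2 - q) / (q * (q - 1) * T)"
  proof -
    have "L powr (q - 2) = inverse (L powr (2 - q))" using powr_minus[of L "2 - q"] by simp
    moreover have "2 * \<kappa> * T = q * (q - 1) * T * L powr (q - 2)"
      unfolding \<kappa>_def by (simp only: times_divide_eq_right mult_ac)
    ultimately have "2 * \<kappa> * T = q * (q - 1) * T / L powr (2 - q)"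
      by (simp only: divide_inverse)
    then show ?thesis by (simp only: divide_divide_eq_right mult_1_left)
  qed
  have "pd b (pd b (u T)) x \<le> 1 / (2 * \<kappa> * T)"
  proof (rule second_derivative_le)
    show "((\<lambda>s. u T (x + s *\<^sub>R b)) has_real_derivative pd b (u T) (x + s *\<^sub>R b)) (at s)" for s
      by (intro has_pd_line hj_regD(2)[OF hj_solD(1)[OF u] T b])
    show "((\<lambda>s. pd b (u T) (x + s *\<^sub>R b)) has_real_derivative pd b (pd b (u T)) x) (at 0)"
      by (intro has_pdD hj_regD(3)[OF hj_solD(1)[OF u] T b])
    fix h :: real
    define c where "c i = (if i then h / T else - (h / T))" for i
    define K where "K = (h / T)\<^sup>2 / (4 * \<kappa>)"
    have "(\<Sum>i\<in>UNIV. 1 / 2 * u T (x + (c i * T) *\<^sub>R b)) \<le> u T x + 0 + K * T"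
    proof (rule hj_moving_comparison[where u = u and T = T and b = b and I = UNIV and a = "\<lambda>_. 1 / 2"
          and c = c and K = K and M = M and q = q, OF q(1) _ _ b _ u M])
      fix t :: real and p :: "bool \<Rightarrow> 'a"
      assume t: "t > 0" and p: "\<And>i. i \<in> UNIV \<Longrightarrow> \<exists>x. p i = grad (u t) x"
      have pL: "norm (p i) \<le> L" for i using p[of i] L(2)[OF t] by auto
      define x y where "x = p True" and "y = p False"
      define d where "d = norm (x - y)"
      have 1: "norm ((1/2) *\<^sub>R x + (1/2) *\<^sub>R y) powr q + \<kappa> / 4 * d\<^sup>2 \<le> 1/2 * norm x powr q + 1/2 * norm y powr q"
        unfolding d_def using q \<kappa> pL
        by (intro norm_powr_midpoint_strong[where L = L]) (auto simp: \<kappa>_def x_def y_def)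
      have 2: "h / T * (x \<bullet> b) - h / T * (y \<bullet> b) \<le> \<bar>h / T\<bar> * d"
        using scale_inner_le[of b "h / T" "x - y"] b unfolding d_def
        by (simp add: inner_diff_left right_diff_distrib)
      have 3: "1 / 2 * (k * d) - \<kappa> / 4 * d\<^sup>2 \<le> k\<^sup>2 / (4 * \<kappa>)" for k
      proof -
        have "0 \<le> (k - \<kappa> * d)\<^sup>2 / (4 * \<kappa>)" using \<kappa> by simp
        also have "\<dots> = k\<^sup>2 / (4 * \<kappa>) - (1 / 2 * (k * d) - \<kappa> / 4 * d\<^sup>2)"
          using \<kappa> by (simp add: power2_eq_square field_simps)
        finally show ?thesis by simp
      qed
      have "(\<Sum>i\<in>UNIV. 1 / 2 * (c i * (p i \<bullet> b) - norm (p i) powr q)) + norm (\<Sum>i\<in>UNIV. (1 / 2) *\<^sub>R p i) powr q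
        = 1 / 2 * (h / T * (x \<bullet> b) - h / T * (y \<bullet> b)) - (1/2 * norm x powr q + 1/2 * norm y powr q) + norm ((1/2) *\<^sub>R x + (1/2) *\<^sub>R y) powr q"
        by (simp add: UNIV_bool c_def x_def y_def algebra_simps)
      also have "\<dots> \<le> K" proof -
        have lin: "1 / 2 * e - S + z \<le> K" if "z + \<kappa> / 4 * d\<^sup>2 \<le> S" "e \<le> f" "1 / 2 * f - \<kappa> / 4 * d\<^sup>2 \<le> K" for e f S z
          using that by linarith
        show ?thesis
          by (rule lin[OF 1 2]) (use 3[of "\<bar>h / T\<bar>"] in \<open>simp only: K_def power2_abs\<close>)
      qed
      finally show "(\<Sum>i\<in>UNIV. 1 / 2 * (c i * (p i \<bullet> b) - norm (p i) powr q)) + norm (\<Sum>i\<in>UNIV. (1 / 2) *\<^sub>R p i) powr q \<le> K" .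
    qed (use q T in \<open>auto simp: UNIV_bool\<close>)
    then have "u T (x + h *\<^sub>R b) + u T (x + (- h) *\<^sub>R b) - 2 * u T x \<le> 2 * (K * T)"
      using T by (simp add: UNIV_bool c_def)
    also have "2 * (K * T) = 1 / (2 * \<kappa> * T) * h\<^sup>2"
      using T by (simp add: K_def power2_eq_square field_simps)
    finally show "u T (x + h *\<^sub>R b) + u T (x + (- h) *\<^sub>R b) - 2 * u T (x + 0 *\<^sub>R b) \<le> 1 / (2 * \<kappa> * T) * h\<^sup>2"
      by simp
  qed
  then show ?thesis by (simp add: E)
qed

text \<open>n * \<open>grad_const q\<close> * (2 m / T)^(1 / q) bounds the gradient from time T / 2
  on; the power 2 - q and the separate factor 2 come from semiconcavity over the remaining time T /
  2, the leading n from the sum over the axes.\<close>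

definition lap_const :: "real \<Rightarrow> real \<Rightarrow> real" where
  "lap_const q n = n * (n * grad_const q * 2 powr (1 / q)) powr (2 - q) * 2 / (q * (q - 1))"

text \<open>One half of the time produces the gradient bound, the other half semiconcavity. The
  exponents arise from (m / T)^((2 - q) / q) divided by T.\<close>

lemma hj_laplacian_decay:
  fixes u :: "real \<Rightarrow> 'a::euclidean_space \<Rightarrow> real"
  assumes q: "1 < q" "q < 2" and u: "hj_sol q u" and m: "m > 0"
    and bd: "\<And>t x. 0 \<le> t \<Longrightarrow> - m \<le> u t x \<and> u t x \<le> 0" and T: "T > 0"
  shows "laplacian (u T) x \<le> lap_const q (real DIM('a)) * m powr (2 / q - 1) * T powr (- (2 / q))"
proof -
  define n where "n = real DIM('a)"
  have n: "n > 0" by (simp add: n_def)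
  define L where "L = n * (grad_const q * (m / (T / 2)) powr (1 / q))"
  have gc: "grad_const q > 0" by (simp add: grad_const_def add_pos_nonneg)
  have L: "L > 0" using n gc m T by (simp add: L_def)
  define v where "v t = u (t + T / 2)" for t
  have v: "hj_sol q v" unfolding v_def using T by (intro hj_sol_shift_time[OF u]) auto
  have gr: "norm (grad (v t) x) \<le> L" if "t > 0" for t x
  proof -
    have "norm (grad (v t) x) \<le> (\<Sum>b\<in>Basis. \<bar>grad (v t) x \<bullet> b\<bar>)" by (rule norm_le_l1)
    also have "\<dots> \<le> (\<Sum>b\<in>(Basis::'a set). grad_const q * (m / (T / 2)) powr (1 / q))"
    proof (rule sum_mono)
      fix b :: 'a assume b: "b \<in> Basis"
      have "\<bar>pd b (v t) x\<bar> \<le> grad_const q * (m / (t + T / 2)) powr (1 / q)"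
        unfolding v_def using that T by (intro hj_pd_bound[OF q u m bd _ b]) auto
      also have "\<dots> \<le> grad_const q * (m / (T / 2)) powr (1 / q)"
        using gc m T that q by (intro mult_left_mono powr_mono2 divide_left_mono) auto
      finally show "\<bar>grad (v t) x \<bullet> b\<bar> \<le> grad_const q * (m / (T / 2)) powr (1 / q)"
        using b by (simp add: grad_inner)
    qed
    finally show ?thesis by (simp add: L_def n_def)
  qed
  have "laplacian (v (T / 2)) x \<le> (\<Sum>b\<in>(Basis::'a set). L powr (2 - q) / (q * (q - 1) * (T / 2)))"
    unfolding laplacian_def
  proof (rule sum_mono)
    fix b :: 'a assume b: "b \<in> Basis"
    show "pd b (pd b (v (T / 2))) x \<le> L powr (2 - q) / (q * (q - 1) * (T / 2))"
    proof (rule hj_semiconcave[OF q v _ L gr _ b])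
      show "\<bar>v t x\<bar> \<le> m" if "0 \<le> t" for t x using bd[of "t + T/2" x] that T by (auto simp: v_def)
    qed (use T in auto)
  qed
  also have "\<dots> = n * 2 / (q * (q - 1)) * L powr (2 - q) / T"
    using T by (simp add: n_def field_simps)
  also have "L powr (2 - q) = (n * grad_const q * 2 powr (1 / q)) powr (2 - q) * ((m / T) powr (1 / q)) powr (2 - q)"
  proof -
    have "L = (n * grad_const q * 2 powr (1 / q)) * (m / T) powr (1 / q)"
      using m T by (simp add: L_def powr_mult[symmetric] powr_divide mult.commute)
    then show ?thesis using n gc m T by (simp add: powr_mult)
  qed
  also have "((m / T) powr (1 / q)) powr (2 - q) = m powr (2 / q - 1) * T powr (- (2 / q - 1))"
  proof -
    have "1 / q * (2 - q) = 2 / q - 1" using q by (simp add: field_simps)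
    then show ?thesis using m T by (simp add: powr_powr powr_divide powr_minus_divide del: minus_diff_eq)
  qed
  finally have "laplacian (v (T / 2)) x \<le> lap_const q n * m powr (2 / q - 1) * (T powr (- (2 / q - 1)) / T)"
    by (simp add: lap_const_def algebra_simps)
  also have "T powr (- (2 / q - 1)) / T = T powr (- (2 / q))"
    using T powr_diff[of T "- (2 / q - 1)" 1] by simp
  finally show ?thesis by (simp add: v_def n_def)
qed

section \<open>Averages over axis directions\<close>

definition axis_dirs :: "('a::euclidean_space \<times> real) set" where
  "axis_dirs = Basis \<times> {1, -1}"

text \<open>One step of the simple random walk of mesh h. For f of class C^2 it adds h^2 / (2 N)
  times the Laplacian, up to o(h^2).\<close>

definition axis_avg :: "real \<Rightarrow> ('a::euclidean_space \<Rightarrow> real) \<Rightarrow> 'a \<Rightarrow> real" where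
  "axis_avg h f x = (\<Sum>i\<in>axis_dirs. 1 / (2 * real DIM('a)) * f (x + (snd i * h) *\<^sub>R fst i))"

lemma finite_axis_dirs [simp]: "finite axis_dirs" and axis_dirs_nonempty [simp]: "axis_dirs \<noteq> {}"
  by (auto simp: axis_dirs_def)

lemma axis_weights: "(\<Sum>i\<in>(axis_dirs :: ('a::euclidean_space \<times> real) set). 1 / (2 * real DIM('a))) = 1"
  by (simp add: axis_dirs_def card_cartesian_product)

lemma axis_avg_alt:
  fixes f :: "'a::euclidean_space \<Rightarrow> real"
  shows "axis_avg h f x = (\<Sum>b\<in>Basis. f (x + h *\<^sub>R b) + f (x - h *\<^sub>R b)) / (2 * real DIM('a))"
proof -
  have "axis_avg h f x = (\<Sum>b\<in>Basis. \<Sum>s\<in>{1, -1}. 1 / (2 * real DIM('a)) * f (x + (s * h) *\<^sub>R b))"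
    unfolding axis_avg_def axis_dirs_def by (subst sum.cartesian_product) (simp only: case_prod_unfold)
  also have "\<dots> = (\<Sum>b\<in>Basis. 1 / (2 * real DIM('a)) * (f (x + h *\<^sub>R b) + f (x - h *\<^sub>R b)))"
    by (intro sum.cong refl) (simp add: algebra_simps)
  finally show ?thesis by (simp add: sum_divide_distrib)
qed

lemma axis_avg_diff:
  fixes f :: "'a::euclidean_space \<Rightarrow> real"
  shows "axis_avg h f x - f x = (\<Sum>b\<in>Basis. f (x + h *\<^sub>R b) + f (x - h *\<^sub>R b) - 2 * f x) / (2 * real DIM('a))"
  unfolding axis_avg_alt by (simp add: sum_subtractf field_simps)

lemma axis_avg_mono: "(\<And>x. f x \<le> g x) \<Longrightarrow> axis_avg h f x \<le> axis_avg h g x"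
  unfolding axis_avg_def by (intro sum_mono mult_left_mono) auto

lemma axis_avg_const: "axis_avg h (\<lambda>_. c) x = c"
  by (simp add: axis_avg_alt)

lemma axis_avg_add: "axis_avg h (\<lambda>x. f x + g x) x = axis_avg h f x + axis_avg h g x"
  by (simp add: axis_avg_def distrib_left sum.distrib)

lemma axis_avg_cmult: "axis_avg h (\<lambda>x. c * f x) x = c * axis_avg h f x"
  by (simp add: axis_avg_def sum_distrib_left mult_ac)

lemma axis_avg_le_const: "(\<And>x. f x \<le> c) \<Longrightarrow> axis_avg h f x \<le> c"
  using axis_avg_mono[of f "\<lambda>_. c"] by (simp add: axis_avg_const)

lemma axis_avg_ge_const: "(\<And>x. c \<le> f x) \<Longrightarrow> c \<le> axis_avg h f x"
  using axis_avg_mono[of "\<lambda>_. c" f] by (simp add: axis_avg_const)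

lemma axis_avg_iter_bounds:
  assumes "\<And>x. \<bar>f x\<bar> \<le> M"
  shows "\<bar>(axis_avg h ^^ n) f x\<bar> \<le> M"
proof (induction n arbitrary: x)
  case (Suc n)
  have "axis_avg h ((axis_avg h ^^ n) f) x \<le> M"
    by (rule axis_avg_le_const) (use Suc in \<open>auto simp: abs_le_iff\<close>)
  moreover have "- M \<le> axis_avg h ((axis_avg h ^^ n) f) x"
    by (rule axis_avg_ge_const) (use Suc in \<open>auto simp: abs_le_iff minus_le_iff\<close>)
  ultimately show ?case by (simp add: abs_le_iff)
qed (use assms in simp)

lemma axis_avg_iter_mono:
  assumes "\<And>x. f x \<le> g x"
  shows "(axis_avg h ^^ n) f x \<le> (axis_avg h ^^ n) g x"
  by (induction n arbitrary: x) (auto intro: axis_avg_mono assms)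

lemma axis_avg_iter_le:
  assumes "\<And>x. axis_avg h f x \<le> f x + c"
  shows "(axis_avg h ^^ n) f x \<le> f x + real n * c"
proof (induction n arbitrary: x)
  case (Suc n)
  have "(axis_avg h ^^ Suc n) f x \<le> axis_avg h (\<lambda>x. f x + real n * c) x"
    using Suc by (auto intro: axis_avg_mono)
  also have "\<dots> = axis_avg h f x + real n * c"
    by (simp add: axis_avg_add axis_avg_const)
  also have "\<dots> \<le> f x + real (Suc n) * c"
    using assms[of x] by (simp add: algebra_simps)
  finally show ?case .
qed simp

lemma axis_avg_iter_add_const: "(axis_avg h ^^ n) (\<lambda>x. f x + c) x = (axis_avg h ^^ n) f x + c"
proof (induction n arbitrary: x)
  case (Suc n)
  then have "(axis_avg h ^^ n) (\<lambda>x. f x + c) = (\<lambda>x. (axis_avg h ^^ n) f x + c)" by auto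
  then show ?case by (simp add: axis_avg_add axis_avg_const)
qed simp

lemma axis_avg_subsolution:
  fixes w :: "real \<Rightarrow> 'a::euclidean_space \<Rightarrow> real"
  assumes q: "1 < q" "q \<le> 2" and w: "hj_reg w" "\<And>t x. t > 0 \<Longrightarrow> hj_defect q w t x \<le> 0"
    "continuous_on ({0..} \<times> UNIV) (\<lambda>(t, x). w t x)"
  shows "hj_reg (\<lambda>t. axis_avg h (w t))" "t > 0 \<Longrightarrow> hj_defect q (\<lambda>t. axis_avg h (w t)) t x \<le> 0"
    "continuous_on ({0..} \<times> UNIV) (\<lambda>(t, x). axis_avg h (w t) x)"
proof -
  define W where "W i t x = w t (x + (snd i * h) *\<^sub>R fst i)" for i :: "'a \<times> real" and t x
  define c where "c = 1 / (2 * real DIM('a))"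
  have c: "c \<ge> 0" by (simp add: c_def)
  have W: "hj_reg (W i)" for i unfolding W_def by (rule hj_translate(1)[OF w(1)])
  have eq: "(\<lambda>t. axis_avg h (w t)) = (\<lambda>t x. (\<Sum>i\<in>axis_dirs. c * W i t x) - 0 * t)"
    by (auto simp: fun_eq_iff axis_avg_def W_def c_def)
  note S = hj_defect_sum[where I = axis_dirs and W = W and c = "\<lambda>_. c" and K = 0, OF W]
  show "hj_reg (\<lambda>t. axis_avg h (w t))" unfolding eq by (rule S(1))
  show "hj_defect q (\<lambda>t. axis_avg h (w t)) t x \<le> 0" if t: "t > 0"
  proof -
    have "norm (\<Sum>i\<in>axis_dirs. c *\<^sub>R grad (W i t) x) powr q \<le> (\<Sum>i\<in>axis_dirs. c * norm (grad (W i t) x) powr q)"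
      using axis_weights[where 'a = 'a] c q
      by (intro convex_on_sum[OF _ _ convex_on_norm_powr]) (auto simp: c_def)
    moreover have "(\<Sum>i\<in>axis_dirs. c * hj_defect q (W i) t x) \<le> 0"
      using c w(2)[OF t] hj_translate(2)[OF w(1), of q _ t x]
      by (intro sum_nonpos mult_nonneg_nonpos) (auto simp: W_def[abs_def])
    ultimately show ?thesis
      unfolding eq S(2)[OF t] by (simp add: right_diff_distrib sum_subtractf)
  qed
  have "continuous_on ({0..} \<times> UNIV) (\<lambda>z. (\<lambda>(t, x). w t x) (fst z, snd z + (snd i * h) *\<^sub>R fst i))" for i :: "'a \<times> real"
    by (rule continuous_on_compose2[OF w(3)]) (auto intro!: continuous_intros)
  then show "continuous_on ({0..} \<times> UNIV) (\<lambda>(t, x). axis_avg h (w t) x)"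
    unfolding axis_avg_def case_prod_unfold by (intro continuous_intros) simp
qed

lemma axis_avg_iter_subsolution:
  fixes w :: "real \<Rightarrow> 'a::euclidean_space \<Rightarrow> real"
  assumes q: "1 < q" "q \<le> 2" and w: "hj_reg w" "\<And>t x. t > 0 \<Longrightarrow> hj_defect q w t x \<le> 0"
    "continuous_on ({0..} \<times> UNIV) (\<lambda>(t, x). w t x)"
  shows "hj_reg (\<lambda>t. (axis_avg h ^^ n) (w t)) \<and> (\<forall>t>0. \<forall>x. hj_defect q (\<lambda>t. (axis_avg h ^^ n) (w t)) t x \<le> 0)
    \<and> continuous_on ({0..} \<times> UNIV) (\<lambda>(t, x). (axis_avg h ^^ n) (w t) x)"
proof (induction n)
  case (Suc n)
  note S = axis_avg_subsolution[OF q, where w = "\<lambda>t. (axis_avg h ^^ n) (w t)" and h = h]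
  show ?case unfolding funpow.simps o_apply by (intro conjI allI impI S) (use Suc in auto)
qed (use w in auto)

lemma axis_avg_comparison:
  fixes u :: "real \<Rightarrow> 'a::euclidean_space \<Rightarrow> real"
  assumes q: "1 < q" "q \<le> 2" and u: "hj_sol q u" and M: "\<And>t x. 0 \<le> t \<Longrightarrow> \<bar>u t x\<bar> \<le> M"
    and T: "0 \<le> T" and init: "\<And>x. (axis_avg h ^^ n) (u 0) x \<le> u 0 x + D"
  shows "(axis_avg h ^^ n) (u T) x \<le> u T x + D"
proof -
  have sub: "hj_reg (\<lambda>t. (axis_avg h ^^ n) (u t)) \<and> (\<forall>t>0. \<forall>x. hj_defect q (\<lambda>t. (axis_avg h ^^ n) (u t)) t x \<le> 0)
    \<and> continuous_on ({0..} \<times> UNIV) (\<lambda>(t, x). (axis_avg h ^^ n) (u t) x)"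
    by (rule axis_avg_iter_subsolution[OF q]) (use hj_solD[OF u] in auto)
  show ?thesis
  proof (rule hj_comparison[where w = "\<lambda>t. (axis_avg h ^^ n) (u t)" and v = u and M = M, OF q T])
    show "continuous_on ({0..T} \<times> UNIV) (\<lambda>(t, x). (axis_avg h ^^ n) (u t) x)"
      by (rule continuous_on_subset[of "{0..} \<times> UNIV"]) (use sub in auto)
    show "continuous_on ({0..T} \<times> UNIV) (\<lambda>(t, x). u t x)"
      by (rule continuous_on_subset[OF hj_solD(3)[OF u]]) auto
    show "\<bar>(axis_avg h ^^ n) (u t) x\<bar> \<le> M" if "0 \<le> t" "t \<le> T" for t x
      by (rule axis_avg_iter_bounds) (rule M[OF that(1)])
  qed (use sub hj_solD[OF u] M init in auto)
qed

section \<open>From walk averages back to the pointwise Laplacian\<close>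

lemma second_difference_bound:
  fixes g :: "real \<Rightarrow> real"
  assumes g: "\<And>t. (g has_real_derivative g' t) (at t)" "\<And>t. (g' has_real_derivative g'' t) (at t)"
    and \<omega>: "\<And>t. \<bar>t\<bar> \<le> \<bar>h\<bar> \<Longrightarrow> \<bar>g'' t - g'' 0\<bar> \<le> \<omega>"
  shows "\<bar>g h + g (- h) - 2 * g 0 - h\<^sup>2 * g'' 0\<bar> \<le> h\<^sup>2 * \<omega>"
proof -
  define D where "D = (\<lambda>m::nat. if m = 0 then g else if m = 1 then g' else g'')"
  have D: "\<forall>m t. m < 2 \<and> \<bar>t\<bar> \<le> \<bar>k\<bar> \<longrightarrow> DERIV (D m) t :> D (Suc m) t" for k
    using g by (auto simp: D_def less_2_cases_iff)
  have T: "\<exists>t. \<bar>t\<bar> \<le> \<bar>k\<bar> \<and> g k = g 0 + g' 0 * k + g'' t / 2 * k\<^sup>2" for k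
    using Maclaurin_bi_le[OF _ D, of g k] by (simp add: D_def eval_nat_numeral)
  obtain t1 t2 where t: "\<bar>t1\<bar> \<le> \<bar>h\<bar>" "g h = g 0 + g' 0 * h + g'' t1 / 2 * h\<^sup>2"
    "\<bar>t2\<bar> \<le> \<bar>h\<bar>" "g (- h) = g 0 + g' 0 * (- h) + g'' t2 / 2 * h\<^sup>2"
    using T[of h] T[of "- h"] by auto
  have "g h + g (- h) - 2 * g 0 - h\<^sup>2 * g'' 0 = h\<^sup>2 * (((g'' t1 - g'' 0) + (g'' t2 - g'' 0)) / 2)"
    unfolding t by (simp add: field_simps)
  also have "\<bar>\<dots>\<bar> = h\<^sup>2 * \<bar>((g'' t1 - g'' 0) + (g'' t2 - g'' 0)) / 2\<bar>"
    by (simp add: abs_mult)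
  also have "\<dots> \<le> h\<^sup>2 * \<omega>"
    using \<omega>[OF t(1)] \<omega>[OF t(3)] by (intro mult_left_mono) auto
  finally show ?thesis .
qed

lemma axis_modulus:
  fixes k :: "'a::euclidean_space \<Rightarrow> real"
  assumes k: "continuous_on UNIV k" and S: "compact S" and \<omega>: "\<omega> > 0"
  shows "\<exists>d>0. d \<le> 1 \<and> (\<forall>y\<in>S. \<forall>b\<in>Basis. \<forall>t. \<bar>t\<bar> \<le> d \<longrightarrow> \<bar>k (y + t *\<^sub>R b) - k y\<bar> \<le> \<omega>)"
proof -
  obtain R where R: "\<And>y. y \<in> S \<Longrightarrow> norm y \<le> R"
    using compact_imp_bounded[OF S] unfolding bounded_iff by auto
  have "uniformly_continuous_on (cball 0 (R + 1)) k"
    by (intro compact_uniformly_continuous continuous_on_subset[OF k]) auto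
  then obtain e where e: "e > 0" "\<And>x x'. x \<in> cball 0 (R + 1) \<Longrightarrow> x' \<in> cball 0 (R + 1) \<Longrightarrow> dist x' x < e \<Longrightarrow> dist (k x') (k x) < \<omega>"
    using \<omega> unfolding uniformly_continuous_on_def by metis
  show ?thesis
  proof (intro exI[of _ "min 1 (e / 2)"] conjI ballI allI impI)
    fix y b :: 'a and t :: real assume y: "y \<in> S" and b: "b \<in> Basis" and t: "\<bar>t\<bar> \<le> min 1 (e / 2)"
    have "norm (y + t *\<^sub>R b) \<le> R + 1"
      using R[OF y] t b norm_triangle_ineq[of y "t *\<^sub>R b"] by simp
    moreover have "dist (y + t *\<^sub>R b) y < e" using t b e(1) by (simp add: dist_norm)
    ultimately have "dist (k (y + t *\<^sub>R b)) (k y) < \<omega>"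
      using R[OF y] by (intro e(2)) (auto simp: mem_cball_0)
    then show "\<bar>k (y + t *\<^sub>R b) - k y\<bar> \<le> \<omega>" by (simp add: dist_real_def)
  qed (use e in auto)
qed

text \<open>Dominates the \<open>k\<close>-fold average of \<open>|y - x\<^sub>0|\<^sup>4\<close>. For \<open>k h\<^sup>2 = s\<close> it is \<open>O(s\<^sup>2 + s h\<^sup>2)\<close> at \<open>x\<^sub>0\<close>, but bounded below
  away from \<open>x\<^sub>0\<close>, where no second-order expansion of the averaged function is available.\<close>

definition quartic_barrier :: "'a::euclidean_space \<Rightarrow> real \<Rightarrow> nat \<Rightarrow> 'a \<Rightarrow> real" where
  "quartic_barrier x0 h k y = ((y - x0) \<bullet> (y - x0))\<^sup>2 + 6 * real k * h\<^sup>2 * ((y - x0) \<bullet> (y - x0))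
     + real k * h ^ 4 + 3 * (real k)\<^sup>2 * h ^ 4"

text \<open>With S = |y - x0|^2, one step replaces S by S + h^2 on average and S^2 by at most S^2 +
  6 h^2 S + h^4. The term 6 k h^2 S collects the earlier increments; its own growth 6 k h^4 is
  covered by 3 (k + 1)^2 - 3 k^2 = 6 k + 3.\<close>

lemma axis_avg_quartic_barrier:
  fixes x0 :: "'a::euclidean_space"
  shows "axis_avg h (quartic_barrier x0 h k) y \<le> quartic_barrier x0 h (Suc k) y"
proof -
  define z where "z = y - x0"
  define S where "S = z \<bullet> z"
  define N where "N = real DIM('a)"
  have N: "N \<ge> 1" by (simp add: N_def Suc_leI)
  define a where "a = real k * h ^ 4 + 3 * (real k)\<^sup>2 * h ^ 4"
  have S0: "S \<ge> 0" by (simp add: S_def)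
  have pt: "quartic_barrier x0 h k (y + h *\<^sub>R b) + quartic_barrier x0 h k (y - h *\<^sub>R b)
      = 2 * ((S + h\<^sup>2)\<^sup>2 + 6 * real k * h\<^sup>2 * (S + h\<^sup>2) + a) + 8 * h\<^sup>2 * (z \<bullet> b)\<^sup>2" if b: "b \<in> Basis" for b
  proof -
    have e: "(y + s *\<^sub>R b - x0) \<bullet> (y + s *\<^sub>R b - x0) = S + 2 * s * (z \<bullet> b) + s\<^sup>2" for s
    proof -
      have eq: "y + s *\<^sub>R b - x0 = z + s *\<^sub>R b" by (simp add: z_def)
      show ?thesis unfolding eq using b
        by (simp add: S_def inner_add_left inner_add_right inner_commute power2_eq_square)
    qed
    have e': "(y - h *\<^sub>R b - x0) \<bullet> (y - h *\<^sub>R b - x0) = S - 2 * h * (z \<bullet> b) + h\<^sup>2"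
      using e[of "- h"] by simp
    show ?thesis unfolding quartic_barrier_def e e' a_def
      by (simp add: power2_eq_square algebra_simps)
  qed
  have SS: "(\<Sum>b\<in>Basis. (z \<bullet> b)\<^sup>2) = S"
    unfolding S_def by (subst euclidean_inner) (simp add: power2_eq_square)
  have "axis_avg h (quartic_barrier x0 h k) y
      = (\<Sum>b\<in>(Basis::'a set). 2 * ((S + h\<^sup>2)\<^sup>2 + 6 * real k * h\<^sup>2 * (S + h\<^sup>2) + a) + 8 * h\<^sup>2 * (z \<bullet> b)\<^sup>2) / (2 * N)"
    unfolding axis_avg_alt N_def using pt by simp
  also have "\<dots> = (N * (2 * ((S + h\<^sup>2)\<^sup>2 + 6 * real k * h\<^sup>2 * (S + h\<^sup>2) + a)) + 8 * h\<^sup>2 * S) / (2 * N)"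
    by (simp only: sum.distrib sum_constant sum_distrib_left[symmetric] SS N_def)
  also have "\<dots> = (S + h\<^sup>2)\<^sup>2 + 6 * real k * h\<^sup>2 * (S + h\<^sup>2) + a + 4 * h\<^sup>2 * S / N"
    using N by (simp add: field_simps)
  also have "\<dots> \<le> (S + h\<^sup>2)\<^sup>2 + 6 * real k * h\<^sup>2 * (S + h\<^sup>2) + a + 4 * h\<^sup>2 * S"
  proof -
    have "4 * h\<^sup>2 * S / N \<le> 4 * h\<^sup>2 * S / 1" using N S0 by (intro divide_left_mono) auto
    then show ?thesis by simp
  qed
  also have "\<dots> = S\<^sup>2 + 6 * real (Suc k) * h\<^sup>2 * S + (1 + 6 * real k) * h ^ 4 + a"
    by (simp add: power2_eq_square power4_eq_xxxx algebra_simps)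
  also have "\<dots> \<le> S\<^sup>2 + 6 * real (Suc k) * h\<^sup>2 * S + real (Suc k) * h ^ 4 + 3 * (real (Suc k))\<^sup>2 * h ^ 4"
    unfolding a_def by (simp add: power2_eq_square algebra_simps)
  finally show ?thesis unfolding quartic_barrier_def S_def z_def .
qed

text \<open>If the Laplacian exceeded A by 3 \<epsilon> at x0, it would exceed A by 2 \<epsilon> in
  a ball, and every fine walk step inside would raise g at the rate of A + \<epsilon>. Walks leaving
  the ball see only the bound m on g; the barrier weighs them at order s^2 + s h^2, below the gain
  of order s, so small s contradicts the assumption on averages.\<close>

lemma laplacian_le_from_axis_avg:
  fixes g :: "'a::euclidean_space \<Rightarrow> real"
  assumes m: "\<And>x. \<bar>g x\<bar> \<le> m"
    and pd1: "\<And>b x. b \<in> Basis \<Longrightarrow> has_pd b g x"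
    and pd2: "\<And>b x. b \<in> Basis \<Longrightarrow> has_pd b (pd b g) x"
    and cont: "\<And>b. b \<in> Basis \<Longrightarrow> continuous_on UNIV (pd b (pd b g))"
    and A: "\<And>s \<eta>. s > 0 \<Longrightarrow> \<eta> > 0 \<Longrightarrow> \<exists>d>0. \<forall>h n. 0 < h \<longrightarrow> h \<le> d \<longrightarrow> real n * h\<^sup>2 = s \<longrightarrow>
      (axis_avg h ^^ n) g x0 \<le> g x0 + s / (2 * real DIM('a)) * A + \<eta>"
  shows "laplacian g x0 \<le> A"
proof (rule ccontr)
  assume neg: "\<not> laplacian g x0 \<le> A"
  define N where "N = real DIM('a)"
  have N: "N \<ge> 1" by (simp add: N_def Suc_leI)
  define \<epsilon> where "\<epsilon> = (laplacian g x0 - A) / 3"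
  have \<epsilon>: "\<epsilon> > 0" using neg by (simp add: \<epsilon>_def)
  have lapc: "continuous_on UNIV (laplacian g)"
    unfolding laplacian_def[abs_def] by (intro continuous_intros cont)
  then have "isCont (laplacian g) x0" by (simp add: continuous_on_eq_continuous_at)
  then obtain r' where r': "r' > 0" "\<And>y. dist y x0 < r' \<Longrightarrow> dist (laplacian g y) (laplacian g x0) < \<epsilon>"
    using \<epsilon> unfolding continuous_at_eps_delta by metis
  define r where "r = r' / 2"
  have r: "r > 0" using r' by (simp add: r_def)
  have lap: "laplacian g y > A + 2 * \<epsilon>" if "dist y x0 \<le> r" for y
  proof -
    have "\<bar>laplacian g y - laplacian g x0\<bar> < \<epsilon>"
      using r'(2)[of y] that r'(1) by (simp add: r_def dist_real_def)
    moreover have "laplacian g x0 = A + 3 * \<epsilon>" by (simp add: \<epsilon>_def field_simps)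
    ultimately show ?thesis by linarith
  qed
  have "\<forall>b\<in>Basis. \<exists>d>0. \<forall>y\<in>cball x0 r. \<forall>t. \<bar>t\<bar> \<le> d \<longrightarrow> \<bar>pd b (pd b g) (y + t *\<^sub>R b) - pd b (pd b g) y\<bar> \<le> \<epsilon> / N"
  proof
    fix b :: 'a assume b: "b \<in> Basis"
    show "\<exists>d>0. \<forall>y\<in>cball x0 r. \<forall>t. \<bar>t\<bar> \<le> d \<longrightarrow> \<bar>pd b (pd b g) (y + t *\<^sub>R b) - pd b (pd b g) y\<bar> \<le> \<epsilon> / N"
      using axis_modulus[OF cont[OF b] compact_cball[of x0 r], of "\<epsilon> / N"] \<epsilon> N b by auto
  qed
  then obtain db where db: "\<And>b. b \<in> Basis \<Longrightarrow> db b > 0"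
    "\<And>b y t. b \<in> Basis \<Longrightarrow> y \<in> cball x0 r \<Longrightarrow> \<bar>t\<bar> \<le> db b \<Longrightarrow> \<bar>pd b (pd b g) (y + t *\<^sub>R b) - pd b (pd b g) y\<bar> \<le> \<epsilon> / N"
    by metis
  define d1 where "d1 = Min (db ` (Basis :: 'a set))"
  have d1: "d1 > 0" unfolding d1_def using db(1) by (subst Min_gr_iff) auto
  have d1le: "d1 \<le> db b" if "b \<in> Basis" for b unfolding d1_def using that by (intro Min_le) auto
  have m0: "m \<ge> 0" using m[of x0] by simp
  have step: "g y + h\<^sup>2 / (2 * N) * (A + \<epsilon>) \<le> axis_avg h g y" if h: "0 < h" "h \<le> d1" and y: "dist y x0 \<le> r" for h y
  proof -
    have 1: "h\<^sup>2 * pd b (pd b g) y - h\<^sup>2 * (\<epsilon> / N) \<le> g (y + h *\<^sub>R b) + g (y - h *\<^sub>R b) - 2 * g y"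
      if b: "b \<in> Basis" for b
    proof -
      have "\<bar>g (y + h *\<^sub>R b) + g (y + (- h) *\<^sub>R b) - 2 * g (y + 0 *\<^sub>R b) - h\<^sup>2 * pd b (pd b g) (y + 0 *\<^sub>R b)\<bar> \<le> h\<^sup>2 * (\<epsilon> / N)"
      proof (rule second_difference_bound)
        show "((\<lambda>t. g (y + t *\<^sub>R b)) has_real_derivative pd b g (y + t *\<^sub>R b)) (at t)" for t
          by (intro has_pd_line pd1 b)
        show "((\<lambda>t. pd b g (y + t *\<^sub>R b)) has_real_derivative pd b (pd b g) (y + t *\<^sub>R b)) (at t)" for t
          by (intro has_pd_line pd2 b)
        show "\<bar>pd b (pd b g) (y + t *\<^sub>R b) - pd b (pd b g) (y + 0 *\<^sub>R b)\<bar> \<le> \<epsilon> / N" if "\<bar>t\<bar> \<le> \<bar>h\<bar>" for t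
          using db(2)[OF b, of y t] d1le[OF b] h y that by (simp add: dist_commute)
      qed
      then show ?thesis by simp
    qed
    have "h\<^sup>2 * (A + \<epsilon>) \<le> h\<^sup>2 * (laplacian g y - \<epsilon>)"
      using lap[OF y] by (intro mult_left_mono) auto
    also have "\<dots> = (\<Sum>b\<in>Basis. h\<^sup>2 * pd b (pd b g) y - h\<^sup>2 * (\<epsilon> / N))"
      using N by (simp add: laplacian_def sum_subtractf sum_distrib_left N_def right_diff_distrib)
    also have "\<dots> \<le> (\<Sum>b\<in>Basis. g (y + h *\<^sub>R b) + g (y - h *\<^sub>R b) - 2 * g y)"
      by (intro sum_mono 1)
    also have "\<dots> = 2 * N * (axis_avg h g y - g y)"
      unfolding axis_avg_diff N_def by simp
    finally show ?thesis using N by (simp add: field_simps)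
  qed
  \<comment> \<open>Outside the ball the barrier is at least r^4; this factor pushes the claimed
    lower bound below - m, where it holds trivially.\<close>
  define \<Gamma> where "\<Gamma> = (2 * m + \<bar>A + \<epsilon>\<bar> + 1) / r ^ 4"
  have \<Gamma>: "\<Gamma> > 0" using m0 r by (simp add: \<Gamma>_def divide_pos_pos)
  have lower: "g y + real k * (h\<^sup>2 / (2 * N) * (A + \<epsilon>)) - \<Gamma> * quartic_barrier x0 h k y \<le> (axis_avg h ^^ k) g y"
    if h: "0 < h" "h \<le> d1" and k: "real k * h\<^sup>2 \<le> 1" for h k y
    using k
  proof (induction k arbitrary: y)
    case 0
    have "\<Gamma> * quartic_barrier x0 h 0 y \<ge> 0" using \<Gamma> by (simp add: quartic_barrier_def)
    then show ?case by simp
  next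
    case (Suc k)
    have k: "real k * h\<^sup>2 \<le> 1"
      using Suc.prems by (simp add: algebra_simps) (smt (verit) zero_le_power2)
    define c where "c = h\<^sup>2 / (2 * N) * (A + \<epsilon>)"
    show ?case
    proof (cases "dist y x0 \<le> r")
      case True
      have "g y + real (Suc k) * c - \<Gamma> * quartic_barrier x0 h (Suc k) y
          \<le> axis_avg h g y + real k * c - \<Gamma> * axis_avg h (quartic_barrier x0 h k) y"
      proof -
        have "real (Suc k) * c = c + real k * c" by (simp add: algebra_simps)
        moreover have "\<Gamma> * axis_avg h (quartic_barrier x0 h k) y \<le> \<Gamma> * quartic_barrier x0 h (Suc k) y"
          using \<Gamma> by (intro mult_left_mono axis_avg_quartic_barrier) auto
        ultimately show ?thesis using step[OF h True, folded c_def] by linarith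
      qed
      also have "\<dots> = axis_avg h (\<lambda>y. g y + (real k * c + (- \<Gamma>) * quartic_barrier x0 h k y)) y"
        by (simp only: axis_avg_add axis_avg_const axis_avg_cmult)
      also have "\<dots> \<le> axis_avg h ((axis_avg h ^^ k) g) y"
      proof (rule axis_avg_mono)
        show "g y + (real k * c + (- \<Gamma>) * quartic_barrier x0 h k y) \<le> (axis_avg h ^^ k) g y" for y
          using Suc.IH[OF k, of y, folded c_def] by simp
      qed
      finally show ?thesis by (simp add: c_def)
    next
      case False
      then have "r \<le> norm (y - x0)" by (simp add: dist_norm)
      then have "r ^ 4 \<le> norm (y - x0) ^ 4" using r by (intro power_mono) auto
      also have "\<dots> = ((y - x0) \<bullet> (y - x0))\<^sup>2" by (simp flip: power2_norm_eq_inner power_mult)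
      also have "\<dots> \<le> quartic_barrier x0 h (Suc k) y"
        unfolding quartic_barrier_def by (simp add: add_nonneg_nonneg)
      finally have "\<Gamma> * r ^ 4 \<le> \<Gamma> * quartic_barrier x0 h (Suc k) y" using \<Gamma> by simp
      then have 1: "2 * m + \<bar>A + \<epsilon>\<bar> + 1 \<le> \<Gamma> * quartic_barrier x0 h (Suc k) y"
        using r by (simp add: \<Gamma>_def)
      have "real (Suc k) * c = (real (Suc k) * h\<^sup>2) / (2 * N) * (A + \<epsilon>)" by (simp add: c_def)
      also have "\<dots> \<le> (real (Suc k) * h\<^sup>2) / (2 * N) * \<bar>A + \<epsilon>\<bar>"
        using N by (intro mult_left_mono) auto
      also have "\<dots> \<le> 1 * \<bar>A + \<epsilon>\<bar>"
        using N Suc.prems by (intro mult_right_mono) (auto simp: divide_le_eq)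
      finally have 2: "real (Suc k) * c \<le> \<bar>A + \<epsilon>\<bar>" by simp
      have "- m \<le> (axis_avg h ^^ Suc k) g y" 
        using axis_avg_iter_bounds[where f = g and M = m and h = h and n = "Suc k" and x = y] m by (simp add: abs_le_iff)
      then show ?thesis using 1 2 m[of y] unfolding c_def by (simp only: abs_le_iff) linarith
    qed
  qed
  \<comment> \<open>At x0 the barrier costs \<Gamma> (s h^2 + 3 s^2), against a gain of s \<epsilon>
    / (2 N). The choices of s, \<eta> and of the bound on h keep the total cost at s \<epsilon> / N
    times 1/9 + 1/8 + 1/8, which is less than 1/2.\<close>
  define s where "s = min 1 (\<epsilon> / (24 * N * \<Gamma>))"
  have s: "0 < s" "s \<le> 1" using \<epsilon> N \<Gamma> by (auto simp: s_def)
  define \<eta> where "\<eta> = s * (\<epsilon> / (8 * N))"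
  have \<eta>: "\<eta> > 0" using s \<epsilon> N by (simp add: \<eta>_def)
  obtain d2 where d2: "d2 > 0" "\<And>h n. 0 < h \<Longrightarrow> h \<le> d2 \<Longrightarrow> real n * h\<^sup>2 = s \<Longrightarrow>
      (axis_avg h ^^ n) g x0 \<le> g x0 + s / (2 * N) * A + \<eta>"
    using A[OF s(1) \<eta>] unfolding N_def by blast
  define d where "d = min (min d1 d2) (sqrt (\<epsilon> / (9 * N * \<Gamma>)))"
  have d: "d > 0" using d1 d2 \<epsilon> N \<Gamma> by (simp add: d_def)
  \<comment> \<open>The number of steps comes first, so that h = sqrt (s / n) satisfies n h^2 = s
    exactly.\<close>
  obtain n :: nat where n: "s / d\<^sup>2 < real n" using reals_Archimedean2 by blast
  have "0 < s / d\<^sup>2" using s d by simp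
  then have n0: "0 < real n" using n by linarith
  define h where "h = sqrt (s / real n)"
  have h2: "h\<^sup>2 = s / real n" using s n0 by (simp add: h_def)
  have h0: "h > 0" using s n0 by (simp add: h_def)
  have nh: "real n * h\<^sup>2 = s" using n0 by (simp add: h2)
  have "h\<^sup>2 \<le> d\<^sup>2" unfolding h2 using n n0 d by (simp add: field_simps)
  then have hd: "h \<le> d" by (rule power2_le_imp_le) (use d in simp)
  have "h\<^sup>2 \<le> (sqrt (\<epsilon> / (9 * N * \<Gamma>)))\<^sup>2" using hd h0 by (intro power_mono) (auto simp: d_def)
  then have hG: "h\<^sup>2 \<le> \<epsilon> / (9 * N * \<Gamma>)" using \<epsilon> N \<Gamma> by simp
  have "g x0 + real n * (h\<^sup>2 / (2 * N) * (A + \<epsilon>)) - \<Gamma> * quartic_barrier x0 h n x0 \<le> (axis_avg h ^^ n) g x0"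
    by (rule lower) (use h0 hd nh s in \<open>auto simp: d_def\<close>)
  also have "\<dots> \<le> g x0 + s / (2 * N) * A + \<eta>"
    using d2(2)[OF h0 _ nh] hd by (simp add: d_def)
  also have "real n * (h\<^sup>2 / (2 * N) * (A + \<epsilon>)) = s / (2 * N) * (A + \<epsilon>)"
    unfolding nh[symmetric] by simp
  also have "quartic_barrier x0 h n x0 = s * h\<^sup>2 + 3 * s\<^sup>2"
    unfolding quartic_barrier_def nh[symmetric] by (simp add: power2_eq_square power4_eq_xxxx algebra_simps)
  finally have "g x0 + s / (2 * N) * (A + \<epsilon>) - \<Gamma> * (s * h\<^sup>2 + 3 * s\<^sup>2) \<le> g x0 + s / (2 * N) * A + \<eta>" .
  moreover have "s / (2 * N) * (A + \<epsilon>) = s / (2 * N) * A + s * (\<epsilon> / (2 * N))"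
    by (simp add: distrib_left)
  ultimately have fin: "s * (\<epsilon> / (2 * N)) \<le> \<Gamma> * (s * h\<^sup>2 + 3 * s\<^sup>2) + \<eta>" by linarith
  have "\<Gamma> * h\<^sup>2 \<le> \<Gamma> * (\<epsilon> / (9 * N * \<Gamma>))" using hG \<Gamma> by (intro mult_left_mono) auto
  also have "\<dots> = \<epsilon> / (9 * N)" using \<Gamma> by simp
  finally have a1: "\<Gamma> * h\<^sup>2 \<le> \<epsilon> / (9 * N)" .
  have "\<Gamma> * s \<le> \<Gamma> * (\<epsilon> / (24 * N * \<Gamma>))" using \<Gamma> by (intro mult_left_mono) (auto simp: s_def)
  also have "\<dots> = \<epsilon> / (24 * N)" using \<Gamma> by simp
  finally have a2: "\<Gamma> * (3 * s) \<le> \<epsilon> / (8 * N)" by simp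
  have "\<Gamma> * (s * h\<^sup>2 + 3 * s\<^sup>2) + \<eta> = s * (\<Gamma> * h\<^sup>2 + \<Gamma> * (3 * s) + \<epsilon> / (8 * N))"
    by (simp add: \<eta>_def power2_eq_square algebra_simps)
  also have "\<dots> \<le> s * (\<epsilon> / (9 * N) + \<epsilon> / (8 * N) + \<epsilon> / (8 * N))"
    using a1 a2 s by (intro mult_left_mono) auto
  also have "\<dots> < s * (\<epsilon> / (2 * N))"
  proof (intro mult_strict_left_mono s)
    define X where "X = \<epsilon> / N"
    have "X > 0" using \<epsilon> N by (simp add: X_def)
    moreover have "\<epsilon> / (9 * N) = X / 9" "\<epsilon> / (8 * N) = X / 8" "\<epsilon> / (2 * N) = X / 2" by (simp_all add: X_def)
    ultimately show "\<epsilon> / (9 * N) + \<epsilon> / (8 * N) + \<epsilon> / (8 * N) < \<epsilon> / (2 * N)" by simp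
  qed
  finally show False using fin by simp
qed

section \<open>Smooth bumps\<close>

text \<open>The polynomial factor makes the family closed under differentiation, which acts on
  polynomials as p -> X^2 (p - p'). Smoothness is thereby reduced to continuity.\<close>

definition flat_exp :: "real poly \<Rightarrow> real \<Rightarrow> real" where
  "flat_exp p s = (if s > 0 then poly p (1 / s) * exp (- (1 / s)) else 0)"

lemma poly_times_exp_minus_tendsto_0: "((\<lambda>x. poly p x * exp (- x)) \<longlongrightarrow> (0::real)) at_top"
proof -
  have "((\<lambda>x. \<Sum>i\<le>degree p. coeff p i * (x ^ i / exp x)) \<longlongrightarrow> (\<Sum>i\<le>degree p. coeff p i * 0)) at_top"
    by (intro tendsto_intros tendsto_power_div_exp_0)
  then show ?thesis
    by (simp add: poly_altdef sum_distrib_right exp_minus divide_inverse mult.assoc)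
qed

lemma flat_exp_tendsto_0: "((\<lambda>s. poly p (1 / s) * exp (- (1 / s))) \<longlongrightarrow> (0::real)) (at_right 0)"
proof -
  have "filterlim (\<lambda>s::real. 1 / s) at_top (at_right 0)"
    by (simp add: filterlim_inverse_at_top_right flip: inverse_eq_divide)
  from filterlim_compose[OF poly_times_exp_minus_tendsto_0 this] show ?thesis .
qed

lemma flat_exp_deriv:
  "(flat_exp p has_real_derivative flat_exp ([:0, 0, 1:] * (p - pderiv p)) s) (at s)"
proof -
  consider "s > 0" | "s < 0" | "s = 0" by linarith
  then show ?thesis
  proof cases
    case 1
    have "((\<lambda>s. poly p (1 / s) * exp (- (1 / s))) has_real_derivative flat_exp ([:0, 0, 1:] * (p - pderiv p)) s) (at s)"
      using 1 by (auto intro!: derivative_eq_intros DERIV_chain2[OF poly_DERIV] simp: flat_exp_def field_simps power2_eq_square)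
    moreover have "\<forall>\<^sub>F s' in nhds s. flat_exp p s' = poly p (1 / s') * exp (- (1 / s'))"
      using 1 eventually_nhds_in_open[of "{0<..}" s] by (auto elim!: eventually_mono simp: flat_exp_def)
    ultimately show ?thesis
      by (subst DERIV_cong_ev[OF refl _ refl]) auto
  next
    case 2
    have "((\<lambda>s. 0) has_real_derivative flat_exp ([:0, 0, 1:] * (p - pderiv p)) s) (at s)"
      using 2 by (simp add: flat_exp_def)
    moreover have "\<forall>\<^sub>F s' in nhds s. flat_exp p s' = 0"
      using 2 eventually_nhds_in_open[of "{..<0}" s] by (auto elim!: eventually_mono simp: flat_exp_def)
    ultimately show ?thesis
      by (subst DERIV_cong_ev[OF refl _ refl]) auto
  next
    case 3
    have "((\<lambda>h. flat_exp p h / h) \<longlongrightarrow> 0) (at_right 0)"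
    proof (rule Lim_transform_eventually)
      \<comment> \<open>The difference quotient at 0 is a function of the same kind, with polynomial
        X p.\<close>
      show "((\<lambda>s. poly ([:0, 1:] * p) (1 / s) * exp (- (1 / s))) \<longlongrightarrow> (0::real)) (at_right 0)"
        by (rule flat_exp_tendsto_0)
      show "\<forall>\<^sub>F s in at_right 0. poly ([:0, 1:] * p) (1 / s) * exp (- (1 / s)) = flat_exp p s / s"
        by (auto simp: eventually_at_right_less flat_exp_def eventually_at_filter)
    qed
    moreover have "((\<lambda>h. flat_exp p h / h) \<longlongrightarrow> 0) (at_left 0)"
      by (rule tendsto_eventually) (auto simp: flat_exp_def eventually_at_filter)
    ultimately have "((\<lambda>h. flat_exp p h / h) \<longlongrightarrow> 0) (at 0)"
      by (simp add: filterlim_split_at)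
    then show ?thesis using 3 by (simp add: DERIV_def flat_exp_def)
  qed
qed

lemma continuous_flat_exp: "continuous_on UNIV (flat_exp p)"
  using flat_exp_deriv by (intro DERIV_continuous_on) (auto intro: has_field_derivative_at_within)

text \<open>Each of the 2 N faces of the cube of half-side d carries its own polynomial, so a
  partial derivative is a combination of two members of the family, and induction on the order
  applies.\<close>

definition cube_bump :: "real \<Rightarrow> ('a::euclidean_space \<Rightarrow> real poly) \<Rightarrow> ('a \<Rightarrow> real poly) \<Rightarrow> 'a \<Rightarrow> real" where
  "cube_bump d p r y = (\<Prod>b\<in>Basis. flat_exp (p b) (d + y \<bullet> b) * flat_exp (r b) (d - y \<bullet> b))"

lemma cube_bump_pd:
  fixes p r :: "'a::euclidean_space \<Rightarrow> real poly" and c y :: 'a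
  assumes c: "c \<in> Basis"
  defines "q \<equiv> (\<lambda>p. [:0, 0, 1:] * (p - pderiv p) :: real poly)"
  shows "has_pd c (cube_bump d p r) y"
    and "pd c (cube_bump d p r) = (\<lambda>y. 1 * cube_bump d (p(c := q (p c))) r y + (-1) * cube_bump d p (r(c := q (r c))) y)"
proof -
  have split: "cube_bump d p r y = (\<Prod>b\<in>Basis - {c}. flat_exp (p b) (d + y \<bullet> b) * flat_exp (r b) (d - y \<bullet> b))
      * (flat_exp (p c) (d + y \<bullet> c) * flat_exp (r c) (d - y \<bullet> c))" for p r :: "'a \<Rightarrow> real poly" and y :: 'a
    unfolding cube_bump_def by (subst prod.remove[OF _ c]) (auto simp: mult.commute)
  have other: "(\<Prod>b\<in>Basis - {c}. flat_exp ((p(c := P)) b) (d + y \<bullet> b) * flat_exp ((r(c := R)) b) (d - y \<bullet> b))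
    = (\<Prod>b\<in>Basis - {c}. flat_exp (p b) (d + y \<bullet> b) * flat_exp (r b) (d - y \<bullet> b))" for P R y
    by (intro prod.cong) auto
  have D: "((\<lambda>s. cube_bump d p r (y + s *\<^sub>R c)) has_real_derivative
      1 * cube_bump d (p(c := q (p c))) r y + (-1) * cube_bump d p (r(c := q (r c))) y) (at 0)" for y
  proof -
    define C where "C = (\<Prod>b\<in>Basis - {c}. flat_exp (p b) (d + y \<bullet> b) * flat_exp (r b) (d - y \<bullet> b))"
    have C: "(\<Prod>b\<in>Basis - {c}. flat_exp (p b) (d + (y + s *\<^sub>R c) \<bullet> b) * flat_exp (r b) (d - (y + s *\<^sub>R c) \<bullet> b)) = C" for s
      unfolding C_def using c by (intro prod.cong refl) (auto simp: inner_add_left inner_Basis)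
    have a: "((\<lambda>s. flat_exp P (d + (y + s *\<^sub>R c) \<bullet> c)) has_real_derivative flat_exp (q P) (d + (y + 0 *\<^sub>R c) \<bullet> c) * 1) (at 0)" for P
      unfolding q_def using c
      by (intro DERIV_chain2[OF flat_exp_deriv]) (auto intro!: derivative_eq_intros simp: inner_add_left)
    have b: "((\<lambda>s. flat_exp P (d - (y + s *\<^sub>R c) \<bullet> c)) has_real_derivative flat_exp (q P) (d - (y + 0 *\<^sub>R c) \<bullet> c) * (-1)) (at 0)" for P
      unfolding q_def using c
      by (intro DERIV_chain2[OF flat_exp_deriv]) (auto intro!: derivative_eq_intros simp: inner_add_left)
    show ?thesis
      unfolding split[of p r] C
      by (rule DERIV_cong[OF DERIV_cmult[OF DERIV_mult[OF a b]]])
        (use other[of "q (p c)" y "r c"] other[of "p c" y "q (r c)"] in \<open>simp add: split C_def algebra_simps\<close>)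
  qed
  show "has_pd c (cube_bump d p r) y" by (rule pdI(1)[OF D])
  show "pd c (cube_bump d p r) = (\<lambda>y. 1 * cube_bump d (p(c := q (p c))) r y + (-1) * cube_bump d p (r(c := q (r c))) y)"
    using pdI(2)[OF D] by blast
qed

lemma C_k_lincomb:
  "C_k k f \<Longrightarrow> C_k k g \<Longrightarrow> C_k k (\<lambda>x. a * f x + b * g x)"
proof (induction k arbitrary: f g)
  case 0
  then show ?case by (auto intro!: continuous_intros)
next
  case (Suc k)
  have D: "((\<lambda>s. a * f (x + s *\<^sub>R c) + b * g (x + s *\<^sub>R c)) has_real_derivative a * pd c f x + b * pd c g x) (at 0)"
    if "c \<in> Basis" for c x
    using Suc.prems that by (intro DERIV_add DERIV_cmult has_pdD) auto
  have "pd c (\<lambda>x. a * f x + b * g x) = (\<lambda>x. a * pd c f x + b * pd c g x)" if "c \<in> Basis" for c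
    using pdI(2)[OF D[OF that]] by blast
  then show ?case
    using Suc pdI(1)[OF D] by (auto intro!: continuous_intros)
qed

lemma continuous_cube_bump: "continuous_on UNIV (cube_bump d p r)"
proof -
  have "continuous_on UNIV (\<lambda>y. \<Prod>b\<in>Basis. flat_exp (p b) (d + y \<bullet> b) * flat_exp (r b) (d - y \<bullet> b))"
    by (intro continuous_intros continuous_on_compose2[OF continuous_flat_exp]) auto
  then show ?thesis by (simp add: cube_bump_def[abs_def])
qed

lemma C_k_cube_bump: "C_k k (cube_bump d p r)"
proof (induction k arbitrary: p r)
  case (Suc k)
  show ?case
    unfolding C_k.simps
  proof (intro conjI ballI allI continuous_cube_bump)
    fix b x :: 'a assume b: "b \<in> Basis"
    show "has_pd b (cube_bump d p r) x" by (rule cube_bump_pd(1)[OF b])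
    show "C_k k (pd b (cube_bump d p r))"
      unfolding cube_bump_pd(2)[OF b] by (rule C_k_lincomb[OF Suc Suc])
  qed
qed (simp add: continuous_cube_bump)

lemma integrable_continuous_compact_support:
  fixes f :: "'a::euclidean_space \<Rightarrow> real"
  assumes f: "continuous_on UNIV f" and K: "compact K" "\<And>x. x \<notin> K \<Longrightarrow> f x = 0"
  shows "integrable lebesgue f"
proof -
  have "integrable lborel (\<lambda>x. indicator K x *\<^sub>R f x)"
    by (intro borel_integrable_compact K continuous_on_subset[OF f]) auto
  also have "(\<lambda>x. indicator K x *\<^sub>R f x) = f"
    using K(2) by (auto simp: indicator_def fun_eq_iff)
  finally show ?thesis
    using borel_measurable_continuous_onI[OF f] by (simp add: integrable_completion)
qed

text \<open>The set where f exceeds c is open and null, hence empty.\<close>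

lemma AE_continuous_le:
  fixes f :: "'a::euclidean_space \<Rightarrow> real"
  assumes f: "continuous_on UNIV f" and ae: "AE x in lebesgue. f x \<le> c"
  shows "f x \<le> c"
proof (rule ccontr)
  assume "\<not> f x \<le> c"
  have "open {x. c < f x}" by (intro open_Collect_less continuous_intros f)
  moreover have "{x. c < f x} \<noteq> {}" using \<open>\<not> f x \<le> c\<close> by (auto simp: not_le)
  moreover have "{x. c < f x} \<in> null_sets lebesgue"
    using ae \<open>open {x. c < f x}\<close>
    by (subst AE_iff_null_sets) (auto simp: not_less intro: borel_open)
  ultimately show False
    using open_not_negligible negligible_iff_null_sets by blast
qed

lemma mollifier_exists:
  fixes d :: real
  assumes d: "d > 0"
  obtains \<phi> :: "'a::euclidean_space \<Rightarrow> real"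
  where "test_fun \<phi>" "\<And>y. 0 \<le> \<phi> y" "\<And>y b. \<phi> y \<noteq> 0 \<Longrightarrow> b \<in> Basis \<Longrightarrow> \<bar>y \<bullet> b\<bar> < d" "(\<integral>y. \<phi> y \<partial>lebesgue) = 1"
proof -
  define \<psi> :: "'a \<Rightarrow> real" where "\<psi> = cube_bump d (\<lambda>_. 1) (\<lambda>_. 1)"
  have nn: "\<psi> y \<ge> 0" for y
    unfolding \<psi>_def cube_bump_def by (intro prod_nonneg) (auto simp: flat_exp_def)
  have supp: "\<bar>y \<bullet> b\<bar> < d" if "\<psi> y \<noteq> 0" "b \<in> Basis" for y b
  proof -
    have "flat_exp 1 (d + y \<bullet> b) * flat_exp 1 (d - y \<bullet> b) \<noteq> 0"
      using that unfolding \<psi>_def cube_bump_def by (simp add: prod_zero_iff)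
    then show ?thesis by (auto simp: flat_exp_def abs_less_iff split: if_splits)
  qed
  have cont: "continuous_on UNIV \<psi>" unfolding \<psi>_def by (rule continuous_cube_bump)
  have nb: "norm y \<le> real DIM('a) * d" if "\<psi> y \<noteq> 0" for y
  proof -
    have "norm y \<le> (\<Sum>b\<in>Basis. \<bar>y \<bullet> b\<bar>)" by (rule norm_le_l1)
    also have "\<dots> \<le> (\<Sum>b\<in>(Basis::'a set). d)"
      by (intro sum_mono) (use supp[OF that] in \<open>auto intro: less_imp_le\<close>)
    finally show ?thesis by simp
  qed
  have bdd: "bounded {y. \<psi> y \<noteq> 0}" using nb unfolding bounded_iff by blast
  have int: "integrable lebesgue \<psi>"
  proof (rule integrable_continuous_compact_support[OF cont])
    show "compact (closure {y. \<psi> y \<noteq> 0})" using bdd by (simp add: compact_closure)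
    show "\<psi> x = 0" if "x \<notin> closure {y. \<psi> y \<noteq> 0}" for x using that closure_subset[of "{y. \<psi> y \<noteq> 0}"] by auto
  qed
  define c where "c = (\<integral>y. \<psi> y \<partial>lebesgue)"
  have "c \<noteq> 0"
  proof
    assume "c = 0"
    then have "AE y in lebesgue. \<psi> y = 0"
      using integral_nonneg_eq_0_iff_AE[OF int] nn by (simp add: c_def)
    then have "AE y in lebesgue. \<psi> y \<le> 0" by eventually_elim simp
    then have "\<psi> 0 \<le> 0" by (rule AE_continuous_le[OF cont])
    moreover have "\<psi> 0 > 0"
      unfolding \<psi>_def cube_bump_def using d by (intro prod_pos) (auto simp: flat_exp_def)
    ultimately show False by simp
  qed
  moreover have "c \<ge> 0" unfolding c_def by (rule Bochner_Integration.integral_nonneg) (rule nn)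
  ultimately have c: "c > 0" by simp
  \<comment> \<open>The summand 0 * \<psi> y gives \<phi> the shape required by
    \<open>C_k_lincomb\<close>.\<close>
  define \<phi> where "\<phi> y = (1 / c) * \<psi> y + 0 * \<psi> y" for y
  have sup_eq: "{y. \<phi> y \<noteq> 0} = {y. \<psi> y \<noteq> 0}" using c by (auto simp: \<phi>_def)
  show ?thesis
  proof (rule that[of \<phi>])
    have "C_k k \<phi>" for k
      unfolding \<phi>_def[abs_def] by (intro C_k_lincomb) (auto simp: \<psi>_def C_k_cube_bump)
    then show "test_fun \<phi>"
      unfolding test_fun_def sup_eq using bdd by (simp add: compact_closure)
    show "0 \<le> \<phi> y" for y using nn c by (simp add: \<phi>_def)
    show "\<bar>y \<bullet> b\<bar> < d" if "\<phi> y \<noteq> 0" "b \<in> Basis" for y b using supp that by (auto simp: \<phi>_def)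
    show "(\<integral>y. \<phi> y \<partial>lebesgue) = 1" using c by (simp add: \<phi>_def c_def)
  qed
qed

section \<open>Mollification\<close>

lemma lebesgue_integral_translate:
  fixes f :: "'a::euclidean_space \<Rightarrow> real"
  assumes f[measurable]: "f \<in> borel_measurable borel"
  shows "(\<integral>y. f (y - x) \<partial>lebesgue) = (\<integral>y. f y \<partial>lebesgue)"
proof -
  have "(\<integral>y. f (y - x) \<partial>lebesgue) = (\<integral>y. f (y - x) \<partial>lborel)"
    by (intro integral_completion) simp
  also have "\<dots> = (\<integral>y. f y \<partial>distr lborel borel ((+) (- x)))"
    by (subst integral_distr) auto
  also have "\<dots> = (\<integral>y. f y \<partial>lebesgue)"
    unfolding lborel_distr_plus by (intro integral_completion[symmetric]) simp
  finally show ?thesis .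
qed

lemma test_fun_iff:
  "test_fun \<phi> \<longleftrightarrow> (\<forall>k. C_k k \<phi>) \<and> (\<exists>R\<ge>0. \<forall>y. R < norm y \<longrightarrow> \<phi> y = 0)"
proof
  assume t: "test_fun \<phi>"
  then have "bounded (closure {x. \<phi> x \<noteq> 0})" by (simp add: test_fun_def compact_imp_bounded)
  then obtain R where R: "R > 0" "\<And>x. x \<in> closure {x. \<phi> x \<noteq> 0} \<Longrightarrow> norm x \<le> R"
    unfolding bounded_pos by blast
  have "\<forall>y. R < norm y \<longrightarrow> \<phi> y = 0"
    using R(2) closure_subset[of "{x. \<phi> x \<noteq> 0}"] by (meson in_mono linorder_not_le mem_Collect_eq)
  then show "(\<forall>k. C_k k \<phi>) \<and> (\<exists>R\<ge>0. \<forall>y. R < norm y \<longrightarrow> \<phi> y = 0)"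
    using t R(1) unfolding test_fun_def by (meson less_imp_le)
next
  assume a: "(\<forall>k. C_k k \<phi>) \<and> (\<exists>R\<ge>0. \<forall>y. R < norm y \<longrightarrow> \<phi> y = 0)"
  then obtain R where "\<And>y. R < norm y \<Longrightarrow> \<phi> y = 0" by blast
  then have "\<forall>y\<in>{x. \<phi> x \<noteq> 0}. norm y \<le> R" by (meson linorder_not_le mem_Collect_eq)
  then have "bounded {x. \<phi> x \<noteq> 0}" unfolding bounded_iff by blast
  then show "test_fun \<phi>" using a by (simp add: test_fun_def compact_closure)
qed

lemma pd_zero_outside:
  assumes "\<And>y. R < norm y \<Longrightarrow> \<phi> y = 0" "R < norm y"
  shows "pd b \<phi> y = 0"
proof -
  have "open {s. R < norm (y + s *\<^sub>R b)}"
    by (intro open_Collect_less continuous_intros)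
  then have "\<forall>\<^sub>F s in nhds 0. s \<in> {s. R < norm (y + s *\<^sub>R b)}"
    using assms(2) by (intro eventually_nhds_in_open) auto
  then have "\<forall>\<^sub>F s in nhds 0. \<phi> (y + s *\<^sub>R b) = 0"
    by eventually_elim (use assms(1) in auto)
  then have "((\<lambda>s. \<phi> (y + s *\<^sub>R b)) has_real_derivative 0) (at 0)"
    by (subst DERIV_cong_ev[OF refl _ refl, where g = "\<lambda>_. 0"]) auto
  then show ?thesis by (rule pdI(2))
qed

lemma test_funD:
  assumes "test_fun \<phi>"
  shows "C_k k \<phi>" "continuous_on UNIV \<phi>" "b \<in> Basis \<Longrightarrow> has_pd b \<phi> x"
proof -
  show *: "C_k k \<phi>" for k using assms by (simp add: test_fun_def)
  show "continuous_on UNIV \<phi>" using *[of 0] by simp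
  show "has_pd b \<phi> x" if "b \<in> Basis" using *[of "Suc 0"] that by simp
qed

lemma test_fun_pd:
  assumes \<phi>: "test_fun \<phi>" and b: "b \<in> Basis"
  shows "test_fun (pd b \<phi>)"
proof -
  obtain R where R: "R \<ge> 0" "\<And>y. R < norm y \<Longrightarrow> \<phi> y = 0" using \<phi> unfolding test_fun_iff by blast
  have "C_k k (pd b \<phi>)" for k using test_funD(1)[OF \<phi>, of "Suc k"] b by simp
  moreover have "pd b \<phi> y = 0" if "R < norm y" for y by (rule pd_zero_outside[OF R(2) that])
  ultimately show ?thesis unfolding test_fun_iff using R(1) by blast
qed

lemma C_k_shift: "C_k k \<phi> \<Longrightarrow> C_k k (\<lambda>y. \<phi> (y + z))"
proof (induction k arbitrary: \<phi>)
  case 0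
  then show ?case by (auto intro!: continuous_on_compose2[of UNIV \<phi>] continuous_intros)
next
  case (Suc k)
  then show ?case
    by (auto simp: pd_shift has_pd_shift intro!: continuous_on_compose2[of UNIV \<phi>] continuous_intros)
qed

lemma test_fun_shift:
  assumes \<phi>: "test_fun \<phi>"
  shows "test_fun (\<lambda>y. \<phi> (y - x))"
proof -
  obtain R where R: "R \<ge> 0" "\<And>y. R < norm y \<Longrightarrow> \<phi> y = 0" using \<phi> unfolding test_fun_iff by blast
  have "\<phi> (y - x) = 0" if "R + norm x < norm y" for y
    using that norm_triangle_sub[of y x] by (intro R(2)) simp
  moreover have "C_k k (\<lambda>y. \<phi> (y - x))" for k
    using C_k_shift[OF test_funD(1)[OF \<phi>], of k "- x"] by simp
  ultimately show ?thesis unfolding test_fun_iff using R(1) by (meson add_nonneg_nonneg norm_ge_zero)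
qed

lemma test_fun_bounded:
  assumes "test_fun \<phi>"
  obtains B where "B > 0" "\<And>y. \<bar>\<phi> y\<bar> \<le> B"
proof -
  obtain R where R: "R \<ge> 0" "\<And>y. R < norm y \<Longrightarrow> \<phi> y = 0" using assms unfolding test_fun_iff by blast
  have "bounded (\<phi> ` cball 0 R)"
    by (intro compact_imp_bounded compact_continuous_image continuous_on_subset[OF test_funD(2)[OF assms]]) auto
  then obtain B where B: "B > 0" "\<And>y. y \<in> cball 0 R \<Longrightarrow> \<bar>\<phi> y\<bar> \<le> B"
    unfolding bounded_pos by auto
  have "\<bar>\<phi> y\<bar> \<le> B" for y
    using B R(2)[of y] by (cases "R < norm y") auto
  then show ?thesis using that B(1) by blast
qed

lemma L1_loc_times_test_fun:
  fixes g :: "'a::euclidean_space \<Rightarrow> real"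
  assumes g: "L1_loc g" and \<phi>: "test_fun \<phi>"
  shows "integrable lebesgue (\<lambda>y. g y * \<phi> y)"
proof -
  obtain R where R: "R \<ge> 0" "\<And>y. R < norm y \<Longrightarrow> \<phi> y = 0" using \<phi> unfolding test_fun_iff by blast
  obtain B where B: "B > 0" "\<And>y. \<bar>\<phi> y\<bar> \<le> B" using test_fun_bounded[OF \<phi>] by blast
  have int: "integrable lebesgue (\<lambda>y. indicator (cball 0 R) y * g y)"
    using g compact_cball[of 0 R] unfolding L1_loc_def set_integrable_def by auto
  have eq: "(\<lambda>y. g y * \<phi> y) = (\<lambda>y. (indicator (cball 0 R) y * g y) * \<phi> y)"
    using R(2) by (auto simp: fun_eq_iff indicator_def not_le)
  have meas: "\<phi> \<in> borel_measurable lebesgue"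
    using borel_measurable_continuous_onI[OF test_funD(2)[OF \<phi>]] by (simp add: measurable_completion)
  show ?thesis unfolding eq
  proof (rule Bochner_Integration.integrable_bound)
    show "integrable lebesgue (\<lambda>y. B * (indicator (cball 0 R) y * g y))"
      using int by simp
    show "(\<lambda>y. indicator (cball 0 R) y * g y * \<phi> y) \<in> borel_measurable lebesgue"
      by (rule borel_measurable_times[OF borel_measurable_integrable[OF int] meas])
    have "\<bar>x\<bar> * \<bar>\<phi> y\<bar> \<le> B * \<bar>x\<bar>" for x y
      using B(2)[of y] mult_right_mono[of "\<bar>\<phi> y\<bar>" B "\<bar>x\<bar>"] by (simp add: mult.commute)
    then show "AE y in lebesgue. norm (indicator (cball 0 R) y * g y * \<phi> y) \<le> norm (B * (indicator (cball 0 R) y * g y))"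
      using B(1) by (intro AE_I2) (simp add: abs_mult[of _ "\<phi> _"] abs_mult[of B])
  qed
qed

lemma L1_loc_continuous:
  fixes U :: "'a::euclidean_space \<Rightarrow> real"
  assumes "continuous_on UNIV U"
  shows "L1_loc U"
  unfolding L1_loc_def set_integrable_def
proof (intro allI impI)
  fix S :: "'a set" assume S: "compact S"
  have "integrable lborel (\<lambda>x. indicator S x *\<^sub>R U x)"
    by (intro borel_integrable_compact S continuous_on_subset[OF assms]) auto
  moreover have "(\<lambda>x. indicator S x *\<^sub>R U x) \<in> borel_measurable lborel"
    using borel_measurable_continuous_onI[OF assms] borel_compact[OF S]
    by (intro borel_measurable_scaleR borel_measurable_indicator) auto
  ultimately show "integrable lebesgue (\<lambda>x. indicator S x *\<^sub>R U x)"
    by (simp add: integrable_completion)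
qed

text \<open>A correlation rather than a convolution: the kernel is a mere translate of \<phi>, hence
  a test function in y that can be used directly with weak derivatives. The price is a minus sign
  for each derivative moved onto \<phi>.\<close>

definition conv :: "('a::euclidean_space \<Rightarrow> real) \<Rightarrow> ('a \<Rightarrow> real) \<Rightarrow> 'a \<Rightarrow> real" where
  "conv U \<phi> x = (\<integral>y. U y * \<phi> (y - x) \<partial>lebesgue)"

lemma conv_bound:
  fixes U :: "'a::euclidean_space \<Rightarrow> real"
  assumes M: "\<And>x. \<bar>U x\<bar> \<le> M"
    and \<psi>: "integrable lebesgue (\<lambda>y. U y * \<psi> (y - x))" "\<And>y. \<bar>\<psi> y\<bar> \<le> \<omega>" "\<And>y. R < norm y \<Longrightarrow> \<psi> y = 0"
  shows "\<bar>conv U \<psi> x\<bar> \<le> M * \<omega> * measure lebesgue (cball (0::'a) R)"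
proof -
  have M0: "M \<ge> 0" using M[of 0] by simp
  have \<omega>0: "\<omega> \<ge> 0" using \<psi>(2)[of 0] by simp
  have I: "integrable lebesgue (\<lambda>y. M * \<omega> * indicator (cball x R) y)"
    using emeasure_lborel_cball_finite[of x R] by (intro integrable_mult_right integrable_real_indicator) auto
  have "norm (conv U \<psi> x) \<le> (\<integral>y. M * \<omega> * indicator (cball x R) y \<partial>lebesgue)"
    unfolding conv_def
  proof (rule Bochner_Integration.integral_norm_bound_integral[OF \<psi>(1) I])
    fix y
    show "norm (U y * \<psi> (y - x)) \<le> M * \<omega> * indicator (cball x R) y"
    proof (cases "R < norm (y - x)")
      case True
      then show ?thesis using \<psi>(3) M0 \<omega>0 by (simp add: indicator_def)
    next
      case False
      then have "y \<in> cball x R" by (simp add: dist_norm norm_minus_commute)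
      then show ?thesis using mult_mono[OF M[of y] \<psi>(2)[of "y - x"] M0] by (simp add: abs_mult)
    qed
  qed
  also have "\<dots> = (\<integral>y. (\<lambda>y. M * \<omega> * indicator (cball 0 R) y) (y - x) \<partial>lebesgue)"
    by (intro Bochner_Integration.integral_cong refl) (auto simp: indicator_def dist_norm norm_minus_commute)
  also have "\<dots> = (\<integral>y. M * \<omega> * indicator (cball (0::'a) R) y \<partial>lebesgue)"
    by (intro lebesgue_integral_translate borel_measurable_times borel_measurable_indicator borel_measurable_const borel_closed closed_cball)
  also have "\<dots> = M * \<omega> * measure lebesgue (cball (0::'a) R)" by simp
  finally show ?thesis by simp
qed

lemma integrable_conv:
  assumes "continuous_on UNIV U" "test_fun \<phi>"
  shows "integrable lebesgue (\<lambda>y. U y * \<phi> (y - x))"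
  by (rule L1_loc_times_test_fun[OF L1_loc_continuous[OF assms(1)] test_fun_shift[OF assms(2)]])

lemma conv_shift: "conv U \<phi> (x + z) = conv U (\<lambda>y. \<phi> (y - z)) x"
  by (simp add: conv_def algebra_simps)

text \<open>The first-order remainder of \<phi> is at most |h| \<omega> and vanishes outside a fixed
  ball, so its integral against the bounded U is o(h).\<close>

lemma conv_pd:
  fixes U :: "'a::euclidean_space \<Rightarrow> real"
  assumes U: "continuous_on UNIV U" and M: "\<And>x. \<bar>U x\<bar> \<le> M" and \<phi>: "test_fun \<phi>" and b: "b \<in> Basis"
  shows "((\<lambda>s. conv U \<phi> (x + s *\<^sub>R b)) has_real_derivative - conv U (pd b \<phi>) x) (at 0)"
  unfolding DERIV_def LIM_eq
proof (intro allI impI)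
  fix e :: real assume e: "e > 0"
  have M0: "M \<ge> 0" using M[of 0] by simp
  obtain R where R: "R \<ge> 0" "\<And>y. R < norm y \<Longrightarrow> \<phi> y = 0" using \<phi> unfolding test_fun_iff by blast
  define V where "V = measure lebesgue (cball (0::'a) (R + 1))"
  define \<omega> where "\<omega> = e / (2 * (M * V + 1))"
  have MV: "M * V \<ge> 0" using M0 by (simp add: V_def)
  have \<omega>: "\<omega> > 0" using e MV by (simp add: \<omega>_def)
  have \<omega>e: "M * \<omega> * V < e"
  proof -
    have "M * \<omega> * V = e * (M * V / (2 * (M * V + 1)))" by (simp add: \<omega>_def)
    also have "\<dots> < e * 1" using e MV by (intro mult_strict_left_mono) (auto simp: divide_less_eq)
    finally show ?thesis by simp
  qed
  note pdphi = test_fun_pd[OF \<phi> b]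
  obtain d where d01: "0 < d" "d \<le> 1" and
    dmod: "\<And>y c t. y \<in> cball 0 (R + 1) \<Longrightarrow> c \<in> Basis \<Longrightarrow> \<bar>t\<bar> \<le> d \<Longrightarrow> \<bar>pd b \<phi> (y + t *\<^sub>R c) - pd b \<phi> y\<bar> \<le> \<omega>"
    using axis_modulus[OF test_funD(2)[OF pdphi] compact_cball[of 0 "R + 1"] \<omega>] by auto
  note d = d01 dmod[OF _ b]
  show "\<exists>d>0. \<forall>h. h \<noteq> 0 \<and> norm (h - 0) < d \<longrightarrow>
      norm ((conv U \<phi> (x + (0 + h) *\<^sub>R b) - conv U \<phi> (x + 0 *\<^sub>R b)) / h - - conv U (pd b \<phi>) x) < e"
  proof (intro exI[of _ d] conjI allI impI)
    show "d > 0" using d01 by simp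
    fix h :: real assume h: "h \<noteq> 0 \<and> norm (h - 0) < d"
    define \<psi> where "\<psi> y = \<phi> (y - h *\<^sub>R b) - \<phi> y + h * pd b \<phi> y" for y
    have int1: "integrable lebesgue (\<lambda>y. U y * \<phi> (y - x - h *\<^sub>R b))"
      using integrable_conv[OF U \<phi>, of "x + h *\<^sub>R b"] by (simp add: diff_diff_add)
    note int2 = integrable_conv[OF U \<phi>, of x]
    note int3 = integrable_conv[OF U pdphi, of x]
    have prod_eq: "(\<lambda>y. U y * \<psi> (y - x)) = (\<lambda>y. U y * \<phi> (y - x - h *\<^sub>R b) - U y * \<phi> (y - x) + h * (U y * pd b \<phi> (y - x)))"
      by (simp add: \<psi>_def fun_eq_iff algebra_simps)
    have int: "integrable lebesgue (\<lambda>y. U y * \<psi> (y - x))"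
      unfolding prod_eq using int1 int2 int3 by simp
    have eq: "conv U \<psi> x = conv U \<phi> (x + h *\<^sub>R b) - conv U \<phi> x + h * conv U (pd b \<phi>) x"
      unfolding conv_shift unfolding conv_def prod_eq using int1 int2 int3 by simp
    have supp: "\<psi> y = 0" if "R + 1 < norm y" for y
    proof -
      have "norm (h *\<^sub>R b) \<le> 1" using h d b by simp
      then have "R < norm (y - h *\<^sub>R b)" using that norm_triangle_ineq2[of y "h *\<^sub>R b"] by linarith
      moreover have Ry: "R < norm y" using that by linarith
      moreover have "pd b \<phi> y = 0" by (rule pd_zero_outside[OF R(2) Ry])
      ultimately show ?thesis
        using R(2)[of "y - h *\<^sub>R b"] R(2)[of y] that by (simp add: \<psi>_def)
    qed
    have bnd: "\<bar>\<psi> y\<bar> \<le> \<bar>h\<bar> * \<omega>" for y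
    proof (cases "R + 1 < norm y")
      case True
      then show ?thesis using supp[OF True] \<omega> by simp
    next
      case False
      define D where "D m r = (if m = 0 then \<phi> (y + r *\<^sub>R b) else pd b \<phi> (y + r *\<^sub>R b))" for m :: nat and r
      have "\<exists>t. \<bar>t\<bar> \<le> \<bar>- h\<bar> \<and> D 0 (- h) = (\<Sum>m<1. D m 0 / fact m * (- h) ^ m) + D 1 t / fact 1 * (- h) ^ 1"
        using has_pd_line[OF test_funD(3)[OF \<phi> b]] by (intro Maclaurin_bi_le) (auto simp: D_def)
      then obtain t where t: "\<bar>t\<bar> \<le> \<bar>h\<bar>" "\<phi> (y - h *\<^sub>R b) = \<phi> y - h * pd b \<phi> (y + t *\<^sub>R b)"
        by (auto simp: D_def)
      have "\<psi> y = - h * (pd b \<phi> (y + t *\<^sub>R b) - pd b \<phi> y)" unfolding \<psi>_def t(2) by (simp add: algebra_simps)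
      then have "\<bar>\<psi> y\<bar> = \<bar>h\<bar> * \<bar>pd b \<phi> (y + t *\<^sub>R b) - pd b \<phi> y\<bar>" by (simp add: abs_mult)
      also have "\<dots> \<le> \<bar>h\<bar> * \<omega>" using dmod[OF _ b, of y t] False t(1) h by (intro mult_left_mono) auto
      finally show ?thesis .
    qed
    have "\<bar>conv U \<psi> x\<bar> \<le> M * (\<bar>h\<bar> * \<omega>) * V"
      unfolding V_def by (rule conv_bound[OF M int bnd supp])
    also have "\<dots> = \<bar>h\<bar> * (M * \<omega> * V)" by (simp add: algebra_simps)
    also have "\<dots> < \<bar>h\<bar> * e" using h \<omega>e by (intro mult_strict_left_mono) auto
    finally have "\<bar>conv U \<psi> x\<bar> < \<bar>h\<bar> * e" .
    moreover have "(conv U \<phi> (x + (0 + h) *\<^sub>R b) - conv U \<phi> (x + 0 *\<^sub>R b)) / h - - conv U (pd b \<phi>) x = conv U \<psi> x / h"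
      using h by (simp add: eq field_simps)
    ultimately show "norm ((conv U \<phi> (x + (0 + h) *\<^sub>R b) - conv U \<phi> (x + 0 *\<^sub>R b)) / h - - conv U (pd b \<phi>) x) < e"
      using h by (simp add: divide_less_eq mult.commute)
  qed
qed

lemma conv_line:
  fixes U :: "'a::euclidean_space \<Rightarrow> real"
  assumes U: "continuous_on UNIV U" and M: "\<And>x. \<bar>U x\<bar> \<le> M" and \<phi>: "test_fun \<phi>" and b: "b \<in> Basis"
  shows "((\<lambda>s. conv U \<phi> (x + s *\<^sub>R b)) has_real_derivative - conv U (pd b \<phi>) (x + s *\<^sub>R b)) (at s)"
proof -
  have "has_pd b (conv U \<phi>) (x + s *\<^sub>R b)" "pd b (conv U \<phi>) (x + s *\<^sub>R b) = - conv U (pd b \<phi>) (x + s *\<^sub>R b)"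
    by (rule pdI[OF conv_pd[OF U M \<phi> b]])+
  then show ?thesis using has_pd_line[of b "conv U \<phi>" x s] by simp
qed

lemma conv_bounded:
  fixes U :: "'a::euclidean_space \<Rightarrow> real"
  assumes U: "continuous_on UNIV U" and M: "\<And>x. \<bar>U x\<bar> \<le> M" and \<phi>: "test_fun \<phi>"
  obtains B where "B > 0" "\<And>x. \<bar>conv U \<phi> x\<bar> \<le> B"
proof -
  obtain R where R: "R \<ge> 0" "\<And>y. R < norm y \<Longrightarrow> \<phi> y = 0" using \<phi> unfolding test_fun_iff by blast
  obtain B where B: "B > 0" "\<And>y. \<bar>\<phi> y\<bar> \<le> B" using test_fun_bounded[OF \<phi>] by blast
  have "\<bar>conv U \<phi> x\<bar> \<le> M * B * measure lebesgue (cball (0::'a) R)" for x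
    by (rule conv_bound[OF M integrable_conv[OF U \<phi>] B(2) R(2)])
  then show ?thesis
    using that[of "max 1 (M * B * measure lebesgue (cball (0::'a) R))"] by (meson less_max_iff_disj max.coboundedI2 zero_less_one)
qed

lemma line_lipschitz:
  fixes f :: "real \<Rightarrow> real"
  assumes "\<And>s. (f has_real_derivative f' s) (at s)" "\<And>s. \<bar>f' s\<bar> \<le> B"
  shows "\<bar>f t - f 0\<bar> \<le> B * \<bar>t\<bar>"
  using field_differentiable_bound[of UNIV f f' B t 0] assms by simp

text \<open>For the mollified function the pure second derivatives are taken at one common point x,
  so only their sum matters, and bounded third derivatives make the error of a step cubic in h. C
  depends on \<phi>, but neither on h nor on x.\<close>

lemma conv_axis_avg:
  fixes U :: "'a::euclidean_space \<Rightarrow> real"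
  assumes U: "continuous_on UNIV U" and M: "\<And>x. \<bar>U x\<bar> \<le> M" and \<phi>: "test_fun \<phi>"
    and A: "\<And>x. (\<Sum>b\<in>Basis. conv U (pd b (pd b \<phi>)) x) \<le> A"
  obtains C where "C > 0" "\<And>h x. 0 < h \<Longrightarrow> axis_avg h (conv U \<phi>) x \<le> conv U \<phi> x + h\<^sup>2 / (2 * real DIM('a)) * (A + C * h)"
proof -
  define N where "N = real DIM('a)"
  have "\<forall>b\<in>Basis. \<exists>B>0. \<forall>x. \<bar>conv U (pd b (pd b (pd b \<phi>))) x\<bar> \<le> B"
    using conv_bounded[OF U M] test_fun_pd \<phi> by metis
  then obtain B where B: "\<And>b. b \<in> Basis \<Longrightarrow> B b > 0" "\<And>b x. b \<in> Basis \<Longrightarrow> \<bar>conv U (pd b (pd b (pd b \<phi>))) x\<bar> \<le> B b"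
    by metis
  define C where "C = (\<Sum>b\<in>(Basis::'a set). B b)"
  have C: "C > 0" unfolding C_def using B(1) by (intro sum_pos) auto
  have main: "axis_avg h (conv U \<phi>) x \<le> conv U \<phi> x + h\<^sup>2 / (2 * N) * (A + C * h)" if h: "0 < h" for h x
  proof -
    have 1: "conv U \<phi> (x + h *\<^sub>R b) + conv U \<phi> (x - h *\<^sub>R b) - 2 * conv U \<phi> x
        \<le> h\<^sup>2 * conv U (pd b (pd b \<phi>)) x + h\<^sup>2 * (B b * h)" if b: "b \<in> Basis" for b
    proof -
      note p1 = test_fun_pd[OF \<phi> b] and p2 = test_fun_pd[OF test_fun_pd[OF \<phi> b] b]
      have "\<bar>conv U \<phi> (x + h *\<^sub>R b) + conv U \<phi> (x + (- h) *\<^sub>R b) - 2 * conv U \<phi> (x + 0 *\<^sub>R b)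
          - h\<^sup>2 * - (- conv U (pd b (pd b \<phi>)) (x + 0 *\<^sub>R b))\<bar> \<le> h\<^sup>2 * (B b * h)"
      proof (rule second_difference_bound)
        show "((\<lambda>t. conv U \<phi> (x + t *\<^sub>R b)) has_real_derivative - conv U (pd b \<phi>) (x + t *\<^sub>R b)) (at t)" for t
          by (rule conv_line[OF U M \<phi> b])
        show "((\<lambda>t. - conv U (pd b \<phi>) (x + t *\<^sub>R b)) has_real_derivative - (- conv U (pd b (pd b \<phi>)) (x + t *\<^sub>R b))) (at t)" for t
          by (intro DERIV_minus conv_line[OF U M p1 b])
        fix t assume t: "\<bar>t\<bar> \<le> \<bar>h\<bar>"
        have "\<bar>conv U (pd b (pd b \<phi>)) (x + t *\<^sub>R b) - conv U (pd b (pd b \<phi>)) (x + 0 *\<^sub>R b)\<bar> \<le> B b * \<bar>t\<bar>"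
          by (rule line_lipschitz[OF conv_line[OF U M p2 b]]) (use B(2)[OF b] in simp)
        also have "\<dots> \<le> B b * h" using t h B(1)[OF b] by (intro mult_left_mono) auto
        finally show "\<bar>- (- conv U (pd b (pd b \<phi>)) (x + t *\<^sub>R b)) - - (- conv U (pd b (pd b \<phi>)) (x + 0 *\<^sub>R b))\<bar> \<le> B b * h"
          by simp
      qed
      then show ?thesis by (simp add: abs_le_iff)
    qed
    have "axis_avg h (conv U \<phi>) x - conv U \<phi> x \<le>
        (\<Sum>b\<in>(Basis::'a set). h\<^sup>2 * conv U (pd b (pd b \<phi>)) x + h\<^sup>2 * (B b * h)) / (2 * N)"
      unfolding axis_avg_diff N_def by (intro divide_right_mono sum_mono 1) auto
    also have "\<dots> = h\<^sup>2 / (2 * N) * ((\<Sum>b\<in>(Basis::'a set). conv U (pd b (pd b \<phi>)) x) + C * h)"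
      by (simp add: sum.distrib sum_distrib_left[symmetric] sum_distrib_right[symmetric] C_def algebra_simps add_divide_distrib)
    also have "\<dots> \<le> h\<^sup>2 / (2 * N) * (A + C * h)"
      using A[of x] by (intro mult_left_mono add_right_mono) (auto simp: N_def)
    finally show ?thesis by simp
  qed
  show ?thesis using that[OF C] main unfolding N_def by blast
qed

lemma shifted_test_fun_integral:
  assumes "test_fun \<phi>" "(\<integral>y. \<phi> y \<partial>lebesgue) = 1"
  shows "(\<integral>y. \<phi> (y - x) \<partial>lebesgue) = 1" "integrable lebesgue (\<lambda>y. \<phi> (y - x))"
proof -
  show one: "(\<integral>y. \<phi> (y - x) \<partial>lebesgue) = 1"
    using lebesgue_integral_translate[of \<phi> x] borel_measurable_continuous_onI[OF test_funD(2)[OF assms(1)]] assms(2) by simp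
  \<comment> \<open>Non-integrable functions have integral 0, so the value 1 entails
    integrability.\<close>
  then show "integrable lebesgue (\<lambda>y. \<phi> (y - x))" using not_integrable_integral_eq by fastforce
qed

lemma conv_approx:
  fixes U :: "'a::euclidean_space \<Rightarrow> real"
  assumes U: "continuous_on UNIV U" and \<phi>: "test_fun \<phi>" "\<And>y. 0 \<le> \<phi> y" "(\<integral>y. \<phi> y \<partial>lebesgue) = 1"
    and e: "\<And>y. \<phi> y \<noteq> 0 \<Longrightarrow> \<bar>U (x + y) - U x\<bar> \<le> e"
  shows "\<bar>conv U \<phi> x - U x\<bar> \<le> e"
proof -
  note int = integrable_conv[OF U \<phi>(1), of x]
  note one = shifted_test_fun_integral(1)[OF \<phi>(1,3), of x]
  note int1 = shifted_test_fun_integral(2)[OF \<phi>(1,3), of x]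
  have "conv U \<phi> x - U x = (\<integral>y. U y * \<phi> (y - x) \<partial>lebesgue) - (\<integral>y. U x * \<phi> (y - x) \<partial>lebesgue)"
    using one by (simp add: conv_def)
  also have "\<dots> = (\<integral>y. U y * \<phi> (y - x) - U x * \<phi> (y - x) \<partial>lebesgue)"
    by (rule Bochner_Integration.integral_diff[symmetric]) (use int int1 in auto)
  also have "norm \<dots> \<le> (\<integral>y. e * \<phi> (y - x) \<partial>lebesgue)"
  proof (rule Bochner_Integration.integral_norm_bound_integral)
    show "integrable lebesgue (\<lambda>y. U y * \<phi> (y - x) - U x * \<phi> (y - x))" using int int1 by simp
    show "integrable lebesgue (\<lambda>y. e * \<phi> (y - x))" using int1 by simp
    fix y
    show "norm (U y * \<phi> (y - x) - U x * \<phi> (y - x)) \<le> e * \<phi> (y - x)"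
      using e[of "y - x"] \<phi>(2)[of "y - x"]
      by (cases "\<phi> (y - x) = 0") (auto simp: left_diff_distrib[symmetric] abs_mult intro: mult_right_mono)
  qed
  also have "\<dots> = e" using one by simp
  finally show ?thesis by simp
qed

section \<open>Weak Laplacian of the initial data\<close>

lemma conv_weak_pd:
  fixes U :: "'a::euclidean_space \<Rightarrow> real"
  assumes U: "continuous_on UNIV U" and ae: "AE x in lebesgue. U x = f x"
    and g: "has_weak_pd b f g" and \<phi>: "test_fun \<phi>" and b: "b \<in> Basis"
  shows "conv U (pd b \<phi>) x = - (\<integral>y. g y * \<phi> (y - x) \<partial>lebesgue)"
proof -
  have pd_eq: "pd b (\<lambda>y. \<phi> (y - x)) = (\<lambda>y. pd b \<phi> (y - x))"
    using pd_shift[of b \<phi> "- x"] by simp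
  note ts = test_fun_shift[OF test_fun_pd[OF \<phi> b], of x]
  have f: "L1_loc f" using g by (simp add: has_weak_pd_def)
  have "conv U (pd b \<phi>) x = (\<integral>y. f y * pd b \<phi> (y - x) \<partial>lebesgue)"
    unfolding conv_def
  proof (rule integral_cong_AE)
    show "(\<lambda>y. U y * pd b \<phi> (y - x)) \<in> borel_measurable lebesgue"
      by (rule borel_measurable_integrable[OF L1_loc_times_test_fun[OF L1_loc_continuous[OF U] ts]])
    show "(\<lambda>y. f y * pd b \<phi> (y - x)) \<in> borel_measurable lebesgue"
      by (rule borel_measurable_integrable[OF L1_loc_times_test_fun[OF f ts]])
    show "AE y in lebesgue. U y * pd b \<phi> (y - x) = f y * pd b \<phi> (y - x)"
      using ae by eventually_elim simp
  qed
  also have "\<dots> = - (\<integral>y. g y * \<phi> (y - x) \<partial>lebesgue)"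
    using g[unfolded has_weak_pd_def, THEN conjunct2, THEN conjunct2, rule_format, OF test_fun_shift[OF \<phi>, of x]]
    unfolding pd_eq .
  finally show ?thesis .
qed

lemma AE_norm_le_Linf_norm:
  assumes "Linf_enorm f < \<infinity>"
  shows "AE x in lebesgue. norm (f x) \<le> Linf_norm f"
proof -
  have "AE x in lebesgue. ereal (norm (f x)) \<le> Linf_enorm f"
    unfolding Linf_enorm_def by (rule esssup_AE)
  then show ?thesis
    by eventually_elim (use assms in \<open>cases "Linf_enorm f"; auto simp: Linf_norm_def\<close>)
qed

text \<open>The axis derivative of the mollified U is an average of g. Uniform continuity of U is
  not yet at hand, so the mollifier is adapted to the two points x and x + t b.\<close>

lemma weak_pd_bounded_lipschitz:
  fixes U :: "'a::euclidean_space \<Rightarrow> real"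
  assumes U: "continuous_on UNIV U" and M: "\<And>x. \<bar>U x\<bar> \<le> M" and ae: "AE x in lebesgue. U x = f x"
    and g: "has_weak_pd b f g" "Linf g" and b: "b \<in> Basis"
  shows "\<bar>U (x + t *\<^sub>R b) - U x\<bar> \<le> Linf_norm g * \<bar>t\<bar>"
proof (rule field_le_epsilon)
  fix e :: real assume e: "e > 0"
  define N where "N = real DIM('a)"
  have N: "N \<ge> 1" by (simp add: N_def Suc_leI)
  have near: "\<exists>d>0. \<forall>y. norm y < d \<longrightarrow> \<bar>U (z + y) - U z\<bar> \<le> e / 2" for z
  proof -
    have "isCont U z" using U by (simp add: continuous_on_eq_continuous_at)
    then obtain d where d: "d > 0" "\<And>y. dist y z < d \<Longrightarrow> dist (U y) (U z) < e / 2"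
      using e unfolding continuous_at_eps_delta by (metis half_gt_zero)
    show ?thesis
    proof (intro exI[of _ d] conjI allI impI d(1))
      fix y :: 'a assume "norm y < d"
      then have "dist (U (z + y)) (U z) < e / 2" by (intro d(2)) (simp add: dist_norm)
      then show "\<bar>U (z + y) - U z\<bar> \<le> e / 2" by (simp add: dist_real_def)
    qed
  qed
  obtain d1 where d1: "d1 > 0" "\<And>y. norm y < d1 \<Longrightarrow> \<bar>U (x + y) - U x\<bar> \<le> e / 2" using near[of x] by blast
  obtain d2 where d2: "d2 > 0" "\<And>y. norm y < d2 \<Longrightarrow> \<bar>U (x + t *\<^sub>R b + y) - U (x + t *\<^sub>R b)\<bar> \<le> e / 2"
    using near[of "x + t *\<^sub>R b"] by blast
  define d where "d = min d1 d2 / N"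
  have d: "d > 0" using d1 d2 N by (simp add: d_def)
  obtain \<phi> :: "'a \<Rightarrow> real" where \<phi>: "test_fun \<phi>" "\<And>y. 0 \<le> \<phi> y"
    "\<And>y b. \<phi> y \<noteq> 0 \<Longrightarrow> b \<in> Basis \<Longrightarrow> \<bar>y \<bullet> b\<bar> < d" "(\<integral>y. \<phi> y \<partial>lebesgue) = 1"
    using mollifier_exists[OF d] by metis
  have small: "norm y < min d1 d2" if "\<phi> y \<noteq> 0" for y
  proof -
    have "norm y \<le> (\<Sum>b\<in>Basis. \<bar>y \<bullet> b\<bar>)" by (rule norm_le_l1)
    also have "\<dots> < (\<Sum>b\<in>(Basis::'a set). d)"
      by (intro sum_strict_mono) (use \<phi>(3)[OF that] in auto)
    also have "\<dots> = min d1 d2" using N by (simp add: d_def N_def)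
    finally show ?thesis .
  qed
  have a1: "\<bar>conv U \<phi> x - U x\<bar> \<le> e / 2"
    using small d1(2) by (intro conv_approx[OF U \<phi>(1,2,4)]) auto
  have a2: "\<bar>conv U \<phi> (x + t *\<^sub>R b) - U (x + t *\<^sub>R b)\<bar> \<le> e / 2"
    using small d2(2) by (intro conv_approx[OF U \<phi>(1,2,4)]) auto
  have G: "\<bar>- conv U (pd b \<phi>) z\<bar> \<le> Linf_norm g" for z
  proof -
    have gL: "L1_loc g" using g by (simp add: has_weak_pd_def)
    have "norm (\<integral>y. g y * \<phi> (y - z) \<partial>lebesgue) \<le> (\<integral>y. norm (g y * \<phi> (y - z)) \<partial>lebesgue)"
      by (rule Bochner_Integration.integral_norm_bound)
    also have "\<dots> \<le> (\<integral>y. Linf_norm g * \<phi> (y - z) \<partial>lebesgue)"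
    proof (rule integral_mono_AE)
      show "integrable lebesgue (\<lambda>y. norm (g y * \<phi> (y - z)))"
        by (rule integrable_norm[OF L1_loc_times_test_fun[OF gL test_fun_shift[OF \<phi>(1)]]])
      show "integrable lebesgue (\<lambda>y. Linf_norm g * \<phi> (y - z))"
        using shifted_test_fun_integral[OF \<phi>(1,4)] by simp
      have "AE y in lebesgue. norm (g y) \<le> Linf_norm g"
        using g(2) by (intro AE_norm_le_Linf_norm) (simp add: Linf_def)
      then show "AE y in lebesgue. norm (g y * \<phi> (y - z)) \<le> Linf_norm g * \<phi> (y - z)"
        by eventually_elim (use \<phi>(2) in \<open>auto simp: abs_mult intro: mult_right_mono\<close>)
    qed
    also have "\<dots> = Linf_norm g" using shifted_test_fun_integral[OF \<phi>(1,4)] by simp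
    finally show ?thesis unfolding conv_weak_pd[OF U ae g(1) \<phi>(1) b] by simp
  qed
  have "\<bar>conv U \<phi> (x + t *\<^sub>R b) - conv U \<phi> (x + 0 *\<^sub>R b)\<bar> \<le> Linf_norm g * \<bar>t\<bar>"
    by (rule line_lipschitz[OF conv_line[OF U M \<phi>(1) b] G])
  then have "\<bar>conv U \<phi> (x + t *\<^sub>R b) - conv U \<phi> x\<bar> \<le> Linf_norm g * \<bar>t\<bar>" by simp
  then show "\<bar>U (x + t *\<^sub>R b) - U x\<bar> \<le> Linf_norm g * \<bar>t\<bar> + e" using a1 a2 by linarith
qed

text \<open>Moving one coordinate at a time turns the axis bounds into a modulus of continuity that
  is uniform in x.\<close>

lemma axis_lipschitz_telescope:
  fixes U :: "'a::euclidean_space \<Rightarrow> real"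
  assumes G: "\<And>b x t. b \<in> Basis \<Longrightarrow> \<bar>U (x + t *\<^sub>R b) - U x\<bar> \<le> G b * \<bar>t\<bar>"
  shows "\<bar>U (x + z) - U x\<bar> \<le> (\<Sum>b\<in>Basis. G b * \<bar>z \<bullet> b\<bar>)"
proof -
  have "\<bar>U (x + (\<Sum>b\<in>S. (z \<bullet> b) *\<^sub>R b)) - U x\<bar> \<le> (\<Sum>b\<in>S. G b * \<bar>z \<bullet> b\<bar>)"
    if "finite S" "S \<subseteq> Basis" for S x
    using that
  proof (induction S arbitrary: x rule: finite_induct)
    case (insert c S)
    have "\<bar>U (x + (z \<bullet> c) *\<^sub>R c + (\<Sum>b\<in>S. (z \<bullet> b) *\<^sub>R b)) - U (x + (z \<bullet> c) *\<^sub>R c)\<bar> \<le> (\<Sum>b\<in>S. G b * \<bar>z \<bullet> b\<bar>)"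
      using insert by blast
    moreover have "\<bar>U (x + (z \<bullet> c) *\<^sub>R c) - U x\<bar> \<le> G c * \<bar>z \<bullet> c\<bar>" using insert.prems by (intro G) auto
    ultimately show ?case using insert.hyps by (simp add: add.assoc)
  qed simp
  from this[of Basis x] show ?thesis by (simp add: euclidean_representation)
qed

lemma has_weak_pd_weak_pd: "has_weak_pd b f g \<Longrightarrow> has_weak_pd b f (weak_pd b f)"
  unfolding weak_pd_def by (rule someI[where P = "has_weak_pd b f"])

text \<open>\<open>weak_pd\<close> is an arbitrary choice, while \<open>W_inf\<close> supplies a
  second weak derivative for some first one. All weak derivatives of f act alike on the test
  function pd c \<phi>, so the second derivative belongs to the chosen one as well.\<close>

lemma has_weak_pd_transfer:
  assumes "has_weak_pd b f g" "has_weak_pd b f g'" "has_weak_pd c g h" and c: "c \<in> Basis"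
  shows "has_weak_pd c g' h"
  unfolding has_weak_pd_def
proof (intro conjI allI impI)
  show "L1_loc g'" "L1_loc h" using assms by (auto simp: has_weak_pd_def)
  fix \<phi> :: "'a \<Rightarrow> real" assume \<phi>: "test_fun \<phi>"
  note t = test_fun_pd[OF \<phi> c]
  have "(\<integral>x. g' x * pd c \<phi> x \<partial>lebesgue) = - (\<integral>x. f x * pd b (pd c \<phi>) x \<partial>lebesgue)"
    "(\<integral>x. g x * pd c \<phi> x \<partial>lebesgue) = - (\<integral>x. f x * pd b (pd c \<phi>) x \<partial>lebesgue)"
    using assms(1,2) t by (auto simp: has_weak_pd_def)
  moreover have "(\<integral>x. g x * pd c \<phi> x \<partial>lebesgue) = - (\<integral>x. h x * \<phi> x \<partial>lebesgue)"
    using assms(3) \<phi> by (auto simp: has_weak_pd_def)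
  ultimately show "(\<integral>x. g' x * pd c \<phi> x \<partial>lebesgue) = - (\<integral>x. h x * \<phi> x \<partial>lebesgue)" by simp
qed

text \<open>Both derivatives return to u0 with cancelling signs, and the sum becomes an average of
  \<open>weak_laplacian u0\<close> with weight \<phi>.\<close>

lemma conv_laplacian_le:
  fixes U :: "'a::euclidean_space \<Rightarrow> real"
  assumes U: "continuous_on UNIV U" and ae: "AE x in lebesgue. U x = u0 x" and W: "W_inf 2 u0"
    and A: "AE x in lebesgue. weak_laplacian u0 x \<le> A"
    and \<phi>: "test_fun \<phi>" "\<And>y. 0 \<le> \<phi> y" "(\<integral>y. \<phi> y \<partial>lebesgue) = 1"
  shows "(\<Sum>b\<in>Basis. conv U (pd b (pd b \<phi>)) x) \<le> A"
proof -
  define Z where "Z b = weak_pd b (weak_pd b u0)" for b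
  have w: "has_weak_pd b u0 (weak_pd b u0)" and z: "has_weak_pd b (weak_pd b u0) (Z b)" if b: "b \<in> Basis" for b
  proof -
    obtain g h where g: "has_weak_pd b u0 g" "has_weak_pd b g h"
      using W b by (auto simp: eval_nat_numeral) blast
    show w: "has_weak_pd b u0 (weak_pd b u0)" by (rule has_weak_pd_weak_pd[OF g(1)])
    show "has_weak_pd b (weak_pd b u0) (Z b)"
      unfolding Z_def by (rule has_weak_pd_weak_pd[OF has_weak_pd_transfer[OF g(1) w g(2) b]])
  qed
  have eq: "conv U (pd b (pd b \<phi>)) x = (\<integral>y. Z b y * \<phi> (y - x) \<partial>lebesgue)" if b: "b \<in> Basis" for b
  proof -
    have pd_eq: "pd b (\<lambda>y. \<phi> (y - x)) = (\<lambda>y. pd b \<phi> (y - x))"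
      using pd_shift[of b \<phi> "- x"] by simp
    have "conv U (pd b (pd b \<phi>)) x = - (\<integral>y. weak_pd b u0 y * pd b \<phi> (y - x) \<partial>lebesgue)"
      by (rule conv_weak_pd[OF U ae w[OF b] test_fun_pd[OF \<phi>(1) b] b])
    also have "\<dots> = (\<integral>y. Z b y * \<phi> (y - x) \<partial>lebesgue)"
      using z[OF b, unfolded has_weak_pd_def, THEN conjunct2, THEN conjunct2, rule_format, OF test_fun_shift[OF \<phi>(1), of x]]
      unfolding pd_eq by simp
    finally show ?thesis .
  qed
  have int: "integrable lebesgue (\<lambda>y. Z b y * \<phi> (y - x))" if "b \<in> Basis" for b
    using z[OF that] by (intro L1_loc_times_test_fun test_fun_shift \<phi>(1)) (simp add: has_weak_pd_def)
  have lap: "(\<Sum>b\<in>Basis. Z b y * \<phi> (y - x)) = weak_laplacian u0 y * \<phi> (y - x)" for y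
    by (simp add: weak_laplacian_def Z_def sum_distrib_right)
  have "(\<Sum>b\<in>Basis. conv U (pd b (pd b \<phi>)) x) = (\<Sum>b\<in>Basis. \<integral>y. Z b y * \<phi> (y - x) \<partial>lebesgue)"
    by (intro sum.cong refl eq)
  also have "\<dots> = (\<integral>y. weak_laplacian u0 y * \<phi> (y - x) \<partial>lebesgue)"
    unfolding lap[symmetric] by (intro Bochner_Integration.integral_sum[symmetric] int)
  also have "\<dots> \<le> (\<integral>y. A * \<phi> (y - x) \<partial>lebesgue)"
  proof (rule integral_mono_AE)
    show "integrable lebesgue (\<lambda>y. weak_laplacian u0 y * \<phi> (y - x))"
      unfolding lap[symmetric] by (intro Bochner_Integration.integrable_sum int)
    show "integrable lebesgue (\<lambda>y. A * \<phi> (y - x))"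
      using shifted_test_fun_integral[OF \<phi>(1,3)] by simp
    show "AE y in lebesgue. weak_laplacian u0 y * \<phi> (y - x) \<le> A * \<phi> (y - x)"
      using A by eventually_elim (use \<phi>(2) in \<open>auto intro: mult_right_mono\<close>)
  qed
  also have "\<dots> = A" using shifted_test_fun_integral[OF \<phi>(1,3)] by simp
  finally show ?thesis .
qed

text \<open>The order of choices matters. The Lipschitz bounds fix a mollifier with uniform error e
  / 4, which enters twice; only then is the mesh chosen so small that the cubic errors of all n
  steps, with n h^2 = s, add up to at most e / 2. Monotonicity of the average passes from U to the
  mollified function.\<close>

lemma weak_laplacian_axis_avg:
  fixes U :: "'a::euclidean_space \<Rightarrow> real"
  assumes U: "continuous_on UNIV U" and M: "\<And>x. \<bar>U x\<bar> \<le> M"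
    and ae: "AE x in lebesgue. U x = u0 x" and W: "W_inf 2 u0"
    and A: "AE x in lebesgue. weak_laplacian u0 x \<le> A" and s: "s > 0" and e: "e > 0"
  shows "\<exists>d>0. \<forall>h n. 0 < h \<longrightarrow> h \<le> d \<longrightarrow> real n * h\<^sup>2 = s \<longrightarrow>
    (\<forall>x. (axis_avg h ^^ n) U x \<le> U x + s / (2 * real DIM('a)) * A + e)"
proof -
  define N where "N = real DIM('a)"
  have N: "N \<ge> 1" by (simp add: N_def Suc_leI)
  have "\<forall>b\<in>Basis. \<exists>G\<ge>0. \<forall>x t. \<bar>U (x + t *\<^sub>R b) - U x\<bar> \<le> G * \<bar>t\<bar>"
  proof
    fix b :: 'a assume b: "b \<in> Basis"
    obtain g where g: "has_weak_pd b u0 g" "Linf g"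
      using W b by (auto simp: eval_nat_numeral)
    have L: "\<bar>U (x + t *\<^sub>R b) - U x\<bar> \<le> Linf_norm g * \<bar>t\<bar>" for x t
      by (rule weak_pd_bounded_lipschitz[OF U M ae g b])
    moreover have "0 \<le> Linf_norm g" using L[of 0 1] by linarith
    ultimately show "\<exists>G\<ge>0. \<forall>x t. \<bar>U (x + t *\<^sub>R b) - U x\<bar> \<le> G * \<bar>t\<bar>" by blast
  qed
  then obtain G where G: "\<And>b. b \<in> Basis \<Longrightarrow> 0 \<le> G b" "\<And>b x t. b \<in> Basis \<Longrightarrow> \<bar>U (x + t *\<^sub>R b) - U x\<bar> \<le> G b * \<bar>t\<bar>"
    by metis
  define GG where "GG = (\<Sum>b\<in>(Basis::'a set). G b)"
  have GG: "GG \<ge> 0" unfolding GG_def by (intro sum_nonneg G(1))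
  \<comment> \<open>The sum of the Lipschitz constants may be 0, hence the 1 in the
    denominator.\<close>
  define d where "d = e / (4 * (GG + 1))"
  have d: "d > 0" using e GG by (simp add: d_def)
  obtain \<phi> :: "'a \<Rightarrow> real" where \<phi>: "test_fun \<phi>" "\<And>y. 0 \<le> \<phi> y"
    "\<And>y b. \<phi> y \<noteq> 0 \<Longrightarrow> b \<in> Basis \<Longrightarrow> \<bar>y \<bullet> b\<bar> < d" "(\<integral>y. \<phi> y \<partial>lebesgue) = 1"
    using mollifier_exists[OF d] by metis
  define f where "f = conv U \<phi>"
  have fU: "\<bar>f x - U x\<bar> \<le> e / 4" for x
    unfolding f_def
  proof (rule conv_approx[OF U \<phi>(1,2,4)])
    fix y assume y: "\<phi> y \<noteq> 0"
    have "\<bar>U (x + y) - U x\<bar> \<le> (\<Sum>b\<in>Basis. G b * \<bar>y \<bullet> b\<bar>)" by (rule axis_lipschitz_telescope[OF G(2)])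
    also have "\<dots> \<le> (\<Sum>b\<in>Basis. G b * d)"
      by (intro sum_mono mult_left_mono G(1) less_imp_le[OF \<phi>(3)[OF y]])
    also have "\<dots> = GG * d" by (simp add: GG_def sum_distrib_right)
    also have "\<dots> \<le> (GG + 1) * d" using d by simp
    also have "\<dots> = e / 4" using GG by (simp add: d_def field_simps)
    finally show "\<bar>U (x + y) - U x\<bar> \<le> e / 4" .
  qed
  obtain C where C: "C > 0" "\<And>h x. 0 < h \<Longrightarrow> axis_avg h f x \<le> f x + h\<^sup>2 / (2 * N) * (A + C * h)"
    unfolding f_def N_def
    using conv_axis_avg[OF U M \<phi>(1) conv_laplacian_le[OF U ae W A \<phi>(1,2,4)]] by metis
  define d' where "d' = e * N / (s * C)"
  have d': "d' > 0" using e N s C(1) by (simp add: d'_def)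
  show ?thesis
  proof (intro exI[of _ d'] conjI allI impI d')
    fix h n x assume h: "0 < h" "h \<le> d'" and n: "real n * h\<^sup>2 = s"
    have "(axis_avg h ^^ n) U x \<le> (axis_avg h ^^ n) (\<lambda>x. f x + e / 4) x"
      using fU by (intro axis_avg_iter_mono) (smt (verit))
    also have "\<dots> = (axis_avg h ^^ n) f x + e / 4" by (rule axis_avg_iter_add_const)
    also have "(axis_avg h ^^ n) f x \<le> f x + real n * (h\<^sup>2 / (2 * N) * (A + C * h))"
      using C(2)[OF h(1)] by (rule axis_avg_iter_le)
    also have "real n * (h\<^sup>2 / (2 * N) * (A + C * h)) = s / (2 * N) * A + s * C * h / (2 * N)"
      unfolding n[symmetric] by (simp add: distrib_left algebra_simps add_divide_distrib)
    also have "s * C * h / (2 * N) \<le> s * C * d' / (2 * N)"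
      using h s C(1) N by (intro divide_right_mono mult_left_mono) auto
    also have "s * C * d' / (2 * N) = e / 2" using s C(1) N by (simp add: d'_def)
    finally have "(axis_avg h ^^ n) U x \<le> f x + (s / (2 * N) * A + e / 2) + e / 4" by simp
    moreover have "f x \<le> U x + e / 4" using fU[of x] by linarith
    ultimately show "(axis_avg h ^^ n) U x \<le> U x + s / (2 * real DIM('a)) * A + e"
      unfolding N_def by linarith
  qed
qed

section \<open>Heat kernels and the lower decay rate\<close>

text \<open>The heat kernel centred at x0 at time s, without the factor (4 \<pi>)^(- N / 2).\<close>

definition gauss :: "'a::euclidean_space \<Rightarrow> real \<Rightarrow> 'a \<Rightarrow> real" where
  "gauss x0 s x = s powr (- (real DIM('a) / 2)) * exp (- ((x - x0) \<bullet> (x - x0)) / (4 * s))"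

lemma gauss_pos: "s > 0 \<Longrightarrow> gauss x0 s x > 0"
  by (simp add: gauss_def)

lemma gauss_le: "s > 0 \<Longrightarrow> gauss (x0::'a::euclidean_space) s x \<le> s powr (- (real DIM('a) / 2))"
  unfolding gauss_def by (intro mult_left_le) (auto simp: divide_nonpos_pos)

lemma gauss_pd:
  fixes x0 :: "'a::euclidean_space"
  assumes s: "s > 0" and b: "b \<in> Basis"
  shows "has_pd b (gauss x0 s) x" "pd b (gauss x0 s) = (\<lambda>x. - ((x - x0) \<bullet> b) / (2 * s) * gauss x0 s x)"
    "has_pd b (pd b (gauss x0 s)) x"
    "pd b (pd b (gauss x0 s)) x = (((x - x0) \<bullet> b)\<^sup>2 / (4 * s\<^sup>2) - 1 / (2 * s)) * gauss x0 s x"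
proof -
  have line: "(x + r *\<^sub>R b - x0) \<bullet> (x + r *\<^sub>R b - x0) = (x - x0) \<bullet> (x - x0) + 2 * r * ((x - x0) \<bullet> b) + r\<^sup>2" for r x
  proof -
    have eq: "x + r *\<^sub>R b - x0 = (x - x0) + r *\<^sub>R b" by simp
    show ?thesis unfolding eq using b
      by (simp only: inner_add_left inner_add_right) (simp add: inner_commute power2_eq_square algebra_simps)
  qed
  have D: "((\<lambda>r. gauss x0 s (x + r *\<^sub>R b)) has_real_derivative - ((x - x0) \<bullet> b) / (2 * s) * gauss x0 s x) (at 0)" for x
    unfolding gauss_def line using s
    by (auto intro!: derivative_eq_intros simp: field_simps)
  show "has_pd b (gauss x0 s) x" by (rule pdI(1)[OF D])
  show eq: "pd b (gauss x0 s) = (\<lambda>x. - ((x - x0) \<bullet> b) / (2 * s) * gauss x0 s x)"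
    using pdI(2)[OF D] by blast
  have i: "((\<lambda>r. - ((x + r *\<^sub>R b - x0) \<bullet> b) / (2 * s)) has_real_derivative - 1 / (2 * s)) (at 0)"
    using s b by (auto intro!: derivative_eq_intros simp: inner_add_left inner_diff_left)
  have D2: "((\<lambda>r. - ((x + r *\<^sub>R b - x0) \<bullet> b) / (2 * s) * gauss x0 s (x + r *\<^sub>R b)) has_real_derivative
      (((x - x0) \<bullet> b)\<^sup>2 / (4 * s\<^sup>2) - 1 / (2 * s)) * gauss x0 s x) (at 0)"
    by (rule DERIV_cong[OF DERIV_mult[OF i D]]) (use s in \<open>simp add: power2_eq_square field_simps\<close>)
  show "has_pd b (pd b (gauss x0 s)) x" "pd b (pd b (gauss x0 s)) x = (((x - x0) \<bullet> b)\<^sup>2 / (4 * s\<^sup>2) - 1 / (2 * s)) * gauss x0 s x"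
    unfolding eq by (rule pdI[OF D2])+
qed

lemma gauss_laplacian:
  fixes x0 :: "'a::euclidean_space"
  assumes s: "s > 0"
  shows "laplacian (gauss x0 s) x = ((x - x0) \<bullet> (x - x0) / (4 * s\<^sup>2) - real DIM('a) / (2 * s)) * gauss x0 s x"
proof -
  have SS: "(\<Sum>b\<in>Basis. ((x - x0) \<bullet> b)\<^sup>2) = (x - x0) \<bullet> (x - x0)"
    using euclidean_inner[of "x - x0" "x - x0"] by (simp only: power2_eq_square)
  have "laplacian (gauss x0 s) x = (\<Sum>b\<in>Basis. (((x - x0) \<bullet> b)\<^sup>2 / (4 * s\<^sup>2) - 1 / (2 * s)) * gauss x0 s x)"
    unfolding laplacian_def by (intro sum.cong refl gauss_pd(4)[OF s])
  also have "\<dots> = ((\<Sum>b\<in>Basis. ((x - x0) \<bullet> b)\<^sup>2) / (4 * s\<^sup>2) - real DIM('a) / (2 * s)) * gauss x0 s x"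
    by (simp add: sum_distrib_right[symmetric] sum_subtractf sum_divide_distrib)
  finally show ?thesis unfolding SS .
qed

lemma gauss_time:
  fixes x0 :: "'a::euclidean_space"
  assumes s: "t + a > 0"
  shows "((\<lambda>t. gauss x0 (t + a) x) has_real_derivative
    ((x - x0) \<bullet> (x - x0) / (4 * (t + a)\<^sup>2) - real DIM('a) / (2 * (t + a))) * gauss x0 (t + a) x) (at t)"
proof -
  define k where "k = real DIM('a) / 2"
  define S where "S = (x - x0) \<bullet> (x - x0)"
  have "((\<lambda>t. (t + a) powr (- k)) has_real_derivative - k * (t + a) powr (- k - 1) * 1) (at t)"
    using s by (auto intro!: derivative_eq_intros)
  moreover have "((\<lambda>t. exp (- S / (4 * (t + a)))) has_real_derivative exp (- S / (4 * (t + a))) * (S / (4 * (t + a)\<^sup>2))) (at t)"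
  proof -
    have "((\<lambda>t. (- S / 4) * inverse (t + a)) has_real_derivative S / (4 * (t + a)\<^sup>2)) (at t)"
    proof (rule DERIV_cong)
      show "((\<lambda>t. (- S / 4) * inverse (t + a)) has_real_derivative
          (- S / 4) * (- (inverse (t + a) * (1 + 0) * inverse (t + a)))) (at t)"
        using s by (intro DERIV_cmult DERIV_inverse' DERIV_add DERIV_ident DERIV_const) auto
      show "(- S / 4) * (- (inverse (t + a) * (1 + 0) * inverse (t + a))) = S / (4 * (t + a)\<^sup>2)"
        by (simp add: power2_eq_square inverse_eq_divide)
    qed
    moreover have "(\<lambda>t. (- S / 4) * inverse (t + a)) = (\<lambda>t. - S / (4 * (t + a)))"
      by (simp add: inverse_eq_divide fun_eq_iff)
    ultimately have "((\<lambda>t. - S / (4 * (t + a))) has_real_derivative S / (4 * (t + a)\<^sup>2)) (at t)"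
      by (simp only:)
    then show ?thesis by (rule DERIV_fun_exp)
  qed
  ultimately have D: "((\<lambda>t. (t + a) powr (- k) * exp (- S / (4 * (t + a)))) has_real_derivative
      (- k * (t + a) powr (- k - 1) * 1) * exp (- S / (4 * (t + a)))
      + exp (- S / (4 * (t + a))) * (S / (4 * (t + a)\<^sup>2)) * (t + a) powr (- k)) (at t)"
    by (rule DERIV_mult)
  have "(t + a) powr (- k - 1) = (t + a) powr (- k) / (t + a)"
    using s by (simp add: powr_diff)
  with D show ?thesis
    unfolding gauss_def k_def[symmetric] S_def[symmetric]
    by (rule_tac DERIV_cong[OF D]) (simp add: k_def algebra_simps)
qed

text \<open>The kernel solves the heat equation, so only the gradient term of the defect survives.
  Starting at age a > 0 keeps it bounded and regular down to t = 0.\<close>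

lemma gauss_hj:
  fixes x0 :: "'a::euclidean_space"
  assumes a: "a > 0"
  defines "W \<equiv> (\<lambda>t. gauss x0 (t + a))"
  shows "hj_reg W" "t > 0 \<Longrightarrow> hj_defect q W t x = norm (grad (W t) x) powr q"
proof -
  show "hj_reg W"
    unfolding hj_reg_def
  proof (intro allI impI ballI conjI)
    fix t :: real and x b :: 'a assume t: "0 < t" and b: "b \<in> Basis"
    have "t + a > 0" using t a by simp
    then show "has_pd b (W t) x" "has_pd b (pd b (W t)) x"
      unfolding W_def by (rule gauss_pd(1)[OF _ b], rule gauss_pd(3)[OF _ b])
  next
    fix t :: real and x :: 'a assume t: "0 < t"
    show "(\<lambda>s. W s x) differentiable at t"
      unfolding W_def real_differentiable_def using gauss_time[of t a] t a by auto
  qed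
  assume t: "t > 0"
  then have ta: "t + a > 0" using a by simp
  show "hj_defect q W t x = norm (grad (W t) x) powr q"
    unfolding hj_defect_def W_def DERIV_imp_deriv[OF gauss_time[OF ta]] gauss_laplacian[OF ta] by simp
qed

lemma continuous_gauss:
  fixes x0 :: "'a::euclidean_space"
  assumes "a > 0"
  shows "continuous_on ({0..T} \<times> UNIV) (\<lambda>(t, x). gauss x0 (t + a) x)"
  unfolding gauss_def case_prod_unfold using assms by (intro continuous_intros) auto

text \<open>Every solution of the heat equation is a supersolution. A negative kernel alone would
  not lie above u 0, which may vanish away from x0; adding half of the kernel of age 2 a makes the
  combination nonnegative outside a ball, yet at x0 at most half of the negative part is lost at
  later times.\<close>

lemma hj_lower_decay:
  fixes u :: "real \<Rightarrow> 'a::euclidean_space \<Rightarrow> real"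
  assumes q: "1 < q" "q \<le> 2" and u: "hj_sol q u"
    and bd: "\<And>t x. 0 \<le> t \<Longrightarrow> - M \<le> u t x \<and> u t x \<le> 0" and x0: "u 0 x0 < 0"
  obtains c where "c > 0" "\<And>T. T \<ge> 1 \<Longrightarrow> u T x0 \<le> - c * T powr (- (real DIM('a) / 2))"
proof -
  define k where "k = real DIM('a) / 2"
  have k: "k > 0" by (simp add: k_def)
  define \<alpha> where "\<alpha> = - u 0 x0 / 2"
  have \<alpha>: "\<alpha> > 0" using x0 by (simp add: \<alpha>_def)
  have "continuous_on UNIV (\<lambda>x. (\<lambda>(t, x). u t x) (0, x))"
    by (rule continuous_on_compose2[OF hj_solD(3)[OF u]]) (auto intro!: continuous_intros)
  then have "isCont (u 0) x0" by (simp add: continuous_on_eq_continuous_at)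
  then obtain r where r: "r > 0" "\<And>y. dist y x0 < r \<Longrightarrow> dist (u 0 y) (u 0 x0) < \<alpha>"
    using \<alpha> unfolding continuous_at_eps_delta by metis
  have near: "u 0 y \<le> - \<alpha>" if "dist y x0 < r" for y
  proof -
    have "\<bar>u 0 y - u 0 x0\<bar> < \<alpha>" using r(2)[OF that] by (simp add: dist_real_def)
    moreover have "u 0 x0 = - 2 * \<alpha>" by (simp add: \<alpha>_def)
    ultimately show ?thesis by linarith
  qed
  \<comment> \<open>Chosen so that exp (r^2 / (8 a)) = 2 * 2^k: from distance r on, the kernel of
    age a is at most half of the one of age 2 a.\<close>
  define a where "a = r\<^sup>2 / (8 * ((1 + k) * ln 2))"
  have a: "a > 0" using r k by (simp add: a_def)
  \<comment> \<open>The maximum of the kernel of age a is a^(- k), so c times it is \<alpha>, the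
    depth of u 0 near x0.\<close>
  define c where "c = \<alpha> * a powr k"
  have c: "c > 0" using \<alpha> a by (simp add: c_def)
  define W where "W i t = gauss x0 (t + (if i then a else 2 * a))" for i :: bool and t
  define C where "C i = (if i then - c else c / 2)" for i :: bool
  define v where "v t x = (\<Sum>i\<in>UNIV. C i * W i t x) - 0 * t" for t x
  have v: "v t x = - c * gauss x0 (t + a) x + c / 2 * gauss x0 (t + 2 * a) x" for t x
    by (simp add: v_def UNIV_bool C_def W_def)
  have W: "hj_reg (W i)" for i unfolding W_def using a by (cases i) (auto intro!: gauss_hj(1))
  have Wd: "hj_defect q (W i) t x = norm (grad (W i t) x) powr q" if "t > 0" for i t x
    using gauss_hj(2)[where a = a and q = q, OF a that] gauss_hj(2)[where a = "2 * a" and q = q, OF _ that] a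
    unfolding W_def by (cases i) auto
  note S = hj_defect_sum[where I = UNIV and W = W and c = C and K = 0, OF W, folded v_def]
  have far: "gauss x0 a x \<le> 1 / 2 * gauss x0 (2 * a) x" if "r \<le> norm (x - x0)" for x
  proof -
    define S where "S = (x - x0) \<bullet> (x - x0)"
    have "r\<^sup>2 \<le> S" unfolding S_def power2_norm_eq_inner[symmetric] using that r by (intro power_mono) auto
    moreover have "(1 + k) * ln 2 * (8 * a) = r\<^sup>2" using k by (simp add: a_def)
    ultimately have "(1 + k) * ln 2 \<le> S / (8 * a)"
      using a by (simp add: pos_le_divide_eq)
    then have "exp ((1 + k) * ln 2) \<le> exp (S / (8 * a))" by simp
    then have e: "2 * 2 powr k \<le> exp (S / (8 * a))"
      by (simp add: powr_def distrib_right exp_add)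
    have "gauss x0 a x = a powr (- k) * exp (- S / (4 * a))" by (simp add: gauss_def k_def S_def)
    also have "exp (- S / (4 * a)) = exp (- S / (8 * a)) / exp (S / (8 * a))"
      by (simp flip: exp_diff)
    also have "\<dots> \<le> exp (- S / (8 * a)) / (2 * 2 powr k)"
      using e by (intro divide_left_mono) auto
    also have "a powr (- k) * (exp (- S / (8 * a)) / (2 * 2 powr k)) = 1 / 2 * gauss x0 (2 * a) x"
      using a by (simp add: gauss_def k_def[symmetric] S_def[symmetric] powr_mult powr_minus field_simps)
    finally show ?thesis using a by (simp add: mult_left_mono)
  qed
  define M' where "M' = M + c * a powr (- k) + c * (2 * a) powr (- k)"
  have M0: "M \<ge> 0" using bd[of 0 x0] x0 by linarith
  have main: "u T x0 \<le> v T x0 + 0" if T: "0 \<le> T" for T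
  proof (rule hj_comparison[where w = u and v = v and M = M', OF q T])
    show "hj_reg u" by (rule hj_solD(1)[OF u])
    show "hj_defect q u t x \<le> 0" if "t > 0" for t x using hj_solD(4)[OF u that] by simp
    show "continuous_on ({0..T} \<times> UNIV) (\<lambda>(t, x). u t x)"
      by (rule continuous_on_subset[OF hj_solD(3)[OF u]]) auto
    show "\<bar>u t x\<bar> \<le> M'" if "0 \<le> t" "t \<le> T" for t x
    proof -
      have "0 \<le> c * a powr (- k)" "0 \<le> c * (2 * a) powr (- k)" using c by auto
      then show ?thesis using bd[OF that(1), of x] unfolding M'_def by linarith
    qed
    show "hj_reg v" using S(1) unfolding v_def[abs_def] .
    show "hj_defect q v t x \<ge> 0" if "t > 0" for t x
      using S(2)[OF that, of q x] Wd[OF that] by (simp add: v_def[abs_def])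
    show "continuous_on ({0..T} \<times> UNIV) (\<lambda>(t, x). v t x)"
      using continuous_gauss[OF a, of T x0] continuous_gauss[of "2 * a" T x0] a
      unfolding v case_prod_unfold by (intro continuous_intros) auto
    show "\<bar>v t x\<bar> \<le> M'" if "0 \<le> t" "t \<le> T" for t x
    proof -
      have g: "0 \<le> gauss x0 (t + d) x \<and> gauss x0 (t + d) x \<le> d powr (- k)" if "d > 0" for d
      proof -
        have "gauss x0 (t + d) x \<le> (t + d) powr (- k)"
          unfolding k_def using that \<open>0 \<le> t\<close> by (intro gauss_le) auto
        also have "\<dots> \<le> d powr (- k)" using that \<open>0 \<le> t\<close> k by (intro powr_mono2') auto
        finally show ?thesis using gauss_pos[of "t + d" x0 x] that \<open>0 \<le> t\<close> by simp
      qed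
      have "c * gauss x0 (t + a) x \<le> c * a powr (- k)" "c * gauss x0 (t + 2 * a) x \<le> c * (2 * a) powr (- k)"
        "0 \<le> c * gauss x0 (t + a) x" "0 \<le> c * gauss x0 (t + 2 * a) x"
        using c g[of a] g[of "2 * a"] a by (auto intro: mult_left_mono)
      moreover have "v t x = - (c * gauss x0 (t + a) x) + 1 / 2 * (c * gauss x0 (t + 2 * a) x)"
        by (simp add: v)
      ultimately show ?thesis unfolding M'_def using M0 by linarith
    qed
    show "u 0 x \<le> v 0 x + 0" for x
    proof (cases "norm (x - x0) < r")
      case True
      have "c * gauss x0 a x \<le> c * a powr (- k)"
        unfolding k_def using c a by (intro mult_left_mono gauss_le) auto
      also have "\<dots> = \<alpha>" using a by (simp add: c_def powr_minus)
      finally have "c * gauss x0 a x \<le> \<alpha>" .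
      moreover have "0 \<le> c / 2 * gauss x0 (2 * a) x" using gauss_pos[of "2 * a" x0 x] a c by simp
      ultimately show ?thesis using near[of x] True by (simp add: v dist_norm)
    next
      case False
      then have "c * gauss x0 a x \<le> c * (1 / 2 * gauss x0 (2 * a) x)"
        using far[of x] c by (intro mult_left_mono) auto
      then show ?thesis using bd[of 0 x] by (simp add: v)
    qed
  qed
  show ?thesis
  proof (rule that[of "c / 2 * (1 + a) powr (- k)"])
    show "c / 2 * (1 + a) powr (- k) > 0" using c a by simp
    fix T :: real assume T: "T \<ge> 1"
    have "(T + 2 * a) powr (- k) \<le> (T + a) powr (- k)" using T a k by (intro powr_mono2') auto
    then have "c / 2 * (T + 2 * a) powr (- k) \<le> c / 2 * (T + a) powr (- k)" using c by (intro mult_left_mono) auto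
    moreover have "u T x0 \<le> - c * (T + a) powr (- k) + c / 2 * (T + 2 * a) powr (- k)"
      using main[of T] T by (simp add: v gauss_def k_def)
    ultimately have 1: "u T x0 \<le> - (c / 2 * (T + a) powr (- k))" by linarith
    \<comment> \<open>For T \<ge> 1 the shift by a is absorbed into a constant factor.\<close>
    have "T * (1 + a) \<ge> T + a" using T a by (simp add: algebra_simps)
    then have "(T * (1 + a)) powr (- k) \<le> (T + a) powr (- k)" using T a k by (intro powr_mono2') auto
    then have "T powr (- k) * (1 + a) powr (- k) \<le> (T + a) powr (- k)" using T a by (simp add: powr_mult)
    then have "c / 2 * (T powr (- k) * (1 + a) powr (- k)) \<le> c / 2 * (T + a) powr (- k)"
      using c by (intro mult_left_mono) auto
    with 1 show "u T x0 \<le> - (c / 2 * (1 + a) powr (- k)) * T powr (- (real DIM('a) / 2))"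
      unfolding k_def by (simp add: algebra_simps)
  qed
qed

section \<open>Non-extinction\<close>

lemma hj_const:
  fixes k :: real
  shows "hj_reg (\<lambda>t (x::'a::euclidean_space). k)" "hj_defect q (\<lambda>t (x::'a). k) t x = 0"
proof -
  have p: "has_pd b (\<lambda>x::'a. c) x" "pd b (\<lambda>x::'a. c) = (\<lambda>_. 0)" for b :: 'a and c :: real and x
    by (auto simp: has_pd_def pd_def fun_eq_iff)
  show "hj_reg (\<lambda>t (x::'a). k)" unfolding hj_reg_def by (auto simp: p)
  show "hj_defect q (\<lambda>t (x::'a). k) t x = 0" by (simp add: hj_defect_def laplacian_def grad_def p)
qed

lemma hj_bounds_persist:
  fixes u :: "real \<Rightarrow> 'a::euclidean_space \<Rightarrow> real"
  assumes q: "1 < q" "q \<le> 2" and u: "hj_sol q u" and M: "\<And>t x. 0 \<le> t \<Longrightarrow> \<bar>u t x\<bar> \<le> M" and T: "0 \<le> T"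
  shows "(\<And>x. u 0 x \<le> k) \<Longrightarrow> u T x \<le> k" "(\<And>x. k \<le> u 0 x) \<Longrightarrow> k \<le> u T x"
proof -
  define M' where "M' = max M \<bar>k\<bar>"
  have M': "\<bar>u t x\<bar> \<le> M'" if "0 \<le> t" for t x using M[OF that, of x] by (simp add: M'_def)
  have cont: "continuous_on ({0..T} \<times> UNIV) (\<lambda>(t, x). u t x)"
    by (rule continuous_on_subset[OF hj_solD(3)[OF u]]) auto
  have ck: "continuous_on ({0..T} \<times> UNIV) (\<lambda>(t::real, x::'a). k)" by (simp add: case_prod_unfold)
  have d: "t > 0 \<Longrightarrow> hj_defect q u t x = 0" for t x by (rule hj_solD(4)[OF u])
  have k: "\<bar>k\<bar> \<le> M'" by (simp add: M'_def)
  show "u T x \<le> k" if "\<And>x. u 0 x \<le> k"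
    using hj_comparison[where w = u and v = "\<lambda>_ _. k" and M = M' and D = 0 and x = x, OF q T hj_solD(1)[OF u] _ cont _ hj_const(1) _ ck]
      d M' k that by (auto simp: hj_const(2))
  show "k \<le> u T x" if "\<And>x. k \<le> u 0 x"
    using hj_comparison[where v = u and w = "\<lambda>_ _. k" and M = M' and D = 0 and x = x, OF q T hj_const(1) _ ck _ hj_solD(1)[OF u] _ cont]
      d M' k that by (auto simp: hj_const(2))
qed

text \<open>The factor \<open>2\<^sup>2\<^sup>/\<^sup>q = 2 * 2\<^sup>\<alpha>\<close> comes from switching between the two bounds for \<open>\<Delta>u\<close> at the time \<open>\<parallel>u\<^sub>0\<parallel> / (2 A)\<close>.\<close>

definition thr_const :: "real \<Rightarrow> real \<Rightarrow> real" where
  "thr_const q n = 2 powr (2 / q) * (lap_const q n / (2 / q - 1))"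

lemma lap_const_pos: "1 < q \<Longrightarrow> q < 2 \<Longrightarrow> n > 0 \<Longrightarrow> lap_const q n > 0"
proof -
  assume q: "1 < q" "q < 2" "n > 0"
  have "grad_const q > 0" by (simp add: grad_const_def add_pos_nonneg)
  then show ?thesis unfolding lap_const_def using q by (intro divide_pos_pos mult_pos_pos) auto
qed

lemma hj_time_derivative_le:
  assumes u: "hj_sol q u" and t: "t > 0"
  shows "((\<lambda>s. u s x) has_real_derivative deriv (\<lambda>s. u s x) t) (at t)"
    "deriv (\<lambda>s. u s x) t \<le> laplacian (u t) x"
proof -
  show "((\<lambda>s. u s x) has_real_derivative deriv (\<lambda>s. u s x) t) (at t)"
    by (rule hj_regD(1)[OF hj_solD(1)[OF u] t])
  have "0 \<le> norm (grad (u t) x) powr q" by simp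
  then show "deriv (\<lambda>s. u s x) t \<le> laplacian (u t) x"
    using hj_solD(4)[OF u t, of x] unfolding hj_defect_def by linarith
qed

text \<open>Up to T = m / (2 A) the bound A lets v rise by at most m / 2. Afterwards the decaying
  bound integrates to B / a * T^(- a) = C / a * (2 A)^a, in which m cancels; the threshold says
  exactly that this is less than m / 2. The infimum - m need not be attained, so the argument
  follows a point where v 0 is close to it.\<close>

lemma hj_nonextinction:
  fixes v :: "real \<Rightarrow> 'a::euclidean_space \<Rightarrow> real"
  assumes q: "1 < q" "q < 2" and v: "hj_sol q v" and m: "m > 0"
    and bd: "\<And>t x. 0 \<le> t \<Longrightarrow> - m \<le> v t x \<and> v t x \<le> 0"
    and inf: "\<And>e. e > 0 \<Longrightarrow> \<exists>x. v 0 x < - m + e"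
    and A: "A > 0" "\<And>t x. t > 0 \<Longrightarrow> laplacian (v t) x \<le> A"
    and thr: "m * A powr (1 - 2 / q) > thr_const q (real DIM('a))"
  obtains \<delta> T x where "\<delta> > 0" "T > 0" "\<And>t. t \<ge> T \<Longrightarrow> v t x \<le> - \<delta>"
proof -
  define a where "a = 2 / q - 1"
  have a: "a > 0" using q by (simp add: a_def)
  define C where "C = lap_const q (real DIM('a))"
  have C: "C > 0" unfolding C_def using lap_const_pos[OF q] by simp
  define T where "T = m / (2 * A)"
  have T: "T > 0" using m A by (simp add: T_def)
  define B where "B = C * m powr a"
  have B: "B > 0" using C m by (simp add: B_def)
  have tail: "B / a * T powr (- a) = C / a * 2 powr a * A powr a"
  proof -
    have "T powr (- a) = m powr (- a) * (2 * A) powr a"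
      using m A by (simp add: T_def powr_divide powr_minus field_simps)
    also have "(2 * A) powr a = 2 powr a * A powr a" using A by (simp add: powr_mult)
    finally have "B / a * T powr (- a) = C / a * (m powr a * m powr (- a)) * (2 powr a * A powr a)"
      by (simp add: B_def)
    also have "m powr a * m powr (- a) = 1" using m by (simp flip: powr_add)
    finally show ?thesis by (simp add: mult.assoc)
  qed
  have small: "C / a * 2 powr a * A powr a < m / 2"
  proof -
    have "1 - 2 / q = - a" by (simp add: a_def)
    then have "thr_const q (real DIM('a)) < m * A powr (- a)" using thr by simp
    then have "thr_const q (real DIM('a)) * A powr a < m * A powr (- a) * A powr a" using A by simp
    also have "m * A powr (- a) * A powr a = m" using A by (simp add: powr_minus)
    also have "thr_const q (real DIM('a)) = 2 * (C / a * 2 powr a)"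
    proof -
      have "2 / q = 1 + a" by (simp add: a_def)
      then have "2 powr (2 / q) = 2 * 2 powr a" by (simp only: powr_add) simp
      then show ?thesis by (simp add: thr_const_def C_def a_def)
    qed
    finally show ?thesis by (simp add: mult_ac)
  qed
  \<comment> \<open>The gap in the budget is 2 \<delta>: one \<delta> covers the distance of v 0 x
    from - m, the other remains.\<close>
  define \<delta> where "\<delta> = (m / 2 - C / a * 2 powr a * A powr a) / 2"
  have \<delta>: "\<delta> > 0" using small by (simp add: \<delta>_def)
  obtain x where x: "v 0 x < - m + \<delta>" using inf[OF \<delta>] by blast
  have "v T x - A * T \<le> v 0 x - A * 0"
  proof (rule DERIV_nonpos_imp_decreasing_open[where f = "\<lambda>t. v t x - A * t"])
    show "0 \<le> T" using T by simp
    fix t assume t: "0 < t" "t < T"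
    show "\<exists>y. ((\<lambda>t. v t x - A * t) has_real_derivative y) (at t) \<and> y \<le> 0"
    proof (intro exI conjI)
      show "((\<lambda>t. v t x - A * t) has_real_derivative deriv (\<lambda>s. v s x) t - A * 1) (at t)"
        by (intro DERIV_diff DERIV_cmult DERIV_ident hj_time_derivative_le(1)[OF v t(1)])
      show "deriv (\<lambda>s. v s x) t - A * 1 \<le> 0"
        using hj_time_derivative_le(2)[OF v t(1), of x] A(2)[OF t(1), of x] by simp
    qed
  next
    have "continuous_on {0..T} (\<lambda>t. (\<lambda>(t, x). v t x) (t, x))"
      by (rule continuous_on_compose2[OF hj_solD(3)[OF v]]) (auto intro!: continuous_intros)
    then show "continuous_on {0..T} (\<lambda>t. v t x - A * t)"
      by (intro continuous_intros) simp
  qed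
  moreover have "A * T = m / 2" using A by (simp add: T_def)
  ultimately have vT: "v T x < - m / 2 + \<delta>" using x by simp
  have "v t x \<le> - \<delta>" if t: "t \<ge> T" for t
  proof -
    \<comment> \<open>The added term is the integral of the decaying Laplacian bound from s to
      infinity, so f is nonincreasing.\<close>
    define f where "f s = v s x + B / a * s powr (- a)" for s
    have "f t \<le> f T"
    proof (rule DERIV_nonpos_imp_nonincreasing[OF t])
      fix s assume s: "T \<le> s" "s \<le> t"
      then have s0: "s > 0" using T by simp
      show "\<exists>y. (f has_real_derivative y) (at s) \<and> y \<le> 0"
      proof (intro exI conjI)
        have "((\<lambda>s. s powr (- a)) has_real_derivative - a * s powr (- a - 1)) (at s)"
          using s0 by (auto intro!: derivative_eq_intros)
        then show "(f has_real_derivative deriv (\<lambda>s. v s x) s + B / a * (- a * s powr (- a - 1))) (at s)"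
          unfolding f_def by (intro DERIV_add DERIV_cmult hj_time_derivative_le(1)[OF v s0])
        have "laplacian (v s) x \<le> C * m powr (2 / q - 1) * s powr (- (2 / q))"
          unfolding C_def by (rule hj_laplacian_decay[OF q v m bd s0])
        also have "\<dots> = B * s powr (- a - 1)" by (simp add: B_def a_def)
        finally show "deriv (\<lambda>s. v s x) s + B / a * (- a * s powr (- a - 1)) \<le> 0"
          using hj_time_derivative_le(2)[OF v s0, of x] a by simp
      qed
    qed
    moreover have "B / a * t powr (- a) \<ge> 0" using B a by simp
    ultimately have "v t x \<le> v T x + B / a * T powr (- a)" unfolding f_def by linarith
    also have "\<dots> \<le> - \<delta>" using vT unfolding tail \<delta>_def by (simp add: field_simps)
    finally show ?thesis .
  qed
  then show ?thesis using that[OF \<delta> T] by blast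
qed

section \<open>Sup norms of solutions, the limit, and the two regimes of q\<close>

lemma Linf_norm_continuous:
  fixes f :: "'a::euclidean_space \<Rightarrow> real"
  assumes f: "continuous_on UNIV f" and B: "\<And>x. \<bar>f x\<bar> \<le> B"
  shows "\<bar>f x\<bar> \<le> Linf_norm f" "Linf_norm f \<le> B" "Linf_enorm f < \<infinity>"
proof -
  have meas: "f \<in> borel_measurable lebesgue"
    using borel_measurable_continuous_onI[OF f] by (simp add: measurable_completion)
  have le: "Linf_enorm f \<le> ereal B"
    unfolding Linf_enorm_def using B meas by (intro esssup_I) auto
  then show fin: "Linf_enorm f < \<infinity>" by auto
  have "AE x in lebesgue. \<bar>f x\<bar> \<le> Linf_norm f"
    using AE_norm_le_Linf_norm[OF fin] by simp
  then show "\<bar>f x\<bar> \<le> Linf_norm f"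
    by (rule AE_continuous_le[rotated]) (intro continuous_intros f)
  have "B \<ge> 0" using B[of 0] by simp
  then show "Linf_norm f \<le> B"
    using le unfolding Linf_norm_def by (cases "Linf_enorm f") auto
qed

lemma antimono_tendsto_pos:
  fixes f :: "real \<Rightarrow> real"
  assumes mono: "\<And>s t. 0 < s \<Longrightarrow> s \<le> t \<Longrightarrow> f t \<le> f s" and d: "d > 0" and T: "T > 0" and low: "\<And>t. t \<ge> T \<Longrightarrow> d \<le> f t"
  shows "\<exists>L>0. (f \<longlongrightarrow> L) at_top"
proof -
  define L where "L = Inf (f ` {T..})"
  have bdd: "bdd_below (f ` {T..})" using low by (intro bdd_belowI[of _ d]) auto
  have L: "L \<le> f t" if "t \<ge> T" for t unfolding L_def using that by (intro cInf_lower bdd) auto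
  have "d \<le> L" unfolding L_def by (rule cInf_greatest) (use low in auto)
  moreover have "(f \<longlongrightarrow> L) at_top"
  proof (rule order_tendstoI)
    fix a assume "a < L"
    then show "\<forall>\<^sub>F x in at_top. a < f x"
      using L by (intro eventually_at_top_linorderI[of T]) (auto intro: less_le_trans)
  next
    fix a assume "L < a"
    then obtain s where s: "s \<ge> T" "f s < a"
      unfolding L_def using cInf_lessD[of "f ` {T..}" a] by auto
    then show "\<forall>\<^sub>F x in at_top. f x < a"
    proof (intro eventually_at_top_linorderI[of s])
      fix t assume "s \<le> t"
      then have "f t \<le> f s" using mono[of s t] s(1) T by simp
      then show "f t < a" using s(2) by simp
    qed
  qed
  ultimately show ?thesis using d by (intro exI[of _ L]) auto
qed

text \<open>With \<alpha> = 2 / q - 1 the claim is N / 2 < \<alpha> (1 + \<alpha>), that is n q^2 +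
  4 q - 8 < 0, whose positive root is 4 / (1 + sqrt (1 + 2 n)). It compares the decay rate of the
  norm with that of the Laplacian bound raised to the power \<alpha>.\<close>

lemma small_exponent:
  fixes n q :: real
  assumes q: "1 < q" and n: "n \<ge> 1" and lt: "q < 4 / (1 + sqrt (1 + 2 * n))"
  shows "n / 2 < (2 / q - 1) * (2 / q)"
proof -
  define R where "R = sqrt (1 + 2 * n)"
  have R2: "R\<^sup>2 = 1 + 2 * n" using n by (simp add: R_def)
  have R: "R > 1" using n by (simp add: R_def)
  have qR: "q * (R + 1) < 4" using lt R by (simp add: R_def[symmetric] pos_less_divide_eq add.commute)
  have "n * q\<^sup>2 * 2 = (R - 1) * q * (q * (R + 1))"
  proof -
    have "n * 2 = (R - 1) * (R + 1)" using R2 by (simp add: power2_eq_square algebra_simps)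
    then show ?thesis by (simp add: power2_eq_square mult_ac)
  qed
  also have "\<dots> < (R - 1) * q * 4" using R q qR by (intro mult_strict_left_mono) auto
  also have "\<dots> = 4 * (q * (R + 1)) - 8 * q" by (simp add: algebra_simps)
  also have "\<dots> < 16 - 8 * q" using qR by simp
  finally have "n * q\<^sup>2 < 8 - 4 * q" by simp
  then have "n / 2 < (4 - 2 * q) / q\<^sup>2" using q by (simp add: pos_less_divide_eq)
  also have "\<dots> = (2 / q - 1) * (2 / q)" using q by (simp add: power2_eq_square field_simps)
  finally show ?thesis .
qed

text \<open>Walk averages are the vehicle: at time 0 they bound u 0 uniformly in x, as comparison
  requires; comparison moves the bound to time t, where the regularity of u t allows the Laplacian
  to be read off.\<close>

lemma laplacian_bound_persists:
  fixes u :: "real \<Rightarrow> 'a::euclidean_space \<Rightarrow> real"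
  assumes q: "1 < q" "q \<le> 2" and u: "hj_sol q u" and M: "\<And>t x. 0 \<le> t \<Longrightarrow> \<bar>u t x\<bar> \<le> M"
    and ae: "AE x in lebesgue. u 0 x = u0 x" and W: "W_inf 2 u0"
    and A: "AE x in lebesgue. weak_laplacian u0 x \<le> A" and t: "t > 0"
  shows "laplacian (u t) x \<le> A"
proof (rule laplacian_le_from_axis_avg)
  have C2: "C_k 2 (u t)" using hj_solD(2)[OF u] t by (simp add: C21_def)
  show "\<bar>u t x\<bar> \<le> M" for x using M t by simp
  show "has_pd b (u t) x" if "b \<in> Basis" for b x using C2 that by (simp add: eval_nat_numeral)
  show "has_pd b (pd b (u t)) x" if "b \<in> Basis" for b x using C2 that by (simp add: eval_nat_numeral)
  show "continuous_on UNIV (pd b (pd b (u t)))" if "b \<in> Basis" for b using C2 that by (simp add: eval_nat_numeral)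
  fix s e :: real assume s: "s > 0" and e: "e > 0"
  have "continuous_on UNIV (\<lambda>x. (\<lambda>(t, x). u t x) (0, x))"
    by (rule continuous_on_compose2[OF hj_solD(3)[OF u]]) (auto intro!: continuous_intros)
  then have U: "continuous_on UNIV (u 0)" by simp
  obtain d where d: "d > 0" "\<And>h n x. 0 < h \<Longrightarrow> h \<le> d \<Longrightarrow> real n * h\<^sup>2 = s \<Longrightarrow>
      (axis_avg h ^^ n) (u 0) x \<le> u 0 x + s / (2 * real DIM('a)) * A + e"
    using weak_laplacian_axis_avg[OF U M[of 0] ae W A s e] by auto
  show "\<exists>d>0. \<forall>h n. 0 < h \<longrightarrow> h \<le> d \<longrightarrow> real n * h\<^sup>2 = s \<longrightarrow>
      (axis_avg h ^^ n) (u t) x \<le> u t x + s / (2 * real DIM('a)) * A + e"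
  proof (intro exI[of _ d] conjI allI impI d(1))
    fix h n assume h: "0 < h" "h \<le> d" "real n * h\<^sup>2 = s"
    have "(axis_avg h ^^ n) (u t) x \<le> u t x + (s / (2 * real DIM('a)) * A + e)"
      by (rule axis_avg_comparison[OF q u M]) (use t d(2)[OF h] in \<open>auto simp: add.assoc\<close>)
    then show "(axis_avg h ^^ n) (u t) x \<le> u t x + s / (2 * real DIM('a)) * A + e" by simp
  qed
qed

lemma is_solution_properties:
  fixes u :: "real \<Rightarrow> 'a::euclidean_space \<Rightarrow> real"
  assumes q: "1 < q" "q < 2" and W: "W_inf 1 u0" and np: "AE x in lebesgue. u0 x \<le> 0"
    and nz: "\<not> (AE x in lebesgue. u0 x = 0)" and sol: "is_solution q u0 u"
  shows "hj_sol q u" "Linf_norm u0 = Linf_norm (u 0)" "AE x in lebesgue. u 0 x = u0 x"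
    "\<And>t. 0 \<le> t \<Longrightarrow> continuous_on UNIV (u t)"
    "\<And>t x. 0 \<le> t \<Longrightarrow> - Linf_norm u0 \<le> u t x \<and> u t x \<le> 0"
    "\<exists>x. u 0 x < 0"
proof -
  note cs = sol[unfolded is_solution_def, THEN conjunct1, unfolded classical_solution_def]
  show u: "hj_sol q u" 
    unfolding hj_sol_def hj_defect_def
    by (intro conjI cs[THEN conjunct1] cs[THEN conjunct2, THEN conjunct1] cs[THEN conjunct2, THEN conjunct2, THEN conjunct1])
  show ae: "AE x in lebesgue. u 0 x = u0 x" 
    by (rule cs[THEN conjunct2, THEN conjunct2, THEN conjunct2])
  show cont: "continuous_on UNIV (u t)" if "0 \<le> t" for t
  proof -
    have "continuous_on UNIV (\<lambda>x. (\<lambda>(t, x). u t x) (t, x))"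
      by (rule continuous_on_compose2[OF hj_solD(3)[OF u]]) (use that in \<open>auto intro!: continuous_intros\<close>)
    then show ?thesis by simp
  qed
  have L: "Linf u0" using W by simp
  then have fin: "Linf_enorm u0 < \<infinity>" by (simp add: Linf_def)
  have meas0: "u 0 \<in> borel_measurable lebesgue"
    using borel_measurable_continuous_onI[OF cont[of 0]] by (simp add: measurable_completion)
  have "Linf_enorm (u 0) = Linf_enorm u0"
    unfolding Linf_enorm_def
  proof (rule esssup_AE_cong)
    show "(\<lambda>x. ereal (norm (u 0 x))) \<in> borel_measurable lebesgue" using meas0 by simp
    have "u0 \<in> borel_measurable lebesgue" using L by (simp add: Linf_def)
    then show "(\<lambda>x. ereal (norm (u0 x))) \<in> borel_measurable lebesgue" by simp
    show "AE x in lebesgue. ereal (norm (u 0 x)) = ereal (norm (u0 x))" using ae by eventually_elim simp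
  qed
  then show eq0: "Linf_norm u0 = Linf_norm (u 0)" by (simp add: Linf_norm_def)
  \<comment> \<open>\<open>is_solution\<close> bounds u t for t > 0 only; at t = 0 the norms agree
    because u 0 equals u0 almost everywhere.\<close>
  have le: "Linf_enorm (u t) \<le> Linf_enorm u0" if "0 \<le> t" for t
    using sol that \<open>Linf_enorm (u 0) = Linf_enorm u0\<close> unfolding is_solution_def by (cases "t = 0") auto
  have bound: "\<bar>u t x\<bar> \<le> Linf_norm u0" if t: "0 \<le> t" for t x
  proof -
    have "AE x in lebesgue. ereal (norm (u t x)) \<le> Linf_enorm (u t)"
      unfolding Linf_enorm_def by (rule esssup_AE)
    then have "AE x in lebesgue. \<bar>u t x\<bar> \<le> Linf_norm u0"
    proof eventually_elim
      case (elim x)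
      then have "ereal (norm (u t x)) \<le> Linf_enorm u0" using le[OF t] by (rule order_trans)
      then show ?case using fin unfolding Linf_norm_def by (cases "Linf_enorm u0") auto
    qed
    then show ?thesis by (rule AE_continuous_le[rotated]) (intro continuous_intros cont t)
  qed
  have "AE x in lebesgue. u 0 x \<le> 0" using ae np by eventually_elim simp
  then have np0: "u 0 x \<le> 0" for x by (rule AE_continuous_le[OF cont[of 0], rotated]) simp
  show "- Linf_norm u0 \<le> u t x \<and> u t x \<le> 0" if t: "0 \<le> t" for t x
    using bound[OF t, of x] hj_bounds_persist(1)[OF q(1) _ u bound t, of 0 x] np0 q by auto
  show "\<exists>x. u 0 x < 0"
  proof (rule ccontr)
    assume "\<not> (\<exists>x. u 0 x < 0)"
    then have "u 0 x = 0" for x using np0[of x] by (meson antisym_conv2 not_less_iff_gr_or_eq)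
    then have "AE x in lebesgue. u0 x = 0" using ae by auto
    then show False using nz by simp
  qed
qed

lemma near_infimum:
  fixes f :: "'a::euclidean_space \<Rightarrow> real"
  assumes f: "continuous_on UNIV f" "\<And>x. - Linf_norm f \<le> f x \<and> f x \<le> 0" and e: "e > 0"
  shows "\<exists>x. f x < - Linf_norm f + e"
proof (rule ccontr)
  assume neg: "\<not> (\<exists>x. f x < - Linf_norm f + e)"
  have "\<bar>f x\<bar> \<le> Linf_norm f - e" for x
  proof -
    have "\<not> f x < - Linf_norm f + e" using neg by blast
    then show ?thesis using f(2)[of x] by linarith
  qed
  then have "Linf_norm f \<le> Linf_norm f - e" by (rule Linf_norm_continuous(2)[OF f(1)])
  then show False using e by simp
qed

text \<open>One point at which u stays below - \<delta> keeps the norm above \<delta>. Restarting at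
  time s and comparing with the constant given by the norm of u s shows that the norm is
  nonincreasing.\<close>

lemma is_solution_Linf_limit:
  fixes u :: "real \<Rightarrow> 'a::euclidean_space \<Rightarrow> real"
  assumes q: "1 < q" "q < 2" and W: "W_inf 1 u0" and np: "AE x in lebesgue. u0 x \<le> 0"
    and nz: "\<not> (AE x in lebesgue. u0 x = 0)" and sol: "is_solution q u0 u"
    and low: "\<delta> > 0" "T > 0" "\<And>t. t \<ge> T \<Longrightarrow> u t x \<le> - \<delta>"
  shows "\<exists>L>0. ((\<lambda>t. Linf_norm (u t)) \<longlongrightarrow> L) at_top"
proof (rule antimono_tendsto_pos[where d = \<delta> and T = T])
  note P = is_solution_properties[OF q W np nz sol]
  have bd: "\<bar>u t x\<bar> \<le> Linf_norm u0" if "0 \<le> t" for t x using P(5)[OF that, of x] by simp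
  show "\<delta> \<le> Linf_norm (u t)" if "t \<ge> T" for t
  proof -
    have t: "0 \<le> t" using that low(2) by simp
    have "\<bar>u t x\<bar> \<le> Linf_norm (u t)" by (rule Linf_norm_continuous(1)[OF P(4)[OF t] bd[OF t]])
    then show ?thesis using low(3)[OF that] by simp
  qed
  show "Linf_norm (u t) \<le> Linf_norm (u s)" if st: "0 < s" "s \<le> t" for s t
  proof -
    have us: "\<bar>u s x\<bar> \<le> Linf_norm (u s)" for x
      using st by (intro Linf_norm_continuous(1)[OF P(4) bd]) auto
    have low: "- Linf_norm (u s) \<le> u ((t - s) + s) x" for x
    proof (rule hj_bounds_persist(2)[OF q(1) _ hj_sol_shift_time[OF P(1), of s]])
      show "- Linf_norm (u s) \<le> u (0 + s) x" for x using us[of x] by (simp add: abs_le_iff)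
      show "\<bar>u (t + s) x\<bar> \<le> Linf_norm u0" if "0 \<le> t" for t x using bd that st by simp
    qed (use q st in auto)
    show ?thesis
    proof (rule Linf_norm_continuous(2)[OF P(4)])
      show "\<bar>u t x\<bar> \<le> Linf_norm (u s)" for x
        using low[of x] P(5)[of t x] st us[of x] by (simp add: abs_le_iff)
    qed (use st in simp)
  qed
qed (use low in auto)

theorem theorem2p5:
  fixes q :: real
  assumes "1 < q" and "q \<le> q_crit DIM('a::euclidean_space)"
  shows "\<exists>K\<ge>0.
    (\<forall>(u0 :: 'a \<Rightarrow> real) (u :: real \<Rightarrow> 'a \<Rightarrow> real).
       integrable lebesgue u0 \<longrightarrow> W_inf 1 u0 \<longrightarrow>
       (AE x in lebesgue. u0 x \<le> 0) \<longrightarrow> \<not> (AE x in lebesgue. u0 x = 0) \<longrightarrow>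
       is_solution q u0 u \<longrightarrow>
       W_inf 2 u0 \<longrightarrow>
       Linf_norm u0 * Linf_norm (\<lambda>x. max (weak_laplacian u0 x) 0) powr (1 - 2 / q) > K \<longrightarrow>
       (\<exists>L>0. ((\<lambda>t. Linf_norm (u t)) \<longlongrightarrow> L) at_top)) \<and>
    (DIM('a) \<le> 3 \<and> q < 4 / (1 + sqrt (1 + 2 * real DIM('a))) \<longrightarrow> K = 0)"
proof -
  define N where "N = real DIM('a)"
  have N: "N \<ge> 1" by (simp add: N_def Suc_leI)
  have "q_crit DIM('a) < 2" using N by (simp add: q_crit_def N_def[symmetric] divide_less_eq)
  then have q: "1 < q" "q < 2" using assms by auto
  then have q2: "q \<le> 2" by simp
  have thr: "thr_const q N \<ge> 0"
    unfolding thr_const_def using lap_const_pos[OF q, of N] q N by (intro mult_nonneg_nonneg divide_nonneg_nonneg) auto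
  have general: "\<exists>L>0. ((\<lambda>t. Linf_norm (u t)) \<longlongrightarrow> L) at_top"
    if W1: "W_inf 1 u0" and np: "AE x in lebesgue. u0 x \<le> 0" and nz: "\<not> (AE x in lebesgue. u0 x = 0)"
      and sol: "is_solution q u0 u" and W2: "W_inf 2 u0"
      and K: "Linf_norm u0 * Linf_norm (\<lambda>x. max (weak_laplacian u0 x) 0) powr (1 - 2 / q) > thr_const q N"
    for u0 :: "'a \<Rightarrow> real" and u
  proof -
    note P = is_solution_properties[OF q W1 np nz sol]
    define m where "m = Linf_norm u0"
    define A where "A = Linf_norm (\<lambda>x. max (weak_laplacian u0 x) 0)"
    have bd: "\<And>t x. 0 \<le> t \<Longrightarrow> - m \<le> u t x \<and> u t x \<le> 0" unfolding m_def by (rule P(5))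
    obtain x0 where "u 0 x0 < 0" using P(6) by blast
    then have m: "m > 0" using bd[of 0 x0] by simp
    have K': "m * A powr (1 - 2 / q) > thr_const q N" using K by (simp add: m_def A_def)
    \<comment> \<open>an infinite norm would be read as \<open>A = 0\<close>, and \<open>0 powr _ = 0\<close>\<close>
    then have A0: "A \<noteq> 0" using thr by auto
    then have fin: "Linf_enorm (\<lambda>x. max (weak_laplacian u0 x) 0) < \<infinity>"
      unfolding A_def Linf_norm_def by (cases "Linf_enorm (\<lambda>x. max (weak_laplacian u0 x) 0)") auto
    have AEA: "AE x in lebesgue. norm (max (weak_laplacian u0 x) 0) \<le> A"
      unfolding A_def by (rule AE_norm_le_Linf_norm[OF fin])
    \<comment> \<open>An almost everywhere valid bound on the constant function 0 holds somewhere,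
      as Lebesgue measure is not zero; this gives A \<ge> 0.\<close>
    then have "AE x in lebesgue. (\<lambda>_::'a. 0) x \<le> A" by eventually_elim (auto intro: order_trans[OF norm_ge_zero])
    then have "A \<ge> 0" using AE_continuous_le[of "\<lambda>_::'a. 0" A] by simp
    then have A: "A > 0" using A0 by simp
    have AEl: "AE x in lebesgue. weak_laplacian u0 x \<le> A" using AEA by eventually_elim auto
    have M: "\<bar>u t x\<bar> \<le> m" if "0 \<le> t" for t x using bd[OF that, of x] by simp
    have lap: "laplacian (u t) x \<le> A" if "t > 0" for t x
      by (rule laplacian_bound_persists[OF q(1) q2 P(1) M P(3) W2 AEl that])
    have inf: "\<exists>x. u 0 x < - m + e" if "e > 0" for e
      using near_infimum[of "u 0" e] P(4)[of 0] bd[of 0] that unfolding m_def P(2) by simp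
    obtain \<delta> T x where "\<delta> > 0" "T > 0" "\<And>t. t \<ge> T \<Longrightarrow> u t x \<le> - \<delta>"
      using hj_nonextinction[OF q P(1) m bd inf A lap K'[unfolded N_def]] by metis
    then show ?thesis by (rule is_solution_Linf_limit[OF q W1 np nz sol])
  qed
  have special: "\<exists>L>0. ((\<lambda>t. Linf_norm (u t)) \<longlongrightarrow> L) at_top"
    if W1: "W_inf 1 u0" and np: "AE x in lebesgue. u0 x \<le> 0" and nz: "\<not> (AE x in lebesgue. u0 x = 0)"
      and sol: "is_solution q u0 u" and small: "q < 4 / (1 + sqrt (1 + 2 * N))"
    for u0 :: "'a \<Rightarrow> real" and u
  proof -
    note P = is_solution_properties[OF q W1 np nz sol]
    define m where "m = Linf_norm u0"
    have bd: "\<And>t x. 0 \<le> t \<Longrightarrow> - m \<le> u t x \<and> u t x \<le> 0" unfolding m_def by (rule P(5))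
    obtain x0 where x0: "u 0 x0 < 0" using P(6) by blast
    have m: "m > 0" using x0 bd[of 0 x0] by simp
    have M: "\<bar>u t x\<bar> \<le> m" if "0 \<le> t" for t x using bd[OF that, of x] by simp
    obtain c where c: "c > 0" "\<And>T. T \<ge> 1 \<Longrightarrow> u T x0 \<le> - c * T powr (- (N / 2))"
      using hj_lower_decay[OF q(1) q2 P(1) bd x0] unfolding N_def by metis
    define a where "a = 2 / q - 1"
    have a: "a > 0" using q by (simp add: a_def)
    define C where "C = lap_const q N * m powr a"
    have C: "C > 0" using lap_const_pos[OF q, of N] N m by (simp add: C_def)
    \<comment> \<open>The quantity to be compared with the threshold at time T is at least k * T^e;
      e > 0 is the condition on q.\<close>
    define e where "e = a * (2 / q) - N / 2"
    have e: "e > 0" using small_exponent[OF q(1) N small] by (simp add: e_def a_def)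
    define k where "k = c * C powr (- a)"
    have k: "k > 0" using c(1) C by (simp add: k_def)
    \<comment> \<open>This makes k * T^e equal to k plus the threshold, hence strictly larger than
      it.\<close>
    define T where "T = (1 + thr_const q N / k) powr (1 / e)"
    have T1: "T \<ge> 1" unfolding T_def using thr k e by (intro ge_one_powr_ge_zero) auto
    have Te: "T powr e = 1 + thr_const q N / k"
      unfolding T_def using thr k e by (simp add: powr_powr add_nonneg_nonneg)
    define v where "v t = u (t + T)" for t
    have v: "hj_sol q v" unfolding v_def using T1 by (intro hj_sol_shift_time[OF P(1)]) simp
    define m' where "m' = Linf_norm (v 0)"
    have contv: "continuous_on UNIV (v 0)" unfolding v_def using T1 P(4) by simp
    have v0: "\<bar>v 0 x\<bar> \<le> m'" for x
      unfolding m'_def by (rule Linf_norm_continuous(1)[OF contv, of m]) (use M T1 in \<open>simp add: v_def\<close>)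
    have vM: "\<bar>v t x\<bar> \<le> m" if "0 \<le> t" for t x unfolding v_def using M that T1 by simp
    have vbd: "- m' \<le> v t x \<and> v t x \<le> 0" if "0 \<le> t" for t x
    proof
      show "- m' \<le> v t x" by (rule hj_bounds_persist(2)[OF q(1) q2 v vM that]) (use v0 in \<open>auto simp: abs_le_iff minus_le_iff\<close>)
      show "v t x \<le> 0" unfolding v_def using bd that T1 by simp
    qed
    have cm: "c * T powr (- (N / 2)) \<le> m'" using c(2)[OF T1] v0[of x0] by (simp add: v_def)
    have "c * T powr (- (N / 2)) > 0" using c(1) T1 by simp
    then have m': "m' > 0" using cm by linarith
    \<comment> \<open>The decay estimate is applied to u from time 0 on, with at least T already
      elapsed; this makes A a bound for all later times, of order T^(- 2 / q).\<close>
    define A where "A = C * T powr (- (2 / q))"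
    have A: "A > 0" using C T1 by (simp add: A_def)
    have lap: "laplacian (v t) x \<le> A" if t: "t > 0" for t x
    proof -
      have "laplacian (v t) x \<le> lap_const q N * m powr (2 / q - 1) * (t + T) powr (- (2 / q))"
        unfolding v_def N_def using t T1 by (intro hj_laplacian_decay[OF q P(1) m bd]) auto
      also have "\<dots> = C * (t + T) powr (- (2 / q))" by (simp add: C_def a_def)
      also have "\<dots> \<le> A" unfolding A_def using C T1 t q by (intro mult_left_mono powr_mono2') auto
      finally show ?thesis .
    qed
    have "thr_const q N < k * T powr e" using k by (simp add: Te distrib_left)
    also have "\<dots> = c * T powr (- (N / 2)) * (C powr (- a) * T powr (a * (2 / q)))"
    proof -
      have "T powr e = T powr (a * (2 / q)) * T powr (- (N / 2))" unfolding e_def by (simp flip: powr_add)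
      then show ?thesis by (simp add: k_def)
    qed
    also have "C powr (- a) * T powr (a * (2 / q)) = A powr (- a)"
      unfolding A_def using C T1 by (simp add: powr_mult powr_powr mult.commute)
    also have "c * T powr (- (N / 2)) * A powr (- a) \<le> m' * A powr (- a)"
      using cm by (intro mult_right_mono) auto
    finally have K': "m' * A powr (1 - 2 / q) > thr_const q (real DIM('a))" by (simp add: a_def N_def)
    have inf: "\<exists>x. v 0 x < - m' + e" if "e > 0" for e
      unfolding m'_def using near_infimum[OF contv _ that] vbd[of 0] unfolding m'_def by simp
    obtain \<delta> T' x where d: "\<delta> > 0" "T' > 0" "\<And>t. t \<ge> T' \<Longrightarrow> v t x \<le> - \<delta>"
      using hj_nonextinction[OF q v m' vbd inf A lap K'] by metis
    show ?thesis
    proof (rule is_solution_Linf_limit[OF q W1 np nz sol d(1), where T = "T' + T"])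
      show "T' + T > 0" using d(2) T1 by simp
      show "u t x \<le> - \<delta>" if "t \<ge> T' + T" for t using d(3)[of "t - T"] that by (simp add: v_def)
    qed
  qed
  show ?thesis
  \<comment> \<open>K may depend on q and the dimension. For N \<ge> 4 the quotient is at most 1, so
    the first case arises for N \<le> 3 only.\<close>
  proof (cases "q < 4 / (1 + sqrt (1 + 2 * N))")
    case True
    then show ?thesis using special by (intro exI[of _ 0]) (auto simp: N_def)
  next
    case False
    then show ?thesis using general thr by (intro exI[of _ "thr_const q N"]) (auto simp: N_def)
  qed
qed

end
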